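(* An algebraic function with parabolic signature is expressible in radicals. Moreover, for each parabolic signature there is a group $G$, depending only on the signature, such that the monodromy group of every algebraic function with this signature is a factor group of $G$ by a commutative normal subgroup.
   Context: $S=\mathbb{C}\cup\{\infty\}$ is the Riemann sphere. An algebraic function is a multivalued analytic function $y(x)$ on $S$ satisfying an irreducible polynomial equation over $\mathbb{C}(x)$; its Riemann surface is a (compact connected) branched covering of $S$. Let $A=\{a_1,\dots,a_n\}$ be its branching locus and let $r_i>1$ be the order of the local monodromy operator at $a_i$ (the element of the monodromy group, defined up to conjugation, corresponding to a small loop around $a_i$). The signature of the function is $(A,R)$ with set of orders $R=(r_1,\dots,r_n)$. Standing assumptions: $n\ge 2$, and if $n=2$ then the two orders are equal. The universal covering with signature $(A,R)$ is a branched covering $\pi:Z\to S$ with $Z$ a simply connected Riemann surface, branched over $A$ only, such that $\pi$ has multiplicity $r_k$ at every point of $\pi^{-1}(a_k)$. The signature is parabolic if $Z$ is isomorphic to the complex line $\mathbb{C}$. "Expressible in radicals" means that the function is obtained from complex rational functions of $x$ by arithmetic operations and extraction of roots of arbitrary degree. *)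

theory Defs
  imports
    "HOL-Complex_Analysis.Complex_Analysis"
    "HOL-Computational_Algebra.Polynomial_Factorial"
    "HOL-Algebra.Bij"
    "HOL-Algebra.Coset"
    "HOL-Algebra.Multiplicative_Group"
begin

section \<open>The Riemann sphere\<close>

text \<open>A point \<open>Some c\<close> is the finite point \<open>c\<close>, and \<open>None\<close> is \<open>\<infinity>\<close>.\<close>

type_synonym sphere = "complex option"

abbreviation riemann_sphere :: "sphere topology" where
  "riemann_sphere \<equiv> Alexandroff_compactification euclidean"

text \<open>
  The local coordinate centred at a point: \<open>x - c\<close> at \<open>c\<close> and \<open>1/x\<close> at \<open>\<infinity>\<close>.  It is only
  meaningful on the discs \<open>sphere_disc a e\<close>; outside them its values are junk.
\<close>

fun chart_at :: "sphere \<Rightarrow> sphere \<Rightarrow> complex" where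
  "chart_at (Some c) (Some x) = x - c"
| "chart_at (Some c) None = 0"
| "chart_at None (Some x) = inverse x"
| "chart_at None None = 0"

fun sphere_disc :: "sphere \<Rightarrow> real \<Rightarrow> sphere set" where
  "sphere_disc (Some c) e = Some ` ball c e"
| "sphere_disc None e = insert None (Some ` {x. norm x > 1 / e})"

section \<open>Signatures and parabolic signatures\<close>

text \<open>The orders are given by a function on the sphere whose values outside \<open>A\<close> are irrelevant.\<close>

definition is_signature :: "sphere set \<Rightarrow> (sphere \<Rightarrow> nat) \<Rightarrow> bool" where
  "is_signature A R \<longleftrightarrow>
     finite A \<and> card A \<ge> 2 \<and> (\<forall>a\<in>A. R a > 1) \<and>
     (card A = 2 \<longrightarrow> (\<forall>a\<in>A. \<forall>b\<in>A. R a = R b))"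

text \<open>
  A holomorphic map from the complex line to the sphere is a branched covering (in general with
  infinitely many sheets) if every point \<open>a\<close> of the sphere has a disc such that over it, on each
  component of the preimage, the map is biholomorphically equivalent to \<open>w \<mapsto> w ^ k\<close> on the unit
  disc for some \<open>k > 0\<close>.  This excludes for instance \<open>exp\<close>, whose logarithmic
  singularities over \<open>0\<close> and \<open>\<infinity>\<close> are not filled in.
\<close>

definition branched_covering :: "(complex \<Rightarrow> sphere) \<Rightarrow> bool" where
  "branched_covering \<pi> \<longleftrightarrow>
     continuous_map euclidean riemann_sphere \<pi> \<and> surj \<pi> \<and>
     (\<forall>a. \<exists>e>0. \<forall>U \<in> components (\<pi> -` sphere_disc a e).
        \<exists>k>0. \<exists>\<phi>. \<phi> holomorphic_on U \<and> bij_betw \<phi> U (ball 0 1) \<and>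
          (\<forall>z\<in>U. chart_at a (\<pi> z) = of_real e * \<phi> z ^ k))"

definition multiplicity_at :: "(complex \<Rightarrow> sphere) \<Rightarrow> complex \<Rightarrow> int" where
  "multiplicity_at \<pi> z = zorder (\<lambda>w. chart_at (\<pi> z) (\<pi> w)) z"

text \<open>
  The universal covering with signature \<open>(A, R)\<close> is determined up to isomorphism by being a branched
  covering with a simply connected total space, branched over \<open>A\<close> only, with the multiplicities
  prescribed by \<open>R\<close>.  Its total space is therefore isomorphic to the complex line if and only
  if such a covering exists with total space equal to the (simply connected) complex line.
\<close>

definition universal_covering_by_line ::
    "sphere set \<Rightarrow> (sphere \<Rightarrow> nat) \<Rightarrow> (complex \<Rightarrow> sphere) \<Rightarrow> bool" where
  "universal_covering_by_line A R \<pi> \<longleftrightarrow>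
     branched_covering \<pi> \<and>
     (\<forall>z. \<pi> z \<notin> A \<longrightarrow> multiplicity_at \<pi> z = 1) \<and>
     (\<forall>z. \<pi> z \<in> A \<longrightarrow> multiplicity_at \<pi> z = int (R (\<pi> z)))"

definition parabolic :: "sphere set \<Rightarrow> (sphere \<Rightarrow> nat) \<Rightarrow> bool" where
  "parabolic A R \<longleftrightarrow> (\<exists>\<pi>. universal_covering_by_line A R \<pi>)"

section \<open>Algebraic functions and their monodromy\<close>

text \<open>
  An algebraic function \<open>y(x)\<close> is given by its equation \<open>P(x, y) = 0\<close>, irreducible over the field
  of rational functions of \<open>x\<close>, with denominators cleared.  The outer variable of
  \<open>P\<close> is \<open>y\<close>; the coefficients are polynomials in \<open>x\<close>.
\<close>

definition algebraic_function :: "complex poly poly \<Rightarrow> bool" where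
  "algebraic_function P \<longleftrightarrow> irreducible (fract_poly P)"

definition fiber :: "complex poly poly \<Rightarrow> complex \<Rightarrow> complex set" where
  "fiber P x = {y. poly (poly P [:y:]) x = 0}"

text \<open>
  The points over which the equation has as many distinct solutions as its degree in \<open>y\<close>, that is,
  neither the leading coefficient nor the discriminant vanishes.  All but finitely many
  points of the complex line are of this kind.  Over them the curve \<open>P(x, y) = 0\<close> is an
  unramified covering, and the values in \<open>fiber P x\<close> correspond to the germs of \<open>y\<close> at \<open>x\<close>.
\<close>

definition regular_points :: "complex poly poly \<Rightarrow> complex set" where
  "regular_points P = {x. card (fiber P x) = degree P}"

text \<open>Analytic continuation of the germs of \<open>y\<close> along \<open>\<gamma>\<close>, as a map of their values.\<close>

definition monodromy ::
    "complex poly poly \<Rightarrow> (real \<Rightarrow> complex) \<Rightarrow> complex \<Rightarrow> complex" where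
  "monodromy P \<gamma> =
     restrict (\<lambda>y. THE y'. \<exists>h. path h \<and> pathstart h = y \<and> pathfinish h = y' \<and>
                             (\<forall>t\<in>{0..1}. h t \<in> fiber P (\<gamma> t)))
       (fiber P (pathstart \<gamma>))"

definition monodromy_group ::
    "complex poly poly \<Rightarrow> complex \<Rightarrow> (complex \<Rightarrow> complex) monoid" where
  "monodromy_group P x0 =
     BijGroup (fiber P x0)
       \<lparr>carrier := monodromy P `
          {\<gamma>. path \<gamma> \<and> path_image \<gamma> \<subseteq> regular_points P \<and>
              pathstart \<gamma> = x0 \<and> pathfinish \<gamma> = x0}\<rparr>"

fun small_loop :: "sphere \<Rightarrow> real \<Rightarrow> real \<Rightarrow> complex" where
  "small_loop (Some c) e = circlepath c e"
| "small_loop None e = inverse \<circ> circlepath 0 e"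

text \<open>
  The base point is taken on the small loop itself; another one changes the
  monodromy operator by a conjugation only.
\<close>

definition has_local_monodromy_order :: "complex poly poly \<Rightarrow> sphere \<Rightarrow> nat \<Rightarrow> bool" where
  "has_local_monodromy_order P a r \<longleftrightarrow>
     (\<forall>\<^sub>F e in at_right 0.
        group.ord (monodromy_group P (pathstart (small_loop a e)))
          (monodromy P (small_loop a e)) = r)"

text \<open>The points around which the local monodromy operator is not the identity.\<close>

definition branching_locus :: "complex poly poly \<Rightarrow> sphere set" where
  "branching_locus P = {a. \<not> has_local_monodromy_order P a 1}"

definition has_signature ::
    "complex poly poly \<Rightarrow> sphere set \<Rightarrow> (sphere \<Rightarrow> nat) \<Rightarrow> bool" where
  "has_signature P A R \<longleftrightarrow>
     branching_locus P = A \<and> (\<forall>a\<in>A. has_local_monodromy_order P a (R a))"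

section \<open>Expressibility in radicals\<close>

inductive radical_on :: "complex set \<Rightarrow> (complex \<Rightarrow> complex) \<Rightarrow> bool" for U where
  rational: "(\<And>x. x \<in> U \<Longrightarrow> poly q x \<noteq> 0) \<Longrightarrow> radical_on U (\<lambda>x. poly p x / poly q x)"
| add: "radical_on U f \<Longrightarrow> radical_on U g \<Longrightarrow> radical_on U (\<lambda>x. f x + g x)"
| diff: "radical_on U f \<Longrightarrow> radical_on U g \<Longrightarrow> radical_on U (\<lambda>x. f x - g x)"
| mult: "radical_on U f \<Longrightarrow> radical_on U g \<Longrightarrow> radical_on U (\<lambda>x. f x * g x)"
| divide: "radical_on U f \<Longrightarrow> radical_on U g \<Longrightarrow> (\<And>x. x \<in> U \<Longrightarrow> g x \<noteq> 0) \<Longrightarrow>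
    radical_on U (\<lambda>x. f x / g x)"
| root: "radical_on U g \<Longrightarrow> f holomorphic_on U \<Longrightarrow> n > 0 \<Longrightarrow>
    (\<And>x. x \<in> U \<Longrightarrow> f x ^ n = g x) \<Longrightarrow> radical_on U f"

text \<open>
  Every branch of \<open>y\<close> is given by a formula in radicals.  The formula is asserted on some domain \<open>U\<close>
  inside the domain of the branch, because the intermediate radicals may have zeros
  and branch points where the branch itself is regular; by uniqueness of analytic continuation it
  then holds as an identity of multivalued functions.
\<close>

definition expressible_in_radicals :: "complex poly poly \<Rightarrow> bool" where
  "expressible_in_radicals P \<longleftrightarrow>
     (\<forall>V y. open V \<and> V \<noteq> {} \<and> y holomorphic_on V \<and> (\<forall>x\<in>V. y x \<in> fiber P x) \<longrightarrow>
        (\<exists>U\<subseteq>V. open U \<and> connected U \<and> U \<noteq> {} \<and> radical_on U y))"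

end

theory Submission
  imports Defs "HOL-Computational_Algebra.Fundamental_Theorem_Algebra"
begin

text \<open>
  Let \<open>\<pi>\<close> be the universal covering with signature \<open>(A, R)\<close>, a map of the complex line onto the
  sphere, and let \<open>G\<close> be its group of deck transformations.  All points over the same \<open>a\<close> have the
  same multiplicity, so a local lift of \<open>\<pi>\<close> through itself continues along every path; the line
  is simply connected, so it becomes a global one (\<open>global_section\<close>).  Hence \<open>G\<close> acts transitively
  on the fibres of \<open>\<pi>\<close> (\<open>deck_transitive\<close>).  Biholomorphic maps of the line are affine
  (\<open>deck_affine\<close>), so the elements of \<open>G\<close> without fixed points are translations, and these commute.

  Now let \<open>y\<close> be an algebraic function with this signature.  A small circle around a point over \<open>a\<close>
  runs \<open>r\<close> times around \<open>a\<close>, where \<open>r\<close> is the order of the local monodromy at \<open>a\<close>.  So the germs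
  of \<open>y \<circ> \<pi>\<close> are single-valued near every point of the line, and hence on the whole line: they are
  restrictions of finitely many global functions, the branches (\<open>branch_through\<close>).  The group \<open>G\<close>
  permutes the branches by \<open>Y \<mapsto> Y \<circ> g\<close>.  A loop of regular points lifts to a path in the line
  whose ends differ by some \<open>g\<close> in \<open>G\<close>, and continuation of \<open>y\<close> along the loop is the action of this
  \<open>g\<close>.  So the monodromy group is \<open>G\<close> modulo the kernel \<open>N\<close> of the action
  (\<open>monodromy_group_quotient\<close>).  An element of \<open>N\<close> with a fixed point would be a rotation about it and
  would make a proper power of the local monodromy trivial, which contradicts the order of the latter
  (\<open>fixing_branches_no_fixed_point\<close>).  So \<open>N\<close> consists of translations and is commutative.

  For the expression in radicals, take the ring of polynomials in the branches.  A function of this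
  ring that is invariant under \<open>G\<close> is a single-valued function of \<open>x\<close> of polynomial growth, so it is
  rational (\<open>deck_invariant_rational\<close>).  The translations in \<open>G\<close> are a commutative normal subgroup
  \<open>T\<close>, and the quotient by it is commutative because it embeds into the linear parts.  Since \<open>G\<close> acts
  on the branches through a finite group, one comes down from \<open>G\<close> to \<open>T\<close> and from \<open>T\<close> to the trivial
  group by dropping finitely many group elements, one at a time.  Dropping \<open>t\<close>, of order \<open>m\<close> on
  the branches, costs an \<open>m\<close>-th root: a function \<open>F\<close> is the mean of its Lagrange resolvents with
  respect to \<open>t\<close>, and their \<open>m\<close>-th powers are invariant under \<open>t\<close>
  (\<open>radical_invariants_remove\<close>).
\<close>

section \<open>The plane curve over the regular points\<close>

abbreviation spec_poly :: "complex poly poly \<Rightarrow> complex \<Rightarrow> complex poly" where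
  "spec_poly P x \<equiv> map_poly (\<lambda>c. poly c x) P"

lemma poly_poly_eq_spec: "poly (poly P [:y:]) x = poly (spec_poly P x) y"
  by (induct P) (simp_all add: map_poly_pCons)

lemma fiber_spec: "fiber P x = {y. poly (spec_poly P x) y = 0}"
  by (simp add: fiber_def poly_poly_eq_spec)

lemma coeff_spec: "poly.coeff (spec_poly P x) i = poly (poly.coeff P i) x"
  by (simp add: coeff_map_poly)

lemma degree_spec_le: "degree (spec_poly P x) \<le> degree P"
  by (simp add: map_poly_degree_leq)

lemma degree_spec:
  assumes "poly (lead_coeff P) x \<noteq> 0"
  shows "degree (spec_poly P x) = degree P"
  using assms degree_spec_le[of x P] le_degree[of "spec_poly P x" "degree P"]
  by (simp add: coeff_spec)

lemma continuous_on_poly_compose: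
  fixes p :: "complex poly"
  assumes "continuous_on S f"
  shows "continuous_on S (\<lambda>t. poly p (f t))"
  by (induct p) (auto intro!: continuous_intros assms)

lemma continuous_on_poly_poly:
  fixes P :: "complex poly poly"
  assumes "continuous_on S f" "continuous_on S g"
  shows "continuous_on S (\<lambda>t. poly (poly P [:g t:]) (f t))"
proof (induct P)
  case 0 then show ?case by simp
next
  case (pCons a P)
  have "continuous_on S (\<lambda>t. poly a (f t) + g t * poly (poly P [:g t:]) (f t))"
    by (intro continuous_on_add continuous_on_mult continuous_on_poly_compose assms pCons(2))
  then show ?case by simp
qed

lemma regular_pointD:
  assumes "degree P > 0" "x \<in> regular_points P"
  shows "poly (lead_coeff P) x \<noteq> 0" "finite (fiber P x)" "card (fiber P x) = degree P"
    "fiber P x \<noteq> {}" "spec_poly P x \<noteq> 0"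
proof -
  show c: "card (fiber P x) = degree P" using assms by (simp add: regular_points_def)
  then show "finite (fiber P x)" "fiber P x \<noteq> {}" using assms by (auto intro: card_ge_0_finite)
  then show nz: "spec_poly P x \<noteq> 0"
    by (auto simp: fiber_spec infinite_UNIV_char_0)
  have "degree P \<le> degree (spec_poly P x)"
    using card_poly_roots_bound[OF nz] c by (simp add: fiber_spec)
  then have "degree (spec_poly P x) = degree P" using degree_spec_le[of x P] by simp
  then have "poly (lead_coeff P) x = lead_coeff (spec_poly P x)" by (simp add: coeff_spec)
  then show "poly (lead_coeff P) x \<noteq> 0" using nz by simp
qed

text \<open>
  The value of a polynomial at \<open>y\<close> is its leading coefficient times the product of the differences
  between \<open>y\<close> and the roots, so it cannot be small if all roots are far away.
\<close>

lemma root_near: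
  fixes p :: "complex poly"
  assumes "p \<noteq> 0" "e > 0" "norm (poly p y) < norm (lead_coeff p) * e ^ degree p"
  shows "\<exists>z. poly p z = 0 \<and> dist z y < e"
proof (rule ccontr)
  assume far: "\<not> ?thesis"
  obtain A where A: "size A = degree p" "p = Polynomial.smult (lead_coeff p) (\<Prod>x\<in>#A. [:-x, 1:])"
    using alg_closed_imp_factorization[OF \<open>p \<noteq> 0\<close>] by blast
  have root: "poly p x = 0" if "x \<in># A" for x
    by (subst A(2)) (use that in \<open>auto simp: poly_prod_mset image_mset.compositionality o_def prod_mset_zero_iff image_iff\<close>)
  then have d: "e \<le> norm (y - x)" if "x \<in># A" for x
    using far that by (metis dist_norm dist_commute not_less)
  have "e ^ size A \<le> norm (\<Prod>x\<in>#A. (y - x))"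
    using d
  proof (induct A)
    case (add x A)
    have "e * e ^ size A \<le> norm (y - x) * norm (\<Prod>x\<in>#A. (y - x))"
      using add \<open>e > 0\<close> by (intro mult_mono) auto
    then show ?case by (simp add: norm_mult)
  qed simp
  moreover have "norm (poly p y) = norm (lead_coeff p) * norm (\<Prod>x\<in>#A. (y - x))"
    by (subst A(2)) (simp add: poly_prod_mset image_mset.compositionality o_def norm_mult)
  ultimately show False using assms(3) A(1)
    by (metis linorder_not_less mult_left_mono norm_ge_zero)
qed

text \<open>
  A root \<open>y\<close> of \<open>P(x, _)\<close> makes \<open>P(x', y)\<close> small for \<open>x'\<close> near \<open>x\<close>.
\<close>

lemma root_persists:
  assumes "y \<in> fiber P x" "poly (lead_coeff P) x \<noteq> 0" "e > 0"
  shows "\<forall>\<^sub>F x' in nhds x. poly (lead_coeff P) x' \<noteq> 0 \<and> (\<exists>y'\<in>fiber P x'. dist y' y < e)"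
proof -
  let ?h = "\<lambda>x'. norm (poly (lead_coeff P) x') * e ^ degree P - norm (poly (poly P [:y:]) x')"
  have "open {x'. 0 < ?h x'}" "open {x'. poly (lead_coeff P) x' \<noteq> 0}"
    by (intro open_Collect_less open_Collect_neq continuous_intros continuous_on_poly_compose)+
  moreover have "0 < ?h x" using assms by (simp add: fiber_def)
  ultimately have "\<forall>\<^sub>F x' in nhds x. x' \<in> {x'. 0 < ?h x'}"
      "\<forall>\<^sub>F x' in nhds x. x' \<in> {x'. poly (lead_coeff P) x' \<noteq> 0}"
    using assms(2) by (intro eventually_nhds_in_open; simp)+
  then show ?thesis
  proof eventually_elim
    case (elim x')
    have "spec_poly P x' \<noteq> 0" using elim(2) coeff_spec[of x' P "degree P"] by auto
    moreover have "lead_coeff (spec_poly P x') = poly (lead_coeff P) x'"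
      using elim(2) by (simp add: degree_spec coeff_spec)
    ultimately show ?case
      using root_near[of "spec_poly P x'" e y] elim assms(3)
      by (auto simp: degree_spec fiber_spec poly_poly_eq_spec)
  qed
qed

lemma finite_separation:
  fixes S :: "'a::metric_space set"
  assumes "finite S"
  obtains e where "e > 0" "\<And>x y. x \<in> S \<Longrightarrow> y \<in> S \<Longrightarrow> x \<noteq> y \<Longrightarrow> 2 * e \<le> dist x y"
proof -
  define D where "D = insert 1 ((\<lambda>(x, y). dist x y) ` {(x, y) \<in> S \<times> S. x \<noteq> y})"
  have "{(x, y) \<in> S \<times> S. x \<noteq> y} \<subseteq> S \<times> S" by auto
  then have fin: "finite D" unfolding D_def using assms finite_subset by blast
  have "Min D > 0" using fin by (subst Min_gr_iff) (auto simp: D_def)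
  moreover have "Min D \<le> dist x y" if "x \<in> S" "y \<in> S" "x \<noteq> y" for x y
    using fin that by (intro Min_le) (auto simp: D_def)
  ultimately show ?thesis by (intro that[of "Min D / 2"]) auto
qed

text \<open>
  Every root over \<open>x\<close> persists, and the small discs around these roots are disjoint.  So there are
  already \<open>degree P\<close> roots over \<open>x'\<close>, and there is room for only one in each disc and for none
  outside.
\<close>

lemma evenly_covered_nhd:
  assumes "degree P > 0" "x \<in> regular_points P"
  obtains d e where "d > 0" "e > 0"
    "\<And>y y'. y \<in> fiber P x \<Longrightarrow> y' \<in> fiber P x \<Longrightarrow> y \<noteq> y' \<Longrightarrow> ball y e \<inter> ball y' e = {}"
    "\<And>x'. x' \<in> ball x d \<Longrightarrow> x' \<in> regular_points P"
    "\<And>x' y. x' \<in> ball x d \<Longrightarrow> y \<in> fiber P x \<Longrightarrow> \<exists>!y'. y' \<in> fiber P x' \<inter> ball y e"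
    "\<And>x'. x' \<in> ball x d \<Longrightarrow> fiber P x' \<subseteq> (\<Union>y\<in>fiber P x. ball y e)"
proof -
  note reg = regular_pointD[OF assms]
  obtain e where e: "e > 0" and sep: "\<And>y y'. y \<in> fiber P x \<Longrightarrow> y' \<in> fiber P x \<Longrightarrow> y \<noteq> y' \<Longrightarrow> 2 * e \<le> dist y y'"
    using finite_separation[OF reg(2)] by metis
  have disj: "ball y e \<inter> ball y' e = {}" if "y \<in> fiber P x" "y' \<in> fiber P x" "y \<noteq> y'" for y y'
    using sep[OF that] by (intro disjoint_ballI) simp
  have "\<forall>\<^sub>F x' in nhds x. \<forall>y\<in>fiber P x. poly (lead_coeff P) x' \<noteq> 0 \<and> (\<exists>y'\<in>fiber P x'. dist y' y < e)"
    using root_persists[OF _ reg(1) e] by (intro eventually_ball_finite reg(2)) blast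
  then obtain d where d: "d > 0" and near: "\<And>x' y. dist x' x < d \<Longrightarrow> y \<in> fiber P x \<Longrightarrow>
      poly (lead_coeff P) x' \<noteq> 0 \<and> (\<exists>y'\<in>fiber P x'. dist y' y < e)"
    unfolding eventually_nhds_metric by metis
  have main: "x' \<in> regular_points P \<and> (\<forall>y\<in>fiber P x. \<exists>!y'. y' \<in> fiber P x' \<inter> ball y e) \<and>
      fiber P x' \<subseteq> (\<Union>y\<in>fiber P x. ball y e)" if x': "x' \<in> ball x d" for x'
  proof -
    from x' have "dist x' x < d" by (simp add: dist_commute)
    note near = near[OF this]
    then have lc: "poly (lead_coeff P) x' \<noteq> 0" using reg(4) by blast
    have nz: "spec_poly P x' \<noteq> 0" using lc coeff_spec[of x' P "degree P"] by auto
    have fin: "finite (fiber P x')" and le: "card (fiber P x') \<le> degree P"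
      using poly_roots_finite[OF nz] card_poly_roots_bound[OF nz] degree_spec[OF lc] by (auto simp: fiber_spec)
    obtain r where r: "\<And>y. y \<in> fiber P x \<Longrightarrow> r y \<in> fiber P x' \<and> dist (r y) y < e"
      using near by metis
    have inj: "inj_on r (fiber P x)"
    proof (rule inj_onI, rule ccontr)
      fix y y' assume y: "y \<in> fiber P x" "y' \<in> fiber P x" "r y = r y'" "y \<noteq> y'"
      then show False using disj[of y y'] r[of y] r[of y'] by (auto simp: dist_commute)
    qed
    have eq: "r ` fiber P x = fiber P x'"
    proof (rule card_subset_eq[OF fin])
      show "r ` fiber P x \<subseteq> fiber P x'" using r by blast
      then have "card (r ` fiber P x) \<le> card (fiber P x')" by (rule card_mono[OF fin])
      then show "card (r ` fiber P x) = card (fiber P x')"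
        using le reg(3) card_image[OF inj] by linarith
    qed
    then have "card (fiber P x') = degree P" using card_image[OF inj] reg(3) by simp
    moreover have "\<exists>!y'. y' \<in> fiber P x' \<inter> ball y e" if y: "y \<in> fiber P x" for y
    proof (rule ex1I[of _ "r y"])
      show "r y \<in> fiber P x' \<inter> ball y e" using r[OF y] by (simp add: dist_commute)
      fix y' assume y': "y' \<in> fiber P x' \<inter> ball y e"
      then obtain y2 where y2: "y2 \<in> fiber P x" "y' = r y2" using eq by blast
      then show "y' = r y" using disj[OF y y2(1)] y' r[OF y2(1)] by (cases "y = y2") (auto simp: dist_commute)
    qed
    moreover have "fiber P x' \<subseteq> (\<Union>y\<in>fiber P x. ball y e)"
      using eq r by (force simp: dist_commute)
    ultimately show ?thesis by (simp add: regular_points_def)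
  qed
  show ?thesis using main disj by (intro that[OF d e]) blast+
qed

lemma open_regular_points:
  assumes "degree P > 0" shows "open (regular_points P)"
  unfolding open_contains_ball
proof
  fix x assume "x \<in> regular_points P"
  then obtain d where "d > 0" "\<And>x'. x' \<in> ball x d \<Longrightarrow> x' \<in> regular_points P"
    using evenly_covered_nhd[OF assms, of x thesis] by blast
  then show "\<exists>e>0. ball x e \<subseteq> regular_points P" by blast
qed

definition curve :: "complex poly poly \<Rightarrow> (complex \<times> complex) set" where
  "curve P = {(x, y). x \<in> regular_points P \<and> y \<in> fiber P x}"

text \<open>
  The sheets over a disc are the parts of the curve inside the disjoint discs of
  \<open>evenly_covered_nhd\<close>.  This makes the lifting theorems for covering spaces available; in the next
  two lemmas a continuous choice of roots \<open>f t\<close> of \<open>P(X t, _)\<close> is read as a lift of \<open>X\<close> to the curve.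
\<close>

lemma covering_space_curve:
  assumes "degree P > 0"
  shows "covering_space (curve P) fst (regular_points P)"
proof
  show "continuous_on (curve P) fst" by (intro continuous_intros)
  show "fst ` curve P = regular_points P"
    using regular_pointD(4)[OF assms] by (force simp: curve_def)
  fix x assume x: "x \<in> regular_points P"
  obtain d e where de: "d > 0" "e > 0"
    "\<And>y y'. y \<in> fiber P x \<Longrightarrow> y' \<in> fiber P x \<Longrightarrow> y \<noteq> y' \<Longrightarrow> ball y e \<inter> ball y' e = {}"
    "\<And>x'. x' \<in> ball x d \<Longrightarrow> x' \<in> regular_points P"
    "\<And>x' y. x' \<in> ball x d \<Longrightarrow> y \<in> fiber P x \<Longrightarrow> \<exists>!y'. y' \<in> fiber P x' \<inter> ball y e"
    "\<And>x'. x' \<in> ball x d \<Longrightarrow> fiber P x' \<subseteq> (\<Union>y\<in>fiber P x. ball y e)"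
    by (rule evenly_covered_nhd[OF assms x]) (rule that)
  define sheet where "sheet y = curve P \<inter> (ball x d \<times> ball y e)" for y
  have "\<exists>q. homeomorphism (sheet y) (ball x d) fst q" if y: "y \<in> fiber P x" for y
  proof -
    define s where "s x' = (THE y'. y' \<in> fiber P x' \<inter> ball y e)" for x'
    have s: "s x' \<in> fiber P x'" "s x' \<in> ball y e" if "x' \<in> ball x d" for x'
      using theI'[OF de(5)[OF that y]] unfolding s_def by auto
    have s_eq: "s x' = y'" if "x' \<in> ball x d" "y' \<in> fiber P x'" "y' \<in> ball y e" for x' y'
      using de(5)[OF that(1) y] s[OF that(1)] that by blast
    have "continuous_on (ball x d) s"
      unfolding continuous_on_eq_continuous_at[OF open_ball]
    proof
      fix x1 assume x1: "x1 \<in> ball x d"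
      obtain e0 where e0: "e0 > 0" "ball (s x1) e0 \<subseteq> ball y e"
        using s(2)[OF x1] openE[OF open_ball] by blast
      show "isCont s x1" unfolding continuous_at tendsto_iff
      proof safe
        fix e' :: real assume "e' > 0"
        then have "\<forall>\<^sub>F x' in nhds x1. poly (lead_coeff P) x' \<noteq> 0 \<and> (\<exists>y'\<in>fiber P x'. dist y' (s x1) < min e0 e')"
          using e0 s(1)[OF x1] regular_pointD(1)[OF assms de(4)[OF x1]] by (intro root_persists) auto
        moreover have "\<forall>\<^sub>F x' in nhds x1. x' \<in> ball x d"
          using x1 by (intro eventually_nhds_in_open) auto
        ultimately have "\<forall>\<^sub>F x' in nhds x1. dist (s x') (s x1) < e'"
        proof eventually_elim
          case (elim x')
          then obtain y' where y': "y' \<in> fiber P x'" "dist y' (s x1) < min e0 e'" by blast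
          then have "s x' = y'" using e0 by (intro s_eq elim) (auto simp: dist_commute)
          then show ?case using y' by simp
        qed
        then show "\<forall>\<^sub>F x' in at x1. dist (s x') (s x1) < e'"
          by (simp add: eventually_nhds_conv_at)
      qed
    qed
    then have "homeomorphism (sheet y) (ball x d) fst (\<lambda>x'. (x', s x'))"
      using s s_eq de(4) by (intro homeomorphismI)
        (auto simp: sheet_def curve_def intro!: continuous_intros)
    then show ?thesis by blast
  qed
  moreover have "\<Union> (sheet ` fiber P x) = curve P \<inter> fst -` ball x d"
    using de(6) by (fastforce simp: sheet_def curve_def)
  moreover have "openin (top_of_set (curve P)) (sheet y)" for y
    unfolding sheet_def by (intro openin_open_Int open_Times) auto
  moreover have "pairwise disjnt (sheet ` fiber P x)"
    unfolding pairwise_def disjnt_def sheet_def using de(3) by blast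
  ultimately show "\<exists>T. x \<in> T \<and> openin (top_of_set (regular_points P)) T \<and>
      (\<exists>v. \<Union>v = curve P \<inter> fst -` T \<and> (\<forall>u \<in> v. openin (top_of_set (curve P)) u) \<and>
        pairwise disjnt v \<and> (\<forall>u \<in> v. \<exists>q. homeomorphism u T fst q))"
    using de(1,4) open_regular_points[OF assms]
    by (intro exI[of _ "ball x d"] conjI exI[of _ "sheet ` fiber P x"]) (auto simp: openin_open_eq)
qed

lemma section_unique:
  fixes f g :: "'a::topological_space \<Rightarrow> complex"
  assumes "degree P > 0" "connected T" "continuous_on T X" "X ` T \<subseteq> regular_points P"
    "continuous_on T f" "\<And>t. t \<in> T \<Longrightarrow> f t \<in> fiber P (X t)"
    "continuous_on T g" "\<And>t. t \<in> T \<Longrightarrow> g t \<in> fiber P (X t)"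
    "a \<in> T" "f a = g a" "t \<in> T"
  shows "f t = g t"
proof -
  have "(\<lambda>t. (X t, f t)) t = (\<lambda>t. (X t, g t)) t"
    by (rule covering_space_lift_unique[OF covering_space_curve[OF assms(1)], of _ a _ T X])
      (use assms in \<open>auto simp: curve_def intro!: continuous_intros\<close>)
  then show ?thesis by simp
qed

lemma section_lift:
  fixes X :: "'a::real_normed_vector \<Rightarrow> complex"
  assumes "degree P > 0" "simply_connected U" "locally path_connected U" "continuous_on U X"
    "X ` U \<subseteq> regular_points P" "z \<in> U" "y \<in> fiber P (X z)"
  obtains f where "continuous_on U f" "f z = y" "\<And>t. t \<in> U \<Longrightarrow> f t \<in> fiber P (X t)"
proof -
  have "(X z, y) \<in> curve P" using assms by (auto simp: curve_def)
  from covering_space_lift_strong[OF covering_space_curve[OF assms(1)] this assms(6,2,3,4)]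
  obtain g where g: "continuous_on U g" "g \<in> U \<rightarrow> curve P" "g z = (X z, y)"
      "\<And>y. y \<in> U \<Longrightarrow> fst (g y) = X y" using assms(5) by auto
  show ?thesis
  proof (rule that[of "snd \<circ> g"])
    show "continuous_on U (snd \<circ> g)" using g(1) by (auto intro!: continuous_intros simp: o_def)
    show "(snd \<circ> g) t \<in> fiber P (X t)" if "t \<in> U" for t
      using g(2,4) that by (force simp: curve_def Pi_iff)
  qed (use g in auto)
qed

lemma poly_poly_synthetic_div:
  fixes P :: "complex poly poly"
  shows "poly (poly P [:z:]) x =
    (z - y) * poly (poly (synthetic_div P [:y:]) [:z:]) x + poly (poly P [:y:]) x"
proof -
  have "poly P [:z:] = poly ([:-[:y:], 1:] * synthetic_div P [:y:] + [:poly P [:y:]:]) [:z:]"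
    by (simp only: synthetic_div_correct')
  then have "poly P [:z:] = [:z - y:] * poly (synthetic_div P [:y:]) [:z:] + poly P [:y:]"
    by (simp add: algebra_simps smult_diff_left)
  then show ?thesis by simp
qed

text \<open>
  If the quotient of \<open>P\<close> by \<open>y' - y\<close> vanished at \<open>y\<close> as well, all roots over \<open>x\<close> would be roots of
  this quotient, whose degree is too small.
\<close>

lemma simple_root:
  assumes "degree P > 0" "x \<in> regular_points P" "y \<in> fiber P x"
  shows "poly (poly (synthetic_div P [:y:]) [:y:]) x \<noteq> 0"
proof
  let ?Q = "synthetic_div P [:y:]"
  assume zero: "poly (poly ?Q [:y:]) x = 0"
  note reg = regular_pointD[OF assms(1,2)]
  have "poly (poly P [:z:]) x = (z - y) * poly (poly ?Q [:z:]) x" for z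
    using poly_poly_synthetic_div[of P z x y] assms(3) by (simp add: fiber_def)
  then have "fiber P x = {z. (z - y) * poly (poly ?Q [:z:]) x = 0}" unfolding fiber_def by simp
  also have "\<dots> = {z. poly (poly ?Q [:z:]) x = 0}" using zero by auto
  finally have fib: "fiber P x = {z. poly (spec_poly ?Q x) z = 0}"
    unfolding poly_poly_eq_spec .
  have "spec_poly ?Q x \<noteq> 0" using reg(2) fib infinite_UNIV_char_0 by auto
  from card_poly_roots_bound[OF this] have "card (fiber P x) \<le> degree ?Q"
    using fib degree_spec_le[of x ?Q] by simp
  then show False using reg(3) assms(1) by (simp add: degree_synthetic_div)
qed

text \<open>
  Division by \<open>y - s x1\<close> gives \<open>P(x, y) = (y - s x1) Q(x, y) + P(x, s x1)\<close>.  With \<open>y = s x\<close> the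
  left-hand side vanishes, which expresses the difference quotient of \<open>s\<close> by that of
  \<open>P(x, s x1)\<close> and by the function \<open>Q(x, s x)\<close>, nonzero at \<open>x1\<close>.
\<close>

lemma root_branch_holomorphic:
  assumes "degree P > 0" "open S" "S \<subseteq> regular_points P" "continuous_on S s"
    "\<And>x. x \<in> S \<Longrightarrow> s x \<in> fiber P x"
  shows "s holomorphic_on S"
proof (rule holomorphic_onI)
  fix x1 assume x1: "x1 \<in> S"
  define Q where "Q = synthetic_div P [:s x1:]"
  define q where "q x = poly (poly Q [:s x:]) x" for x
  define p where "p = poly P [:s x1:]"
  have val: "poly (poly P [:z:]) x = (z - s x1) * poly (poly Q [:z:]) x + poly p x" for z x
    unfolding Q_def p_def by (rule poly_poly_synthetic_div)
  have "continuous_on S q" unfolding q_def by (intro continuous_on_poly_poly assms continuous_on_id)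
  then have q: "q \<midarrow>x1\<rightarrow> q x1" using x1 assms(2) continuous_on_interior[of S q x1]
    by (simp add: interior_open isCont_def)
  have q1: "q x1 \<noteq> 0" unfolding q_def Q_def using x1 assms by (intro simple_root) auto
  have p1: "poly p x1 = 0" using assms(5)[OF x1] by (simp add: p_def fiber_def)
  have "((\<lambda>x. (poly p x - poly p x1) / (x - x1)) \<longlongrightarrow> poly (pderiv p) x1) (at x1)"
    using poly_DERIV[of p x1] by (simp add: has_field_derivative_iff)
  then have "((\<lambda>x. - ((poly p x - poly p x1) / (x - x1)) / q x) \<longlongrightarrow> - poly (pderiv p) x1 / q x1) (at x1)"
    by (intro tendsto_intros q q1)
  moreover have "\<forall>\<^sub>F x in at x1. - ((poly p x - poly p x1) / (x - x1)) / q x = (s x - s x1) / (x - x1)"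
  proof -
    have "\<forall>\<^sub>F x in at x1. q x \<noteq> 0" using q q1 tendsto_imp_eventually_ne by blast
    moreover have "\<forall>\<^sub>F x in at x1. x \<in> S" using x1 assms(2) by (simp add: eventually_at_in_open')
    ultimately show ?thesis
    proof eventually_elim
      case (elim x)
      then have "0 = (s x - s x1) * q x + poly p x"
        using val[of "s x" x] assms(5)[of x] by (simp add: fiber_def q_def)
      then have "- poly p x = (s x - s x1) * q x" by (metis add_eq_0_iff2 minus_minus add.commute)
      then have "- poly p x / q x = s x - s x1" using elim by simp
      have "- ((poly p x - poly p x1) / (x - x1)) / q x = (- poly p x / q x) / (x - x1)"
        using p1 by simp
      then show ?case unfolding \<open>- poly p x / q x = s x - s x1\<close> .
    qed
  qed
  ultimately have "((\<lambda>x. (s x - s x1) / (x - x1)) \<longlongrightarrow> - poly (pderiv p) x1 / q x1) (at x1)"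
    using tendsto_cong by fastforce
  then have "(s has_field_derivative - poly (pderiv p) x1 / q x1) (at x1)"
    by (simp add: has_field_derivative_iff)
  then show "s field_differentiable at x1 within S"
    using field_differentiable_def has_field_derivative_at_within by blast
qed

lemma section_holomorphic:
  assumes "degree P > 0" "open T" "X holomorphic_on T" "X ` T \<subseteq> regular_points P"
    "continuous_on T f" "\<And>t. t \<in> T \<Longrightarrow> f t \<in> fiber P (X t)"
  shows "f holomorphic_on T"
proof -
  have "f field_differentiable at t" if t: "t \<in> T" for t
  proof -
    have reg: "X t \<in> regular_points P" using t assms by auto
    obtain d where d: "d > 0" "ball (X t) d \<subseteq> regular_points P"
      using open_regular_points[OF assms(1)] reg open_contains_ball by blast
    obtain s where s: "continuous_on (ball (X t) d) s" "s (X t) = f t"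
        "\<And>x. x \<in> ball (X t) d \<Longrightarrow> s x \<in> fiber P x"
      using section_lift[of P "ball (X t) d" id "X t" "f t"] d assms(1,6) t
      by (auto simp: convex_imp_simply_connected convex_imp_locally_path_connected)
    have hol: "s holomorphic_on ball (X t) d" by (rule root_branch_holomorphic) (use assms d s in auto)
    have contX: "continuous_on T X" using assms(3) holomorphic_on_imp_continuous_on by blast
    then have "open (T \<inter> X -` ball (X t) d)" using assms(2) by (simp add: continuous_open_preimage)
    then obtain r where r: "r > 0" "ball t r \<subseteq> T \<inter> X -` ball (X t) d"
      using t d(1) open_contains_ball[of "T \<inter> X -` ball (X t) d"] by (metis IntI centre_in_ball vimageI)
    have rT: "u \<in> T" "dist (X t) (X u) < d" "X u \<in> regular_points P" if "dist t u < r" for u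
      using r(2) assms(4) that by (auto simp: subset_iff)
    have "f z = (s \<circ> X) z" if "z \<in> ball t r" for z
    proof (rule section_unique[OF assms(1), of "ball t r" X f "s \<circ> X" t])
      show "continuous_on (ball t r) (s \<circ> X)"
        using r s(1) contX by (intro continuous_on_compose2[OF s(1)] continuous_on_compose) 
          (auto intro: continuous_on_subset)
    qed (use r(1) s(2,3) assms(5,6) that contX rT in \<open>auto intro: continuous_on_subset\<close>)
    moreover have "(s \<circ> X) holomorphic_on ball t r"
      using r assms(3) hol by (intro holomorphic_on_compose_gen[of X "ball t r" s "ball (X t) d"])
        (auto intro: holomorphic_on_subset)
    ultimately have "f holomorphic_on ball t r" by (metis holomorphic_cong)
    then show ?thesis using r(1) by (simp add: holomorphic_on_imp_differentiable_at)
  qed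
  then show ?thesis by (simp add: holomorphic_on_def field_differentiable_at_within)
qed

lemma algebraic_function_degree:
  assumes "algebraic_function P" shows "degree P > 0"
proof (rule ccontr)
  assume "\<not> degree P > 0"
  then obtain c where "P = [:c:]" using degree_eq_zeroE by auto
  then have "fract_poly P = [:to_fract c:]" by (simp add: map_poly_pCons)
  then show False using assms unfolding algebraic_function_def irreducible_def
    by (metis dvd_field_iff is_unit_const_poly_iff map_poly_0 pCons_0_0)
qed

text \<open>
  A nonzero combination of \<open>f\<close> and \<open>g\<close> of least degree divides both by division with remainder, so
  it is a unit.
\<close>

lemma irreducible_poly_bezout:
  fixes f g :: "'a::field poly"
  assumes "irreducible f" "\<not> f dvd g"
  obtains s t where "s * f + t * g = 1"
proof -
  define I where "I = {s * f + t * g | s t. True}"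
  have fI: "f \<in> I" and gI: "g \<in> I" unfolding I_def
    by (rule CollectI, rule exI[of _ 1], rule exI[of _ 0], simp,
        rule CollectI, rule exI[of _ 0], rule exI[of _ 1], simp)
  have "f \<noteq> 0" using assms(1) by auto
  then obtain h where h: "h \<in> I" "h \<noteq> 0" and min: "\<And>h'. h' \<in> I \<Longrightarrow> h' \<noteq> 0 \<Longrightarrow> degree h \<le> degree h'"
    using ex_has_least_nat[of "\<lambda>h. h \<in> I \<and> h \<noteq> 0" f degree] fI by blast
  obtain s0 t0 where st0: "h = s0 * f + t0 * g" using h(1) by (auto simp: I_def)
  have dvd: "h dvd k" if kI: "k \<in> I" for k
  proof (rule ccontr)
    assume "\<not> h dvd k"
    then have nz: "k mod h \<noteq> 0" by (simp add: mod_eq_0_iff_dvd)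
    obtain s t where st: "k = s * f + t * g" using kI unfolding I_def by blast
    have "k mod h = k - (k div h) * h" by (simp add: minus_div_mult_eq_mod)
    also have "\<dots> = (s - (k div h) * s0) * f + (t - (k div h) * t0) * g"
      unfolding st by (subst (2) st0) (simp add: algebra_simps)
    finally have "k mod h \<in> I" unfolding I_def by blast
    from min[OF this nz] show False using degree_mod_less'[OF h(2) nz] by simp
  qed
  obtain k where k: "f = h * k" using dvd[OF fI] by (auto simp: dvd_def)
  have "is_unit h"
  proof (rule ccontr)
    assume "\<not> is_unit h"
    then have "is_unit k" using assms(1) k by (auto simp: irreducible_def)
    then have "f dvd h" using k by simp
    then show False using assms(2) dvd[OF gI] dvd_trans by blast
  qed
  then obtain u where "1 = h * u" by (auto simp: dvd_def)
  then have "(u * s0) * f + (u * t0) * g = 1" unfolding st0 by (simp add: algebra_simps)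
  then show ?thesis by (rule that)
qed

lemma clear_denominators:
  fixes q :: "'a::idom fract poly"
  obtains d q' where "d \<noteq> 0" "Polynomial.smult (to_fract d) q = fract_poly q'"
proof -
  have "\<exists>d q'. d \<noteq> 0 \<and> Polynomial.smult (to_fract d) q = fract_poly q'"
  proof (induct q)
    case 0
    show ?case by (rule exI[of _ 1], rule exI[of _ 0]) simp
  next
    case (pCons a q)
    then obtain d q' where d: "d \<noteq> 0" "Polynomial.smult (to_fract d) q = fract_poly q'" by blast
    obtain n m where a: "a = Fract n m" "m \<noteq> 0" by (cases a) auto
    have "to_fract m * a = to_fract n" using a by (simp add: to_fract_def eq_fract)
    then have "Polynomial.smult (to_fract (d * m)) (pCons a q) = fract_poly (pCons (d * n) (Polynomial.smult m q'))"
      using d(2)[symmetric] by (simp add: map_poly_pCons algebra_simps)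
    then show ?case using d(1) a(2) by (metis mult_eq_0_iff)
  qed
  then show ?thesis using that by blast
qed

lemma card_roots_rsquarefree:
  fixes p :: "complex poly"
  assumes "rsquarefree p"
  shows "card {z. poly p z = 0} = degree p"
proof -
  have "degree p = degree (Polynomial.smult (lead_coeff p) (\<Prod>z|poly p z = 0. [:-z, 1:]))"
    by (simp only: complex_poly_decompose_rsquarefree[OF assms])
  also have "\<dots> = degree (\<Prod>z|poly p z = 0. [:-z, 1:])"
    using assms by (simp add: rsquarefree_def)
  also have "\<dots> = card {z. poly p z = 0}"
    by (subst degree_prod_eq_sum_degree) auto
  finally show ?thesis ..
qed

text \<open>
  An irreducible polynomial in characteristic zero is coprime to its derivative.  After clearing
  denominators in a Bezout identity, the right-hand side is a polynomial in \<open>x\<close>; where neither it nor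
  the leading coefficient vanishes, \<open>P(x, _)\<close> has only simple roots.
\<close>

lemma finite_irregular_points:
  assumes "algebraic_function P"
  shows "finite (- regular_points P)"
proof -
  have deg: "degree P > 0" using assms by (rule algebraic_function_degree)
  have "\<not> fract_poly P dvd fract_poly (pderiv P)"
  proof
    assume "fract_poly P dvd fract_poly (pderiv P)"
    moreover have "fract_poly (pderiv P) \<noteq> 0" using deg by (simp add: pderiv_eq_0_iff)
    ultimately have "degree (fract_poly P) \<le> degree (fract_poly (pderiv P))" by (rule dvd_imp_degree_le)
    then show False using deg by (simp add: degree_map_poly degree_pderiv)
  qed
  then obtain s t where st: "s * fract_poly P + t * fract_poly (pderiv P) = 1"
    using assms irreducible_poly_bezout unfolding algebraic_function_def by metis
  obtain c s' where c: "c \<noteq> 0" "Polynomial.smult (to_fract c) s = fract_poly s'" by (rule clear_denominators)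
  obtain d t' where d: "d \<noteq> 0" "Polynomial.smult (to_fract d) t = fract_poly t'" by (rule clear_denominators)
  have "fract_poly [:c * d:] = Polynomial.smult (to_fract (c * d)) (s * fract_poly P + t * fract_poly (pderiv P))"
    unfolding st by (simp add: map_poly_pCons)
  also have "\<dots> = Polynomial.smult (to_fract d) (Polynomial.smult (to_fract c) s * fract_poly P) +
      Polynomial.smult (to_fract c) (Polynomial.smult (to_fract d) t * fract_poly (pderiv P))"
    by (simp add: smult_add_right algebra_simps)
  also have "\<dots> = fract_poly (Polynomial.smult d s' * P + Polynomial.smult c t' * pderiv P)"
    unfolding c(2) d(2) by simp
  finally have eq: "[:c * d:] = Polynomial.smult d s' * P + Polynomial.smult c t' * pderiv P"
    by (simp only: fract_poly_eq_iff)
  \<comment> \<open>Outside the zeros of \<open>D\<close> the degree does not drop and no root is multiple.\<close>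
  define D where "D = c * d * lead_coeff P"
  have "D \<noteq> 0" using c d deg by (auto simp: D_def)
  moreover have "x \<in> regular_points P" if x: "poly D x \<noteq> 0" for x
  proof -
    have "poly (lead_coeff P) x \<noteq> 0" using x by (simp add: D_def)
    then have dg: "degree (spec_poly P x) = degree P" by (rule degree_spec)
    have spd: "spec_poly (pderiv P) x = pderiv (spec_poly P x)"
      by (rule poly_eqI) (simp add: coeff_spec coeff_pderiv)
    have "rsquarefree (spec_poly P x)" unfolding rsquarefree_roots
    proof safe
      fix y assume y: "poly (spec_poly P x) y = 0" "poly (pderiv (spec_poly P x)) y = 0"
      have "poly (poly [:c * d:] [:y:]) x = 0"
        unfolding eq using y by (simp add: poly_poly_eq_spec spd)
      then show False using x by (simp add: D_def)
    qed
    then have "card {y. poly (spec_poly P x) y = 0} = degree (spec_poly P x)"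
      by (rule card_roots_rsquarefree)
    then show ?thesis using dg by (simp add: regular_points_def fiber_spec)
  qed
  ultimately show ?thesis
    using poly_roots_finite[of D] by (auto intro: finite_subset[of _ "{x. poly D x = 0}"])
qed

section \<open>Monodromy operators and the monodromy group\<close>

text \<open>
  The definite description in the definition of \<open>monodromy\<close> is met because lifts of paths to the
  curve are unique.
\<close>

lemma monodromy_eqI:
  assumes "degree P > 0" "path \<gamma>" "path_image \<gamma> \<subseteq> regular_points P" "path h"
    "\<And>t. t \<in> {0..1} \<Longrightarrow> h t \<in> fiber P (\<gamma> t)"
  shows "monodromy P \<gamma> (pathstart h) = pathfinish h"
proof -
  have "(THE y'. \<exists>k. path k \<and> pathstart k = pathstart h \<and> pathfinish k = y' \<and>
      (\<forall>t\<in>{0..1}. k t \<in> fiber P (\<gamma> t))) = pathfinish h"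
  proof (rule the_equality)
    fix y' assume "\<exists>k. path k \<and> pathstart k = pathstart h \<and> pathfinish k = y' \<and>
      (\<forall>t\<in>{0..1}. k t \<in> fiber P (\<gamma> t))"
    then obtain k where k: "path k" "pathstart k = pathstart h" "pathfinish k = y'"
        "\<forall>t\<in>{0..1}. k t \<in> fiber P (\<gamma> t)" by blast
    have "k 1 = h 1"
      by (rule section_unique[OF assms(1), of "{0..1}" \<gamma> k h 0])
        (use assms k in \<open>auto simp: path_def path_image_def pathstart_def\<close>)
    then show "y' = pathfinish h" using k by (simp add: pathfinish_def)
  qed (use assms in auto)
  moreover have "pathstart h \<in> fiber P (pathstart \<gamma>)"
    using assms(5)[of 0] by (simp add: pathstart_def)
  ultimately show ?thesis by (simp add: monodromy_def)
qed

lemma path_lift: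
  assumes "degree P > 0" "path \<gamma>" "path_image \<gamma> \<subseteq> regular_points P" "y \<in> fiber P (pathstart \<gamma>)"
  obtains h where "path h" "pathstart h = y" "\<And>t. t \<in> {0..1} \<Longrightarrow> h t \<in> fiber P (\<gamma> t)"
proof (rule section_lift[of P "{0..1}" \<gamma> 0 y])
  fix f :: "real \<Rightarrow> complex" assume "continuous_on {0..1} f" "f 0 = y" "\<And>t. t \<in> {0..1} \<Longrightarrow> f t \<in> fiber P (\<gamma> t)"
  then show thesis by (intro that[of f]) (auto simp: path_def pathstart_def)
qed (use assms in \<open>auto simp: path_def path_image_def pathstart_def
      convex_imp_simply_connected convex_imp_locally_path_connected\<close>)

lemma monodromy_mem:
  assumes "degree P > 0" "path \<gamma>" "path_image \<gamma> \<subseteq> regular_points P" "y \<in> fiber P (pathstart \<gamma>)"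
  shows "monodromy P \<gamma> y \<in> fiber P (pathfinish \<gamma>)"
proof -
  obtain h where h: "path h" "pathstart h = y" "\<And>t. t \<in> {0..1} \<Longrightarrow> h t \<in> fiber P (\<gamma> t)"
    by (rule path_lift[OF assms]) (rule that)
  then have "monodromy P \<gamma> y = pathfinish h" using monodromy_eqI[OF assms(1-3)] by blast
  then show ?thesis using h(3)[of 1] by (simp add: pathfinish_def)
qed

lemma monodromy_join:
  assumes "degree P > 0" "path \<gamma>" "path_image \<gamma> \<subseteq> regular_points P"
    "path \<gamma>'" "path_image \<gamma>' \<subseteq> regular_points P" "pathfinish \<gamma> = pathstart \<gamma>'"
    "y \<in> fiber P (pathstart \<gamma>)"
  shows "monodromy P (\<gamma> +++ \<gamma>') y = monodromy P \<gamma>' (monodromy P \<gamma> y)"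
proof -
  obtain h where h: "path h" "pathstart h = y" "\<And>t. t \<in> {0..1} \<Longrightarrow> h t \<in> fiber P (\<gamma> t)"
    by (rule path_lift[OF assms(1-3,7)]) (rule that)
  have "pathfinish h \<in> fiber P (pathstart \<gamma>')"
    using h(3)[of 1] assms(6) by (simp add: pathfinish_def)
  then obtain h' where h': "path h'" "pathstart h' = pathfinish h" "\<And>t. t \<in> {0..1} \<Longrightarrow> h' t \<in> fiber P (\<gamma>' t)"
    by (rule path_lift[OF assms(1,4,5)]) (rule that)
  have "monodromy P (\<gamma> +++ \<gamma>') (pathstart (h +++ h')) = pathfinish (h +++ h')"
  proof (rule monodromy_eqI[OF assms(1)])
    show "(h +++ h') t \<in> fiber P ((\<gamma> +++ \<gamma>') t)" if "t \<in> {0..1}" for t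
      using h(3)[of "2 * t"] h'(3)[of "2 * t - 1"] that by (auto simp: joinpaths_def)
  qed (use assms h h' in \<open>auto simp: path_image_join\<close>)
  then show ?thesis
    using monodromy_eqI[OF assms(1-3) h(1,3)] monodromy_eqI[OF assms(1,4,5) h'(1,3)] h(2) h'(2) by simp
qed

lemma monodromy_reversepath:
  assumes "degree P > 0" "path \<gamma>" "path_image \<gamma> \<subseteq> regular_points P" "y \<in> fiber P (pathstart \<gamma>)"
  shows "monodromy P (reversepath \<gamma>) (monodromy P \<gamma> y) = y"
proof -
  obtain h where h: "path h" "pathstart h = y" "\<And>t. t \<in> {0..1} \<Longrightarrow> h t \<in> fiber P (\<gamma> t)"
    by (rule path_lift[OF assms]) (rule that)
  have "monodromy P (reversepath \<gamma>) (pathstart (reversepath h)) = pathfinish (reversepath h)"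
  proof (rule monodromy_eqI[OF assms(1)])
    show "reversepath h t \<in> fiber P (reversepath \<gamma> t)" if "t \<in> {0..1}" for t
      using h(3)[of "1 - t"] that by (auto simp: reversepath_def)
  qed (use assms h in auto)
  then show ?thesis using monodromy_eqI[OF assms(1-3) h(1,3)] h(2) by simp
qed

lemma monodromy_const:
  assumes "degree P > 0" "x \<in> regular_points P" "y \<in> fiber P x"
  shows "monodromy P (linepath x x) y = y"
  using monodromy_eqI[of P "linepath x x" "linepath y y"] assms by auto

definition loops_at :: "complex poly poly \<Rightarrow> complex \<Rightarrow> (real \<Rightarrow> complex) set" where
  "loops_at P x0 = {\<gamma>. path \<gamma> \<and> path_image \<gamma> \<subseteq> regular_points P \<and> pathstart \<gamma> = x0 \<and> pathfinish \<gamma> = x0}"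

lemma monodromy_group_loops:
  "monodromy_group P x0 = BijGroup (fiber P x0)\<lparr>carrier := monodromy P ` loops_at P x0\<rparr>"
  by (simp add: monodromy_group_def loops_at_def)

lemma reversepath_loop: "\<gamma> \<in> loops_at P x0 \<Longrightarrow> reversepath \<gamma> \<in> loops_at P x0"
  by (auto simp: loops_at_def)

lemma monodromy_Bij:
  assumes "degree P > 0" "\<gamma> \<in> loops_at P x0"
  shows "monodromy P \<gamma> \<in> Bij (fiber P x0)"
proof -
  have inv: "monodromy P (reversepath \<gamma>) (monodromy P \<gamma> y) = y" "monodromy P \<gamma> y \<in> fiber P x0"
    if "\<gamma> \<in> loops_at P x0" "y \<in> fiber P x0" for \<gamma> y
    using that assms(1) monodromy_reversepath[of P \<gamma> y] monodromy_mem[of P \<gamma> y] by (auto simp: loops_at_def)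
  have "bij_betw (monodromy P \<gamma>) (fiber P x0) (fiber P x0)"
    using inv[OF assms(2)] inv[OF reversepath_loop[OF assms(2)]]
    by (intro bij_betw_byWitness[where f' = "monodromy P (reversepath \<gamma>)"]) auto
  moreover have "monodromy P \<gamma> \<in> extensional (fiber P x0)"
    using assms(2) by (auto simp: monodromy_def loops_at_def)
  ultimately show ?thesis by (simp add: Bij_def)
qed

lemma mult_monodromy_group:
  assumes "a \<in> Bij (fiber P x0)" "b \<in> Bij (fiber P x0)"
  shows "a \<otimes>\<^bsub>monodromy_group P x0\<^esub> b = compose (fiber P x0) a b"
  using assms by (simp add: monodromy_group_loops BijGroup_def)

lemma one_monodromy_group: "\<one>\<^bsub>monodromy_group P x0\<^esub> = (\<lambda>y\<in>fiber P x0. y)"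
  by (simp add: monodromy_group_loops BijGroup_def)

lemma Bij_eqI:
  assumes "a \<in> Bij S" "b \<in> extensional S" "\<And>y. y \<in> S \<Longrightarrow> a y = b y" shows "a = b"
  using assms by (intro extensionalityI[of _ S]) (auto simp: Bij_def)

lemma group_monodromy_group:
  assumes "degree P > 0" "x0 \<in> regular_points P"
  shows "group (monodromy_group P x0)"
proof -
  interpret B: group "BijGroup (fiber P x0)" by (rule group_BijGroup)
  note Bij = monodromy_Bij[OF assms(1)]
  have join: "monodromy P (\<gamma> +++ \<gamma>') = compose (fiber P x0) (monodromy P \<gamma>') (monodromy P \<gamma>)"
      and join_loop: "\<gamma> +++ \<gamma>' \<in> loops_at P x0"
    if "\<gamma> \<in> loops_at P x0" "\<gamma>' \<in> loops_at P x0" for \<gamma> \<gamma>'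
  proof -
    show l: "\<gamma> +++ \<gamma>' \<in> loops_at P x0" using that by (auto simp: loops_at_def path_image_join)
    show "monodromy P (\<gamma> +++ \<gamma>') = compose (fiber P x0) (monodromy P \<gamma>') (monodromy P \<gamma>)"
      by (rule Bij_eqI[OF Bij[OF l]])
        (use that assms(1) monodromy_join[of P \<gamma> \<gamma>'] in \<open>auto simp: compose_def loops_at_def\<close>)
  qed
  have const_loop: "linepath x0 x0 \<in> loops_at P x0" using assms(2) by (simp add: loops_at_def)
  have const: "monodromy P (linepath x0 x0) = (\<lambda>y\<in>fiber P x0. y)"
    by (rule Bij_eqI[OF Bij[OF const_loop]]) (auto simp: monodromy_const assms)
  have "subgroup (monodromy P ` loops_at P x0) (BijGroup (fiber P x0))"
  proof
    show "monodromy P ` loops_at P x0 \<subseteq> carrier (BijGroup (fiber P x0))"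
      using Bij by (auto simp: BijGroup_def)
    show "a \<otimes>\<^bsub>BijGroup (fiber P x0)\<^esub> b \<in> monodromy P ` loops_at P x0"
      if ab: "a \<in> monodromy P ` loops_at P x0" "b \<in> monodromy P ` loops_at P x0" for a b
    proof -
      obtain \<gamma> \<gamma>' where "\<gamma> \<in> loops_at P x0" "\<gamma>' \<in> loops_at P x0" "a = monodromy P \<gamma>" "b = monodromy P \<gamma>'"
        using ab by blast
      then have "a \<otimes>\<^bsub>BijGroup (fiber P x0)\<^esub> b = monodromy P (\<gamma>' +++ \<gamma>)" "\<gamma>' +++ \<gamma> \<in> loops_at P x0"
        using Bij join[of \<gamma>' \<gamma>] join_loop by (auto simp: BijGroup_def)
      then show ?thesis by simp
    qed
    show "\<one>\<^bsub>BijGroup (fiber P x0)\<^esub> \<in> monodromy P ` loops_at P x0"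
      using const const_loop by (force simp: BijGroup_def)
    show "inv\<^bsub>BijGroup (fiber P x0)\<^esub> a \<in> monodromy P ` loops_at P x0"
      if a: "a \<in> monodromy P ` loops_at P x0" for a
    proof -
      obtain \<gamma> where \<gamma>: "\<gamma> \<in> loops_at P x0" "a = monodromy P \<gamma>" using a by blast
      note rev = reversepath_loop[OF \<gamma>(1)]
      have "compose (fiber P x0) (monodromy P (reversepath \<gamma>)) (monodromy P \<gamma>) = (\<lambda>y\<in>fiber P x0. y)"
        unfolding compose_def using \<gamma>(1) assms(1)
        by (intro restrict_ext monodromy_reversepath) (auto simp: loops_at_def)
      then have "monodromy P (reversepath \<gamma>) \<otimes>\<^bsub>BijGroup (fiber P x0)\<^esub> a = \<one>\<^bsub>BijGroup (fiber P x0)\<^esub>"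
        using Bij \<gamma> rev by (simp add: BijGroup_def)
      then have "inv\<^bsub>BijGroup (fiber P x0)\<^esub> a = monodromy P (reversepath \<gamma>)"
        using Bij[OF \<gamma>(1)] Bij[OF rev] \<gamma>(2) by (intro B.inv_equality) (auto simp: BijGroup_def)
      then show ?thesis using rev by simp
    qed
  qed
  from B.subgroup_imp_group[OF this] show ?thesis by (simp add: monodromy_group_loops)
qed

text \<open>
  Stated with divisibility, the characterisation of the order of a monodromy operator also covers
  the order \<open>0\<close> of an element of infinite order.
\<close>

lemma monodromy_order:
  assumes "degree P > 0" "\<gamma> \<in> loops_at P x0"
  shows "group.ord (monodromy_group P x0) (monodromy P \<gamma>) dvd n \<longleftrightarrow>
    (\<forall>y\<in>fiber P x0. (monodromy P \<gamma> ^^ n) y = y)"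
proof -
  have "x0 \<in> regular_points P"
    using assms(2) pathstart_in_path_image[of \<gamma>] by (auto simp: loops_at_def)
  interpret M: group "monodromy_group P x0" by (rule group_monodromy_group[OF assms(1)]) fact
  have carr: "monodromy P \<gamma> \<in> carrier (monodromy_group P x0)" using assms(2) by (simp add: monodromy_group_loops)
  have car_Bij: "carrier (monodromy_group P x0) \<subseteq> Bij (fiber P x0)"
    using monodromy_Bij[OF assms(1)] by (auto simp: monodromy_group_loops)
  have pow: "(monodromy P \<gamma> [^]\<^bsub>monodromy_group P x0\<^esub> n) y = (monodromy P \<gamma> ^^ n) y"
    if "y \<in> fiber P x0" for y n
    using that
  proof (induct n arbitrary: y)
    case 0 then show ?case by (simp add: one_monodromy_group)
  next
    case (Suc n)
    have "monodromy P \<gamma> y \<in> fiber P x0"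
      using car_Bij carr Suc(2) by (metis Bij_imp_funcset PiE subsetD)
    then show ?case
      using Suc car_Bij carr M.nat_pow_closed[OF carr, of n]
      by (simp add: mult_monodromy_group subset_iff compose_def funpow_swap1)
  qed
  have "monodromy P \<gamma> [^]\<^bsub>monodromy_group P x0\<^esub> n \<in> Bij (fiber P x0)"
    using car_Bij M.nat_pow_closed[OF carr, of n] by blast
  then have "monodromy P \<gamma> [^]\<^bsub>monodromy_group P x0\<^esub> n = (\<lambda>y\<in>fiber P x0. y) \<longleftrightarrow>
      (\<forall>y\<in>fiber P x0. (monodromy P \<gamma> ^^ n) y = y)"
    using pow by (auto intro!: Bij_eqI simp flip: pow)
  then show ?thesis using M.pow_eq_id[OF carr, of n] by (simp add: one_monodromy_group)
qed

section \<open>Global continuation in the plane\<close>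

lemma open_minus_countable_nonempty:
  fixes S :: "complex set"
  assumes "open S" "S \<noteq> {}" "countable B" shows "S - B \<noteq> {}"
proof
  assume "S - B = {}"
  then have "S \<subseteq> B" by blast
  moreover obtain x r where "r > 0" "ball x r \<subseteq> S" using assms(1,2) open_contains_ball by blast
  ultimately show False using uncountable_ball[of r x] countable_subset assms(3) by (metis subset_trans)
qed

lemma convex_open_minus_countable_connected:
  fixes S :: "complex set"
  assumes "open S" "convex S" "countable B" shows "connected (S - B)"
  using assms by (intro connected_open_diff_countable convex_connected) auto

text \<open>
  This is the monodromy theorem for the line, for holomorphic functions whose values at \<open>z\<close> lie in a
  given set \<open>F z\<close> and which may be undefined on a small set \<open>B\<close>: continuation inside small discs
  implies global continuation.  A function on a disc around \<open>z0\<close> is extended to a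
  larger concentric disc by continuing it into small discs of one radius \<open>\<delta>\<close> centred on the bounding
  circle.  On a compact disc a Lebesgue number bounds \<open>\<delta>\<close> from below, so finitely many such steps
  reach any radius.
\<close>

theorem global_section:
  fixes F :: "complex \<Rightarrow> complex set"
  assumes "closed B" "countable B"
    and loc: "\<And>p. \<exists>e>0. \<forall>V f. open V \<and> connected V \<and> V \<noteq> {} \<and> V \<subseteq> ball p e - B \<and>
        f holomorphic_on V \<and> (\<forall>z\<in>V. f z \<in> F z) \<longrightarrow>
        (\<exists>g. g holomorphic_on (ball p e - B) \<and> (\<forall>z\<in>ball p e - B. g z \<in> F z) \<and> (\<forall>z\<in>V. g z = f z))"
    and V0: "open V0" "connected V0" "V0 \<noteq> {}" "V0 \<subseteq> - B" "f0 holomorphic_on V0" "\<And>z. z \<in> V0 \<Longrightarrow> f0 z \<in> F z"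
  obtains g where "g holomorphic_on (- B)" "\<And>z. z \<notin> B \<Longrightarrow> g z \<in> F z" "\<And>z. z \<in> V0 \<Longrightarrow> g z = f0 z"
proof -
  have op: "open (S - B)" if "open S" for S using that assms(1) by (rule open_Diff)
  define Q where "Q p r \<longleftrightarrow> (\<forall>V f. open V \<and> connected V \<and> V \<noteq> {} \<and> V \<subseteq> ball p r - B \<and>
      f holomorphic_on V \<and> (\<forall>z\<in>V. f z \<in> F z) \<longrightarrow>
      (\<exists>g. g holomorphic_on (ball p r - B) \<and> (\<forall>z\<in>ball p r - B. g z \<in> F z) \<and> (\<forall>z\<in>V. g z = f z)))" for p r
  have "\<exists>r>0. Q p r" for p unfolding Q_def by (rule loc)
  then obtain e where e: "\<And>p. e p > 0" and Q: "\<And>p. Q p (e p)" by metis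
  have ext: "\<exists>g. g holomorphic_on (ball p (e p) - B) \<and> (\<forall>z\<in>ball p (e p) - B. g z \<in> F z) \<and> (\<forall>z\<in>V. g z = f z)"
    if "open V" "connected V" "V \<noteq> {}" "V \<subseteq> ball p (e p) - B" "f holomorphic_on V" "\<forall>z\<in>V. f z \<in> F z" for p V f
    using Q[of p] that unfolding Q_def by (elim allE[of _ V] allE[of _ f] impE) auto
  obtain z0 \<rho> where \<rho>: "\<rho> > 0" "ball z0 \<rho> \<subseteq> V0" using V0(1,3) open_contains_ball by blast
  define E where "E r g \<longleftrightarrow> g holomorphic_on (ball z0 r - B) \<and> (\<forall>z\<in>ball z0 r - B. g z \<in> F z) \<and>
      (\<forall>z\<in>ball z0 \<rho>. g z = f0 z)" for r g
  have id_thm: "f z = g z" if "open D" "convex D" "f holomorphic_on D - B" "g holomorphic_on D - B"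
      "open W" "W \<noteq> {}" "W \<subseteq> D" "\<And>z. z \<in> W - B \<Longrightarrow> f z = g z" "z \<in> D - B" for D W f g z
    by (rule analytic_continuation_open[of "W - B" "D - B" f g])
      (use that op convex_open_minus_countable_connected open_minus_countable_nonempty assms(2) in auto)
  have step: "\<exists>g'. E (r + \<delta>) g'"
    if r: "r \<ge> \<rho>" "E r g" and \<delta>: "\<delta> > 0" "\<And>p. dist z0 p = r \<Longrightarrow> \<exists>q. ball p \<delta> \<subseteq> ball q (e q)" for r g \<delta>
  proof -
    have r0: "r > 0" using r(1) \<rho>(1) by simp
    \<comment> \<open>The bounding circle lies in the closure of the disc.\<close>
    have meets: "D \<inter> ball z0 r \<noteq> {}" if "open D" "m \<in> D" "dist z0 m \<le> r" for D m
      using that r0 open_Int_closure_eq_empty[of D "ball z0 r"] by auto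
    have "\<exists>G. G holomorphic_on (ball p \<delta> - B) \<and> (\<forall>z\<in>ball p \<delta> - B. G z \<in> F z) \<and>
        (\<forall>z\<in>ball p \<delta> \<inter> ball z0 r - B. G z = g z)" if p: "dist z0 p = r" for p
    proof -
      obtain q where q: "ball p \<delta> \<subseteq> ball q (e q)" using \<delta>(2)[OF p] by blast
      let ?V = "ball p \<delta> \<inter> ball z0 r"
      have "?V \<noteq> {}" using meets[of "ball p \<delta>" p] \<delta>(1) p by simp
      then have ne: "?V - B \<noteq> {}" using assms(2) by (intro open_minus_countable_nonempty) auto
      have conn: "connected (?V - B)"
        using assms(2) by (intro convex_open_minus_countable_connected convex_Int) auto
      have "\<exists>G. G holomorphic_on (ball q (e q) - B) \<and> (\<forall>z\<in>ball q (e q) - B. G z \<in> F z) \<and>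
          (\<forall>z\<in>?V - B. G z = g z)"
        using r(2) q op by (intro ext conn ne op) (auto simp: E_def intro: holomorphic_on_subset)
      then obtain G where "G holomorphic_on (ball q (e q) - B)" "\<forall>z\<in>ball q (e q) - B. G z \<in> F z"
          "\<forall>z\<in>?V - B. G z = g z" by blast
      then show ?thesis using q by (intro exI[of _ G]) (auto intro: holomorphic_on_subset)
    qed
    then obtain G where G: "\<And>p. dist z0 p = r \<Longrightarrow> G p holomorphic_on (ball p \<delta> - B)"
        "\<And>p z. dist z0 p = r \<Longrightarrow> z \<in> ball p \<delta> - B \<Longrightarrow> G p z \<in> F z"
        "\<And>p z. dist z0 p = r \<Longrightarrow> z \<in> ball p \<delta> \<inter> ball z0 r - B \<Longrightarrow> G p z = g z" by metis
    \<comment> \<open>Two of the small discs that meet also meet inside the old disc, near the midpoint of their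
      centres, and there both continuations agree with \<open>g\<close>.\<close>
    have G_eq: "G p z = G p' z"
      if "dist z0 p = r" "dist z0 p' = r" "z \<in> ball p \<delta> \<inter> ball p' \<delta> - B" for p p' z
    proof -
      let ?D = "ball p \<delta> \<inter> ball p' \<delta>"
      have "dist p p' < 2 * \<delta>" using that(3) dist_triangle2[of p p' z] by (simp add: dist_commute)
      then have "midpoint p p' \<in> ?D" by (simp add: dist_midpoint)
      moreover have "dist z0 (midpoint p p') \<le> r"
      proof -
        have "midpoint p p' \<in> closed_segment p p'" by simp
        also have "\<dots> \<subseteq> cball z0 r" using that by (intro closed_segment_subset) auto
        finally show ?thesis by simp
      qed
      ultimately have "?D \<inter> ball z0 r \<noteq> {}" by (intro meets) auto
      moreover have "G p holomorphic_on ?D - B" "G p' holomorphic_on ?D - B"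
        by (rule holomorphic_on_subset[OF G(1)]; use that in auto)+
      moreover have "open (?D \<inter> ball z0 r)" by auto
      ultimately show ?thesis
        using that G(3) by (intro id_thm[of ?D "G p" "G p'" "?D \<inter> ball z0 r" z]) (auto intro: convex_Int)
    qed
    \<comment> \<open>The radial projection to the circle picks the centre of a small disc for each new point.\<close>
    define pr where "pr z = z0 + of_real (r / dist z0 z) * (z - z0)" for z
    have pr: "dist z0 (pr z) = r" "z \<in> ball (pr z) \<delta>" if "r \<le> dist z0 z" "dist z0 z < r + \<delta>" for z
    proof -
      have nz: "dist z0 z > 0" using that(1) r0 by linarith
      show "dist z0 (pr z) = r" using nz r0 by (simp add: pr_def dist_norm norm_mult norm_divide norm_minus_commute[of z0 z])
      have "pr z - z = of_real (r / dist z0 z - 1) * (z - z0)" by (simp add: pr_def algebra_simps)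
      then have "dist (pr z) z = \<bar>r / dist z0 z - 1\<bar> * dist z0 z"
        by (simp only: dist_norm norm_mult norm_of_real norm_minus_commute)
      also have "\<dots> = \<bar>(r / dist z0 z - 1) * dist z0 z\<bar>" by (simp add: abs_mult)
      also have "(r / dist z0 z - 1) * dist z0 z = r - dist z0 z" using nz by (simp add: algebra_simps)
      finally show "z \<in> ball (pr z) \<delta>" using that by simp
    qed
    define g' where "g' z = (if dist z0 z < r then g z else G (pr z) z)" for z
    have g'_G: "g' w = G p w" if "dist z0 p = r" "w \<in> ball p \<delta> \<inter> ball z0 (r + \<delta>) - B" for p w
      using that G(3)[of p w] G_eq[of p "pr w" w] pr[of w] by (auto simp: g'_def)
    have g'_F: "g' z \<in> F z" if "z \<in> ball z0 (r + \<delta>) - B" for z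
      using that r(2) G(2)[of "pr z" z] pr[of z] by (auto simp: g'_def E_def)
    have "g' holomorphic_on (ball z0 (r + \<delta>) - B)"
      unfolding holomorphic_on_open[OF op[OF open_ball]]
    proof
      fix z assume z: "z \<in> ball z0 (r + \<delta>) - B"
      have "\<exists>S h. open S \<and> z \<in> S \<and> h holomorphic_on S \<and> (\<forall>w\<in>S. g' w = h w)"
      proof (cases "dist z0 z < r")
        case True
        then show ?thesis using z r(2) op[of "ball z0 r"]
          by (intro exI[of _ "ball z0 r - B"] exI[of _ g]) (auto simp: E_def g'_def)
      next
        case False
        have "open (ball (pr z) \<delta> \<inter> ball z0 (r + \<delta>) - B)" by (intro op) auto
        with False show ?thesis using z pr[of z] G(1)[of "pr z"] g'_G
          by (intro exI[of _ "ball (pr z) \<delta> \<inter> ball z0 (r + \<delta>) - B"] exI[of _ "G (pr z)"])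
            (auto intro: holomorphic_on_subset)
      qed
      then obtain S h where S: "open S" "z \<in> S" "h holomorphic_on S" "\<forall>w\<in>S. g' w = h w" by blast
      then have "g' holomorphic_on S" by (metis holomorphic_cong)
      then show "\<exists>f'. (g' has_field_derivative f') (at z)"
        using S holomorphic_on_open by blast
    qed
    moreover have "g' z = f0 z" if "z \<in> ball z0 \<rho>" for z
      using that r by (auto simp: g'_def E_def)
    ultimately show ?thesis using g'_F unfolding E_def by blast
  qed
  have "\<exists>g. E R g" if R: "R \<ge> \<rho>" for R
  proof -
    have "cball z0 R \<subseteq> \<Union> (range (\<lambda>q. ball q (e q)))" using e by (auto intro: centre_in_ball[THEN iffD2])
    then obtain \<delta> where \<delta>: "\<delta> > 0" "\<And>p. p \<in> cball z0 R \<Longrightarrow> \<exists>D\<in>range (\<lambda>q. ball q (e q)). ball p \<delta> \<subseteq> D"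
      by (rule Heine_Borel_lemma[OF compact_cball]) auto
    have "\<exists>r g. r \<ge> \<rho> \<and> r \<ge> min R (\<rho> + real n * \<delta>) \<and> E r g" for n
    proof (induct n)
      case 0
      have "ball z0 \<rho> - B = ball z0 \<rho>" using \<rho> V0(4) by auto
      then have "E \<rho> f0" using \<rho> V0(5,6) unfolding E_def by (auto intro: holomorphic_on_subset)
      then show ?case by (intro exI[of _ \<rho>] exI[of _ f0]) auto
    next
      case (Suc n)
      then obtain r g where rg: "r \<ge> \<rho>" "r \<ge> min R (\<rho> + real n * \<delta>)" "E r g" by blast
      show ?case
      proof (cases "r \<ge> R")
        case True
        then show ?thesis using rg by (intro exI[of _ r] exI[of _ g]) auto
      next
        case False
        then have "\<exists>q. ball p \<delta> \<subseteq> ball q (e q)" if "dist z0 p = r" for p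
          using \<delta>(2)[of p] that by auto
        from step[OF rg(1,3) \<delta>(1) this] obtain g' where "E (r + \<delta>) g'" by blast
        then show ?thesis using rg False \<delta>(1)
          by (intro exI[of _ "r + \<delta>"] exI[of _ g']) (auto simp: algebra_simps min_le_iff_disj)
      qed
    qed
    moreover obtain n where "real n * \<delta> \<ge> R" using \<delta>(1) reals_Archimedean3 by (metis less_imp_le)
    ultimately obtain r g where rg: "r \<ge> min R (\<rho> + real n * \<delta>)" "E r g" by blast
    have "R \<le> r" using rg(1) \<open>real n * \<delta> \<ge> R\<close> \<rho>(1) by simp
    then have "E R g" using rg(2) unfolding E_def
      by (meson Diff_mono holomorphic_on_subset order_refl subset_ball subsetD)
    then show ?thesis by blast
  qed
  then obtain g where g: "\<And>R. R \<ge> \<rho> \<Longrightarrow> E R (g R)" by metis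
  have g_eq: "g R z = g R' z" if "\<rho> \<le> R" "R \<le> R'" "z \<in> ball z0 R - B" for R R' z
  proof (rule id_thm[of "ball z0 R" "g R" "g R'" "ball z0 \<rho>"])
    have "ball z0 R \<subseteq> ball z0 R'" using that by (simp add: subset_ball)
    then show "g R' holomorphic_on ball z0 R - B"
      using g[of R'] that unfolding E_def by (meson Diff_mono holomorphic_on_subset order_refl order_trans)
  qed (use g[of R] g[of R'] that \<rho>(1) in \<open>auto simp: E_def subset_ball\<close>)
  define h where "h z = g (\<rho> + dist z0 z + 1) z" for z
  have h_eq: "h z = g R z" if "\<rho> \<le> R" "z \<in> ball z0 R - B" for R z
  proof -
    have "g (\<rho> + dist z0 z + 1) z = g (max R (\<rho> + dist z0 z + 1)) z" "g R z = g (max R (\<rho> + dist z0 z + 1)) z"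
      using that \<rho>(1) by (intro g_eq; auto)+
    then show ?thesis by (simp add: h_def)
  qed
  show ?thesis
  proof (rule that[of h])
    show "h holomorphic_on - B"
      unfolding holomorphic_on_open[OF open_Compl[OF assms(1)]]
    proof
      fix z assume z: "z \<in> - B"
      define R where "R = \<rho> + dist z0 z + 1"
      have R: "R \<ge> \<rho>" "z \<in> ball z0 R - B" using z \<rho>(1) by (auto simp: R_def)
      have "g R holomorphic_on (ball z0 R - B)" using g[OF R(1)] unfolding E_def by blast
      then have "h holomorphic_on (ball z0 R - B)"
        by (rule holomorphic_transform) (use h_eq[OF R(1)] in auto)
      then show "\<exists>f'. (h has_field_derivative f') (at z)"
        using R(2) op[OF open_ball] holomorphic_on_open by blast
    qed
    then have hol: "h holomorphic_on V0" using V0(4) holomorphic_on_subset by blast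
    have init: "h w = f0 w" if w: "w \<in> ball z0 \<rho>" for w
    proof -
      have "w \<in> ball z0 \<rho> - B" using w \<rho>(2) V0(4) by blast
      then show ?thesis using h_eq[of \<rho> w] g[of \<rho>] w unfolding E_def by simp
    qed
    show "h z = f0 z" if "z \<in> V0" for z
      by (rule analytic_continuation_open[OF open_ball V0(1) _ V0(2) \<rho>(2) hol V0(5) init that])
        (use \<rho>(1) in simp)
    show "h z \<in> F z" if "z \<notin> B" for z
      using g[of "\<rho> + dist z0 z + 1"] that \<rho>(1) by (auto simp: h_def E_def)
  qed
qed

section \<open>Branched coverings of the sphere by the line\<close>

text \<open>
  The inverse of the coordinate \<open>chart_at a\<close>.
\<close>

fun sphere_pt :: "sphere \<Rightarrow> complex \<Rightarrow> sphere" where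
  "sphere_pt (Some c) w = Some (c + w)"
| "sphere_pt None w = (if w = 0 then None else Some (inverse w))"

lemma sphere_pt_in_disc:
  assumes "e > 0" "norm w < e" shows "sphere_pt a w \<in> sphere_disc a e"
proof (cases a)
  case None
  have "1 / e < norm (inverse w)" if "w \<noteq> 0"
  proof -
    have "norm (inverse w) = 1 / norm w" by (simp add: inverse_eq_divide norm_divide)
    then show ?thesis using assms that by (simp add: frac_less2)
  qed
  then show ?thesis using None by auto
qed (use assms in \<open>auto simp: dist_norm\<close>)

lemma chart_at_in_disc:
  assumes "e > 0" "x \<in> sphere_disc a e"
  shows "norm (chart_at a x) < e" "sphere_pt a (chart_at a x) = x"
proof -
  show "norm (chart_at a x) < e"
  proof (cases a)
    case None
    then show ?thesis
    proof (cases x)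
      case (Some y)
      then have "1 / e < norm y" using assms None by auto
      moreover from this have "norm y > 0" using assms(1) by (meson less_trans zero_less_divide_1_iff)
      moreover have "norm (inverse y) = 1 / norm y" by (simp add: inverse_eq_divide norm_divide)
      ultimately have "norm (inverse y) < e" using assms(1) by (simp only:) (simp add: field_simps)
      then show ?thesis using None Some by simp
    qed (use assms None in auto)
  next
    case (Some c)
    then show ?thesis using assms by (cases x) (auto simp: dist_norm norm_minus_commute)
  qed
  show "sphere_pt a (chart_at a x) = x"
  proof (cases a)
    case None
    have "y \<noteq> 0" if "1 / e < norm y" for y :: complex
      using that assms(1) by (auto simp: divide_less_0_iff)
    then show ?thesis using assms None by (cases x) auto
  next
    case (Some c)
    then show ?thesis using assms by (cases x) auto
  qed
qed

lemma chart_at_sphere_pt: "chart_at a (sphere_pt a w) = w"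
  by (cases a) auto

lemma sphere_pt_inj: "sphere_pt a w = sphere_pt a w' \<longleftrightarrow> w = w'"
  by (metis chart_at_sphere_pt)

lemma sphere_pt_0: "sphere_pt a w = a \<longleftrightarrow> w = 0"
  by (cases a) auto

lemma openin_sphere_disc:
  assumes "e > 0" shows "openin riemann_sphere (sphere_disc a e)"
proof (cases a)
  case None
  have "{x. 1 / e < norm x} = UNIV - cball (0::complex) (1 / e)" by auto
  then have "sphere_disc None e = insert None (Some ` (topspace euclidean - cball 0 (1 / e)))" by simp
  then show ?thesis using None
    unfolding openin_Alexandroff_compactification
    by (intro disjI2 exI[of _ "cball (0::complex) (1 / e)"]) (auto simp: compact_cball)
qed simp

locale line_covering =
  fixes A :: "sphere set" and R :: "sphere \<Rightarrow> nat" and \<pi> :: "complex \<Rightarrow> sphere"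
  assumes covering: "universal_covering_by_line A R \<pi>"
begin

definition branch_order :: "sphere \<Rightarrow> nat" where
  "branch_order a = (if a \<in> A then R a else 1)"

abbreviation sheets :: "sphere \<Rightarrow> real \<Rightarrow> complex set set" where
  "sheets a e \<equiv> components (\<pi> -` sphere_disc a e)"

text \<open>
  The normal form of \<open>\<pi>\<close> over a disc of the sphere on one component of its preimage, with the exponent
  already identified as the prescribed order.
\<close>

definition disc_chart :: "sphere \<Rightarrow> real \<Rightarrow> complex set \<Rightarrow> (complex \<Rightarrow> complex) \<Rightarrow> bool" where
  "disc_chart a e U \<phi> \<longleftrightarrow> e > 0 \<and> U \<in> sheets a e \<and>
     \<phi> holomorphic_on U \<and> bij_betw \<phi> U (ball 0 1) \<and>
     (\<forall>z\<in>U. \<pi> z = sphere_pt a (of_real e * \<phi> z ^ branch_order a))"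

lemma open_preimage_disc: "e > 0 \<Longrightarrow> open (\<pi> -` sphere_disc a e)"
  using covering openin_continuous_map_preimage[OF _ openin_sphere_disc[of e a]]
  unfolding universal_covering_by_line_def branched_covering_def
  by (fastforce simp: vimage_def)

lemma surj_projection: "surj \<pi>"
  using covering by (simp add: universal_covering_by_line_def branched_covering_def)

text \<open>
  The exponent in the normal form is the multiplicity of \<open>\<pi>\<close> at the point of the component that lies
  over the centre, and this multiplicity is prescribed by the signature.
\<close>

lemma ex_disc_charts:
  obtains e where "e > 0" "\<And>U. U \<in> sheets a e \<Longrightarrow> \<exists>\<phi>. disc_chart a e U \<phi>"
    "branch_order a > 0"
proof -
  obtain e where e: "e > 0" and ch: "\<And>U. U \<in> sheets a e \<Longrightarrow>
      \<exists>k>0. \<exists>\<phi>. \<phi> holomorphic_on U \<and> bij_betw \<phi> U (ball 0 1) \<and>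
          (\<forall>z\<in>U. chart_at a (\<pi> z) = of_real e * \<phi> z ^ k)"
    using covering unfolding universal_covering_by_line_def branched_covering_def by metis
  have main: "branch_order a > 0 \<and> (\<exists>\<phi>. disc_chart a e U \<phi>)" if U: "U \<in> sheets a e" for U
  proof -
    obtain k \<phi> where k: "k > 0" and \<phi>: "\<phi> holomorphic_on U" "bij_betw \<phi> U (ball 0 1)"
        "\<And>z. z \<in> U \<Longrightarrow> chart_at a (\<pi> z) = of_real e * \<phi> z ^ k" using ch[OF U] by blast
    have op: "open U" using U open_components open_preimage_disc[OF e] by blast
    have disc: "\<pi> z \<in> sphere_disc a e" if "z \<in> U" for z using in_components_subset[OF U] that by blast
    have pt: "\<pi> z = sphere_pt a (of_real e * \<phi> z ^ k)" if "z \<in> U" for z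
      using chart_at_in_disc(2)[OF e disc[OF that]] \<phi>(3)[OF that] by simp
    obtain z where z: "z \<in> U" "\<phi> z = 0" using \<phi>(2) by (metis bij_betw_iff_bijections centre_in_ball zero_less_one)
    have \<pi>z: "\<pi> z = a" using pt[OF z(1)] z(2) k by (simp add: sphere_pt_0)
    have inj: "inj_on \<phi> U" using \<phi>(2) by (rule bij_betw_imp_inj_on)
    have evU: "\<forall>\<^sub>F w in at z. w \<in> U" using op z(1) eventually_at_in_open' by blast
    then have nz: "\<forall>\<^sub>F w in at z. \<phi> w \<noteq> 0"
      using eventually_neq_at_within[of z z UNIV]
      by eventually_elim (use inj z in \<open>metis inj_on_eq_iff\<close>)
    have an: "\<phi> analytic_on {z}" using \<phi>(1) op z(1) analytic_at by blast
    have "zorder \<phi> z = 1"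
      using holomorphic_injective_imp_regular[OF \<phi>(1) op inj z(1)] z
      by (intro zorder_zero_eqI[OF \<phi>(1) op z(1)]) auto
    have "multiplicity_at \<pi> z = zorder (\<lambda>w. of_real e * \<phi> w ^ k) z"
      unfolding multiplicity_at_def \<pi>z by (rule zorder_cong) (use evU \<phi>(3) in \<open>auto elim: eventually_mono\<close>)
    also have "\<dots> = zorder (\<lambda>w. \<phi> w ^ k) z" using e by (intro zorder_cmult) auto
    also have "\<dots> = int k * zorder \<phi> z"
      using nz eventually_frequently[OF at_neq_bot[of z]] an
      by (intro zorder_power analytic_on_imp_meromorphic_on) auto
    finally have "multiplicity_at \<pi> z = int k" using \<open>zorder \<phi> z = 1\<close> by simp
    then have "k = branch_order a"
      using covering \<pi>z unfolding universal_covering_by_line_def branch_order_def by (metis of_nat_eq_iff of_nat_1)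
    then show ?thesis using k U e \<phi> pt unfolding disc_chart_def by blast
  qed
  obtain p where "\<pi> p = a" using surj_projection by (metis surjD)
  then have "p \<in> \<pi> -` sphere_disc a e" using sphere_pt_in_disc[of e 0 a] sphere_pt_0[of a 0] e by simp
  then have "branch_order a > 0" using main componentsI by blast
  then show ?thesis using that[OF e] main by blast
qed

lemma branch_order_pos: "branch_order a > 0" by (rule ex_disc_charts[of a])

lemma disc_chartD:
  assumes "disc_chart a e U \<phi>"
  shows "e > 0" "open U" "connected U" "U \<noteq> {}" "\<phi> holomorphic_on U" "inj_on \<phi> U"
    "\<And>z. z \<in> U \<Longrightarrow> norm (\<phi> z) < 1"
    "\<And>z. z \<in> U \<Longrightarrow> \<pi> z = sphere_pt a (of_real e * \<phi> z ^ branch_order a)"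
    "\<And>z. z \<in> U \<Longrightarrow> \<pi> z = a \<longleftrightarrow> \<phi> z = 0"
    "\<And>z. z \<in> U \<Longrightarrow> \<pi> z \<in> sphere_disc a e"
proof -
  show e: "e > 0" and pt: "\<And>z. z \<in> U \<Longrightarrow> \<pi> z = sphere_pt a (of_real e * \<phi> z ^ branch_order a)"
      and "\<phi> holomorphic_on U" "inj_on \<phi> U"
    using assms unfolding disc_chart_def bij_betw_def by auto
  have U: "U \<in> sheets a e" using assms unfolding disc_chart_def by blast
  show "open U" by (rule open_components[OF open_preimage_disc[OF e] U])
  show "connected U" "U \<noteq> {}" using in_components_connected[OF U] in_components_nonempty[OF U] .
  show "\<pi> z \<in> sphere_disc a e" if "z \<in> U" for z using in_components_subset[OF U] that by blast
  show "norm (\<phi> z) < 1" if "z \<in> U" for z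
    using assms that unfolding disc_chart_def bij_betw_def by (metis imageI mem_ball_0)
  show "\<pi> z = a \<longleftrightarrow> \<phi> z = 0" if "z \<in> U" for z
    using pt[OF that] e branch_order_pos[of a] by (auto simp: sphere_pt_0)
qed

lemma disc_chart_inverse:
  assumes "disc_chart a e U \<phi>"
  obtains \<psi> where "\<psi> holomorphic_on ball 0 1" "\<And>z. z \<in> U \<Longrightarrow> \<psi> (\<phi> z) = z"
    "\<And>w. norm w < 1 \<Longrightarrow> \<psi> w \<in> U" "\<And>w. norm w < 1 \<Longrightarrow> \<phi> (\<psi> w) = w"
proof -
  have im: "\<phi> ` U = ball 0 1" using assms unfolding disc_chart_def bij_betw_def by blast
  obtain \<psi> where \<psi>: "\<psi> holomorphic_on (\<phi> ` U)" "\<And>z. z \<in> U \<Longrightarrow> \<psi> (\<phi> z) = z"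
    using holomorphic_has_inverse disc_chartD(2,5,6)[OF assms] by metis
  have "\<psi> w \<in> U \<and> \<phi> (\<psi> w) = w" if "norm w < 1" for w
  proof -
    have "w \<in> \<phi> ` U" using that im by simp
    then show ?thesis using \<psi>(2) by auto
  qed
  then show ?thesis using that[of \<psi>] \<psi> im by auto
qed

lemma charts_over:
  obtains e where "\<And>U. U \<in> sheets a e \<Longrightarrow> \<exists>\<phi>. disc_chart a e U \<phi>"
    "\<And>p. \<pi> p = a \<Longrightarrow> \<exists>U \<phi>. disc_chart a e U \<phi> \<and> p \<in> U \<and> \<phi> p = 0"
proof -
  obtain e where e: "e > 0" "\<And>U. U \<in> sheets a e \<Longrightarrow> \<exists>\<phi>. disc_chart a e U \<phi>"
    by (rule ex_disc_charts) (rule that)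
  have "\<exists>U \<phi>. disc_chart a e U \<phi> \<and> p \<in> U \<and> \<phi> p = 0" if p: "\<pi> p = a" for p
  proof -
    have "p \<in> \<pi> -` sphere_disc a e"
      using sphere_pt_in_disc[of e 0 a] sphere_pt_0[of a 0] e(1) p by simp
    then have "connected_component_set (\<pi> -` sphere_disc a e) p \<in> sheets a e"
        "p \<in> connected_component_set (\<pi> -` sphere_disc a e) p"
      by (auto simp: componentsI)
    then show ?thesis using e(2) p disc_chartD(9) by blast
  qed
  then show ?thesis using that e(2) by blast
qed

lemma chart_around:
  obtains e U \<phi> where "disc_chart (\<pi> p) e U \<phi>" "p \<in> U" "\<phi> p = 0"
  by (rule charts_over[of "\<pi> p"]) (use that in blast)

subsection \<open>Deck transformations\<close>

text \<open>
  These maps are all the local lifts of \<open>\<pi>\<close> through itself.  They exist between any two components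
  over the same disc because the exponents in both normal forms are equal.
\<close>

lemma rotate_between_charts:
  assumes U: "disc_chart a e U \<phi>" and V: "disc_chart a e V \<theta>" and \<zeta>: "\<zeta> ^ branch_order a = 1"
  obtains f where "f holomorphic_on U" "inj_on f U" "\<And>z. z \<in> U \<Longrightarrow> f z \<in> V"
    "\<And>z. z \<in> U \<Longrightarrow> \<pi> (f z) = \<pi> z" "\<And>z. z \<in> U \<Longrightarrow> \<theta> (f z) = \<zeta> * \<phi> z"
proof -
  note dU = disc_chartD[OF U] and dV = disc_chartD[OF V]
  obtain \<psi> where \<psi>: "\<psi> holomorphic_on ball 0 1" "\<And>w. norm w < 1 \<Longrightarrow> \<psi> w \<in> V"
      "\<And>w. norm w < 1 \<Longrightarrow> \<theta> (\<psi> w) = w"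
    by (rule disc_chart_inverse[OF V]) (rule that)
  have "norm \<zeta> = 1" using power_eq_1_iff[OF \<zeta>] branch_order_pos[of a] by auto
  then have small: "norm (\<zeta> * \<phi> z) < 1" if "z \<in> U" for z using dU(7)[OF that] by (simp add: norm_mult)
  show ?thesis
  proof (rule that[of "\<lambda>z. \<psi> (\<zeta> * \<phi> z)"])
    show "(\<lambda>z. \<psi> (\<zeta> * \<phi> z)) holomorphic_on U"
      using small by (intro holomorphic_on_compose_gen[of "\<lambda>z. \<zeta> * \<phi> z" U \<psi> "ball 0 1", unfolded o_def]
          holomorphic_intros dU(5) \<psi>(1)) auto
    show ch: "\<theta> (\<psi> (\<zeta> * \<phi> z)) = \<zeta> * \<phi> z" and "\<psi> (\<zeta> * \<phi> z) \<in> V" if "z \<in> U" for z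
      using \<psi>(2,3) small[OF that] by auto
    show "inj_on (\<lambda>z. \<psi> (\<zeta> * \<phi> z)) U"
    proof (rule inj_onI)
      fix z z' assume z: "z \<in> U" "z' \<in> U" "\<psi> (\<zeta> * \<phi> z) = \<psi> (\<zeta> * \<phi> z')"
      then have "\<zeta> * \<phi> z = \<zeta> * \<phi> z'" by (metis ch)
      then show "z = z'" using z dU(6) \<open>norm \<zeta> = 1\<close> by (auto dest: inj_onD)
    qed
    show "\<pi> (\<psi> (\<zeta> * \<phi> z)) = \<pi> z" if "z \<in> U" for z
      using dU(8)[OF that] dV(8)[of "\<psi> (\<zeta> * \<phi> z)"] \<psi>(2)[OF small[OF that]] ch[OF that] \<zeta>
      by (simp add: power_mult_distrib)
  qed
qed

text \<open>
  In the charts, a local lift satisfies \<open>\<theta> (f z) ^ k = \<phi> z ^ k\<close>.  So \<open>\<theta> (f z) / \<phi> z\<close> is a continuous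
  function with values in the \<open>k\<close>-th roots of unity, hence constant.
\<close>

lemma deck_germ_extends:
  assumes U: "disc_chart a e U \<phi>" and V: "open V" "connected V" "V \<noteq> {}" "V \<subseteq> U"
    and all: "\<And>W. W \<in> sheets a e \<Longrightarrow> \<exists>\<theta>. disc_chart a e W \<theta>"
    and f: "f holomorphic_on V" "\<And>z. z \<in> V \<Longrightarrow> \<pi> (f z) = \<pi> z"
  obtains g where "g holomorphic_on U" "inj_on g U" "\<And>z. z \<in> U \<Longrightarrow> \<pi> (g z) = \<pi> z"
    "\<And>z. z \<in> V \<Longrightarrow> g z = f z"
proof -
  note dU = disc_chartD[OF U]
  let ?k = "branch_order a"
  have "f ` V \<subseteq> \<pi> -` sphere_disc a e" using f(2) V(4) dU(10) by auto
  moreover have "connected (f ` V)"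
    using f(1) V(2) by (intro connected_continuous_image holomorphic_on_imp_continuous_on)
  ultimately obtain W where W: "W \<in> sheets a e" "f ` V \<subseteq> W"
    using exists_component_superset[of "f ` V" "\<pi> -` sphere_disc a e"] V(3) by (metis empty_is_image subset_empty)
  obtain \<theta> where \<theta>: "disc_chart a e W \<theta>" using all[OF W(1)] by blast
  note dW = disc_chartD[OF \<theta>]
  have pow: "\<theta> (f z) ^ ?k = \<phi> z ^ ?k" if "z \<in> V" for z
  proof -
    have "sphere_pt a (of_real e * \<theta> (f z) ^ ?k) = sphere_pt a (of_real e * \<phi> z ^ ?k)"
      using dU(8)[of z] dW(8)[of "f z"] f(2)[OF that] that V(4) W(2) by (metis image_subset_iff subsetD)
    then show ?thesis using dU(1) by (simp add: sphere_pt_inj)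
  qed
  define Z where "Z = {z \<in> U. \<phi> z = 0}"
  have cZ: "countable Z"
  proof -
    have "finite (\<phi> ` Z)" unfolding Z_def by (rule finite_subset[of _ "{0}"]) auto
    then show ?thesis
      using finite_imageD[of \<phi> Z] inj_on_subset[OF dU(6), of Z] by (auto simp: Z_def countable_finite)
  qed
  have conn: "connected (V - Z)" using V cZ by (intro connected_open_diff_countable) auto
  have ne: "V - Z \<noteq> {}" using V cZ by (intro open_minus_countable_nonempty)
  have "(\<lambda>z. \<theta> (f z) / \<phi> z) constant_on (V - Z)"
  proof (rule continuous_finite_range_constant[OF conn])
    have "(\<theta> \<circ> f) holomorphic_on V" using dW(5) f(1) W(2) by (intro holomorphic_on_compose_gen) auto
    then have "(\<lambda>z. \<theta> (f z) / \<phi> z) holomorphic_on (V - Z)"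
      using dU(5) V(4) by (intro holomorphic_intros) (auto simp: o_def Z_def intro: holomorphic_on_subset)
    then show "continuous_on (V - Z) (\<lambda>z. \<theta> (f z) / \<phi> z)" by (rule holomorphic_on_imp_continuous_on)
    have "(\<lambda>z. \<theta> (f z) / \<phi> z) ` (V - Z) \<subseteq> {w. w ^ ?k = 1}"
    proof
      fix w assume "w \<in> (\<lambda>z. \<theta> (f z) / \<phi> z) ` (V - Z)"
      then obtain z where "z \<in> V" "\<phi> z \<noteq> 0" "w = \<theta> (f z) / \<phi> z" using V(4) by (auto simp: Z_def)
      then show "w \<in> {w. w ^ ?k = 1}" using pow[of z] by (simp add: power_divide)
    qed
    then show "finite ((\<lambda>z. \<theta> (f z) / \<phi> z) ` (V - Z))"
      by (rule finite_subset) (use branch_order_pos in \<open>simp add: finite_roots_unity Suc_leI\<close>)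
  qed
  then obtain \<zeta> where \<zeta>: "\<And>z. z \<in> V - Z \<Longrightarrow> \<theta> (f z) / \<phi> z = \<zeta>" unfolding constant_on_def by blast
  have \<zeta>f: "\<theta> (f z) = \<zeta> * \<phi> z" if "z \<in> V" for z
  proof (cases "z \<in> Z")
    case True
    then have "\<theta> (f z) ^ ?k = 0" using pow[OF that] branch_order_pos by (simp add: Z_def)
    then show ?thesis using True by (simp add: Z_def)
  next
    case False
    then show ?thesis using \<zeta>[of z] that V(4) by (auto simp: Z_def field_simps)
  qed
  obtain z1 where z1: "z1 \<in> V - Z" using ne by blast
  have "\<zeta> ^ ?k = 1" using pow[of z1] \<zeta>[OF z1] z1 V(4) by (auto simp: power_divide Z_def)
  from rotate_between_charts[OF U \<theta> this] obtain g where
    g: "g holomorphic_on U" "inj_on g U" "\<And>z. z \<in> U \<Longrightarrow> g z \<in> W"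
      "\<And>z. z \<in> U \<Longrightarrow> \<pi> (g z) = \<pi> z" "\<And>z. z \<in> U \<Longrightarrow> \<theta> (g z) = \<zeta> * \<phi> z" by metis
  moreover have "g z = f z" if "z \<in> V" for z
  proof (rule inj_onD[OF dW(6)])
    show "\<theta> (g z) = \<theta> (f z)" using g(5)[of z] \<zeta>f[OF that] that V(4) by auto
    show "g z \<in> W" "f z \<in> W" using g(3)[of z] that W(2) V(4) by auto
  qed
  ultimately show ?thesis using that by blast
qed

definition deck :: "(complex \<Rightarrow> complex) set" where
  "deck = {g. g holomorphic_on UNIV \<and> bij g \<and> (\<forall>z. \<pi> (g z) = \<pi> z)}"

lemma deck_germ_global:
  assumes "open V" "connected V" "V \<noteq> {}" "f holomorphic_on V" "\<And>z. z \<in> V \<Longrightarrow> \<pi> (f z) = \<pi> z"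
  obtains g where "g holomorphic_on UNIV" "\<And>z. \<pi> (g z) = \<pi> z" "\<And>z. z \<in> V \<Longrightarrow> g z = f z"
proof -
  have loc: "\<exists>r>0. \<forall>V f. open V \<and> connected V \<and> V \<noteq> {} \<and> V \<subseteq> ball p r - {} \<and>
      f holomorphic_on V \<and> (\<forall>z\<in>V. f z \<in> {w. \<pi> w = \<pi> z}) \<longrightarrow>
      (\<exists>g. g holomorphic_on (ball p r - {}) \<and> (\<forall>z\<in>ball p r - {}. g z \<in> {w. \<pi> w = \<pi> z}) \<and> (\<forall>z\<in>V. g z = f z))"
    for p
  proof -
    obtain e where charts: "\<And>U. U \<in> sheets (\<pi> p) e \<Longrightarrow> \<exists>\<phi>. disc_chart (\<pi> p) e U \<phi>"
      "\<And>q. \<pi> q = \<pi> p \<Longrightarrow> \<exists>U \<phi>. disc_chart (\<pi> p) e U \<phi> \<and> q \<in> U \<and> \<phi> q = 0"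
      by (rule charts_over) (rule that)
    obtain U \<phi> where U: "disc_chart (\<pi> p) e U \<phi>" "p \<in> U" using charts(2)[OF refl] by blast
    obtain r where r: "r > 0" "ball p r \<subseteq> U" using disc_chartD(2)[OF U(1)] U(2) open_contains_ball by blast
    have "\<exists>g. g holomorphic_on ball p r \<and> (\<forall>z\<in>ball p r. \<pi> (g z) = \<pi> z) \<and> (\<forall>z\<in>V. g z = f z)"
      if V: "open V" "connected V" "V \<noteq> {}" "V \<subseteq> ball p r" and f: "f holomorphic_on V" "\<forall>z\<in>V. \<pi> (f z) = \<pi> z" for V f
    proof -
      obtain g where "g holomorphic_on U" "\<And>z. z \<in> U \<Longrightarrow> \<pi> (g z) = \<pi> z" "\<And>z. z \<in> V \<Longrightarrow> g z = f z"
        by (rule deck_germ_extends[OF U(1) V(1-3) _ charts(1) f(1)]) (use V f r that in auto)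
      then show ?thesis using r(2) by (intro exI[of _ g]) (auto intro: holomorphic_on_subset)
    qed
    then show ?thesis using r(1) by (intro exI[of _ r]) simp
  qed
  show ?thesis
    by (rule global_section[OF closed_empty countable_empty loc assms(1-3) _ assms(4)])
      (use assms(5) that in auto)
qed

text \<open>
  Near any point the lift is injective by its normal form; the global extension of a local inverse is
  a global inverse by the identity theorem.
\<close>

lemma entire_lift_in_deck:
  assumes "g holomorphic_on UNIV" "\<And>z. \<pi> (g z) = \<pi> z"
  shows "g \<in> deck"
proof -
  define p :: complex where "p = 0"
  obtain e where charts: "\<And>U. U \<in> sheets (\<pi> p) e \<Longrightarrow> \<exists>\<phi>. disc_chart (\<pi> p) e U \<phi>"
    "\<And>q. \<pi> q = \<pi> p \<Longrightarrow> \<exists>U \<phi>. disc_chart (\<pi> p) e U \<phi> \<and> q \<in> U \<and> \<phi> q = 0"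
    by (rule charts_over) (rule that)
  obtain U \<phi> where U: "disc_chart (\<pi> p) e U \<phi>" using charts(2)[OF refl] by blast
  note dU = disc_chartD[OF U]
  have inj: "inj_on g U"
  proof -
    obtain g' where "inj_on g' U" "\<And>z. z \<in> U \<Longrightarrow> g' z = g z"
      by (rule deck_germ_extends[OF U dU(2-4) _ charts(1), of g]) (use assms in \<open>auto intro: holomorphic_on_subset\<close>)
    then show ?thesis using inj_on_cong by metis
  qed
  have hol: "g holomorphic_on U" using assms(1) holomorphic_on_subset by blast
  obtain h0 where h0: "h0 holomorphic_on (g ` U)" "\<And>z. z \<in> U \<Longrightarrow> h0 (g z) = z"
    using holomorphic_has_inverse[OF hol dU(2) inj] by metis
  have op: "open (g ` U)" by (rule open_mapping_thm3[OF hol dU(2) inj])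
  have "connected (g ` U)"
    using hol dU(3) by (intro connected_continuous_image holomorphic_on_imp_continuous_on)
  then obtain h where h: "h holomorphic_on UNIV" "\<And>z. \<pi> (h z) = \<pi> z" "\<And>z. z \<in> g ` U \<Longrightarrow> h z = h0 z"
    using deck_germ_global[OF op _ _ h0(1)] h0(2) dU(4) assms(2) by (metis (no_types, lifting) image_iff empty_is_image)
  have hg: "h (g z) = z" for z
    by (rule analytic_continuation_open[of U UNIV "\<lambda>z. h (g z)" "\<lambda>z. z"])
      (use dU h h0 assms(1) in \<open>auto intro!: holomorphic_intros
         holomorphic_on_compose_gen[of g UNIV h UNIV, unfolded o_def]\<close>)
  have gh: "g (h z) = z" for z
    by (rule analytic_continuation_open[of "g ` U" UNIV "\<lambda>z. g (h z)" "\<lambda>z. z"])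
      (use dU h h0 assms(1) op in \<open>auto intro!: holomorphic_intros
         holomorphic_on_compose_gen[of h UNIV g UNIV, unfolded o_def]\<close>)
  have "bij g" using hg gh by (metis bijI')
  then show ?thesis using assms by (simp add: deck_def)
qed

lemma deck_transitive:
  assumes "\<pi> p = \<pi> q" obtains g where "g \<in> deck" "g p = q"
proof -
  obtain e where charts: "\<And>U. U \<in> sheets (\<pi> p) e \<Longrightarrow> \<exists>\<phi>. disc_chart (\<pi> p) e U \<phi>"
    "\<And>q. \<pi> q = \<pi> p \<Longrightarrow> \<exists>U \<phi>. disc_chart (\<pi> p) e U \<phi> \<and> q \<in> U \<and> \<phi> q = 0"
    by (rule charts_over) (rule that)
  obtain U \<phi> V \<theta> where U: "disc_chart (\<pi> p) e U \<phi>" "p \<in> U" "\<phi> p = 0"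
      and V: "disc_chart (\<pi> p) e V \<theta>" "q \<in> V" "\<theta> q = 0"
    using charts(2)[OF refl] charts(2)[OF assms[symmetric]] by blast
  obtain f where f: "f holomorphic_on U" "\<And>z. z \<in> U \<Longrightarrow> f z \<in> V"
    "\<And>z. z \<in> U \<Longrightarrow> \<pi> (f z) = \<pi> z" "\<And>z. z \<in> U \<Longrightarrow> \<theta> (f z) = 1 * \<phi> z"
    by (rule rotate_between_charts[OF U(1) V(1) power_one]) (rule that)
  have "\<theta> (f p) = \<theta> q" using f(4)[OF U(2)] U(3) V(3) by simp
  then have "f p = q" using inj_onD[OF disc_chartD(6)[OF V(1)]] f(2)[OF U(2)] V(2) by blast
  moreover obtain g where "g holomorphic_on UNIV" "\<And>z. \<pi> (g z) = \<pi> z" "\<And>z. z \<in> U \<Longrightarrow> g z = f z"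
    by (rule deck_germ_global[OF disc_chartD(2-4)[OF U(1)] f(1,3)]) (auto intro: that)
  ultimately show ?thesis using entire_lift_in_deck U(2) by (intro that[of g]) auto
qed

lemma deck_id: "id \<in> deck" by (auto simp: deck_def)

lemma deck_comp: "g \<in> deck \<Longrightarrow> h \<in> deck \<Longrightarrow> g \<circ> h \<in> deck"
  unfolding deck_def by (auto intro: bij_comp holomorphic_on_compose_gen)

lemma deck_inv:
  assumes "g \<in> deck" shows "inv_into UNIV g \<in> deck"
proof -
  have g: "g holomorphic_on UNIV" "bij g" "\<And>z. \<pi> (g z) = \<pi> z" using assms by (auto simp: deck_def)
  obtain h where "h holomorphic_on range g" "\<And>z. h (g z) = z"
    using holomorphic_has_inverse[OF g(1)] g(2) by (metis UNIV_I bij_is_inj open_UNIV)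
  moreover have "range g = UNIV" using g(2) bij_is_surj by blast
  ultimately have "h holomorphic_on UNIV" "h = inv_into UNIV g"
    using g(2) by (auto simp: inv_unique_comp fun_eq_iff bij_is_surj surj_f_inv_f) (metis bij_inv_eq_iff)
  moreover have "\<pi> (inv_into UNIV g z) = \<pi> z" for z using g(2,3) by (metis bij_inv_eq_iff)
  ultimately show ?thesis using g(2) by (auto simp: deck_def bij_imp_bij_inv)
qed

text \<open>
  A homeomorphism is a proper map, and a proper entire function is a polynomial.  The derivative of
  an injective one has no zeros, so it is constant.
\<close>

lemma deck_affine:
  assumes "g \<in> deck" obtains a b where "a \<noteq> 0" "\<And>z. g z = a * z + b"
proof -
  have g: "g holomorphic_on UNIV" "bij g" and h: "inv_into UNIV g holomorphic_on UNIV"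
    using assms deck_inv[OF assms] by (auto simp: deck_def)
  have "compact {z. g z \<in> K}" if "compact K" for K
  proof -
    have "{z. g z \<in> K} = inv_into UNIV g ` K" using g(2) bij_vimage_eq_inv_image[of g K] by (simp add: vimage_def)
    then show ?thesis
      using that h by (auto intro!: compact_continuous_image holomorphic_on_imp_continuous_on intro: holomorphic_on_subset)
  qed
  then obtain c n where c: "g = (\<lambda>z. \<Sum>i\<le>n. c i * z ^ i)" using proper_map_polyfun_eq[OF g(1)] by blast
  define p where "p = (\<Sum>i\<le>n. Polynomial.monom (c i) i)"
  have gp: "g = poly p" by (simp add: c p_def poly_sum poly_monom fun_eq_iff)
  have "poly (pderiv p) z \<noteq> 0" for z
  proof -
    have "deriv g z \<noteq> 0" using holomorphic_injective_imp_regular[OF g(1) open_UNIV] g(2) bij_is_inj by blast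
    then show ?thesis using DERIV_imp_deriv[OF poly_DERIV] gp by metis
  qed
  then have "constant (poly (pderiv p))" using fundamental_theorem_of_algebra by blast
  then have "degree (pderiv p) = 0" using constant_degree by blast
  then have "degree p \<le> 1" by (simp add: degree_pderiv)
  then obtain a b where p: "p = [:b, a:]" using degree1_coeffs
    by (metis degree_eq_zeroE le_Suc_eq One_nat_def le_zero_eq pCons_0_0)
  have "a \<noteq> 0"
  proof
    assume "a = 0"
    then have "g 0 = g 1" using gp p by simp
    then show False using g(2) by (metis bij_pointE zero_neq_one)
  qed
  then show ?thesis using that[of a b] gp p by (simp add: algebra_simps)
qed

definition deck_group :: "(complex \<Rightarrow> complex) monoid" where
  "deck_group = \<lparr>carrier = deck, mult = (\<circ>), one = id\<rparr>"

lemma group_deck: "group deck_group"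
proof (rule groupI)
  fix g assume "g \<in> carrier deck_group"
  then show "\<exists>h\<in>carrier deck_group. h \<otimes>\<^bsub>deck_group\<^esub> g = \<one>\<^bsub>deck_group\<^esub>"
    using deck_inv[of g] by (intro bexI[of _ "inv_into UNIV g"]) (auto simp: deck_group_def deck_def bij_is_inj)
qed (auto simp: deck_group_def deck_comp deck_id o_assoc)

subsection \<open>The unbranched part\<close>

definition proj :: "complex \<Rightarrow> complex" where "proj z = the (\<pi> z)"

lemma proj_holomorphic:
  assumes "open S" "\<And>z. z \<in> S \<Longrightarrow> \<pi> z \<noteq> None" shows "proj holomorphic_on S"
proof -
  have "proj field_differentiable at p" if p: "p \<in> S" for p
  proof -
    obtain c where c: "\<pi> p = Some c" using assms(2)[OF p] by blast
    obtain e U \<phi> where U: "disc_chart (\<pi> p) e U \<phi>" "p \<in> U" "\<phi> p = 0" by (rule chart_around) (rule that)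
    note dU = disc_chartD[OF U(1)]
    have "(\<lambda>z. c + of_real e * \<phi> z ^ branch_order (\<pi> p)) holomorphic_on U"
      by (intro holomorphic_intros dU)
    then have "proj holomorphic_on U"
      by (rule holomorphic_transform) (simp add: proj_def dU(8) c)
    then show ?thesis using dU(2) U(2) holomorphic_on_imp_differentiable_at by blast
  qed
  then show ?thesis by (simp add: holomorphic_on_def field_differentiable_at_within)
qed

text \<open>
  Over points outside \<open>A\<close> the exponent in the normal form is \<open>1\<close>, so every component over a disc
  around such a point is mapped homeomorphically.
\<close>

lemma proj_covering_space:
  assumes "open S" "\<And>x. x \<in> S \<Longrightarrow> Some x \<notin> A"
  shows "covering_space (\<pi> -` (Some ` S)) proj S"
proof
  have op: "open (\<pi> -` (Some ` S))"
    using covering openin_continuous_map_preimage[of euclidean riemann_sphere \<pi> "Some ` S"] assms(1)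
    unfolding universal_covering_by_line_def branched_covering_def by (fastforce simp: vimage_def)
  then show "continuous_on (\<pi> -` (Some ` S)) proj"
    by (intro holomorphic_on_imp_continuous_on proj_holomorphic) auto
  show "proj ` (\<pi> -` (Some ` S)) = S"
  proof
    show "S \<subseteq> proj ` (\<pi> -` (Some ` S))"
    proof
      fix x assume x: "x \<in> S"
      obtain z where "\<pi> z = Some x" using surj_projection by (metis surjD)
      then show "x \<in> proj ` (\<pi> -` (Some ` S))" using x by (intro image_eqI[of _ _ z]) (auto simp: proj_def)
    qed
  qed (auto simp: proj_def)
  fix x assume x: "x \<in> S"
  have order: "branch_order (Some x) = 1" using assms(2)[OF x] by (simp add: branch_order_def)
  obtain e where e: "e > 0" "\<And>U. U \<in> sheets (Some x) e \<Longrightarrow> \<exists>\<phi>. disc_chart (Some x) e U \<phi>"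
    by (rule ex_disc_charts) (rule that)
  define T where "T = ball x e \<inter> S"
  define v where "v = (\<lambda>U. U \<inter> \<pi> -` (Some ` S)) ` sheets (Some x) e"
  have "\<Union> v = \<pi> -` sphere_disc (Some x) e \<inter> \<pi> -` (Some ` S)"
    unfolding v_def using Union_components[of "\<pi> -` sphere_disc (Some x) e"] by blast
  then have union: "\<Union> v = \<pi> -` (Some ` S) \<inter> proj -` T"
    by (auto simp: T_def proj_def)
  have opv: "openin (top_of_set (\<pi> -` (Some ` S))) u" if "u \<in> v" for u
    using that open_components[OF open_preimage_disc[OF e(1), of "Some x"]] op
    by (auto simp: v_def openin_open_eq)
  have disj: "pairwise disjnt v"
    unfolding pairwise_def disjnt_def v_def
  proof (intro ballI impI)
    fix u u' assume "u \<in> (\<lambda>U. U \<inter> \<pi> -` (Some ` S)) ` sheets (Some x) e"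
      "u' \<in> (\<lambda>U. U \<inter> \<pi> -` (Some ` S)) ` sheets (Some x) e" and ne: "u \<noteq> u'"
    then obtain U V where UV: "U \<in> sheets (Some x) e"
        "V \<in> sheets (Some x) e"
        "u = U \<inter> \<pi> -` (Some ` S)" "u' = V \<inter> \<pi> -` (Some ` S)" by blast
    then have "U \<noteq> V" using ne by blast
    then have "U \<inter> V = {}" using components_eq[OF UV(1,2)] by blast
    then show "u \<inter> u' = {}" using UV by blast
  qed
  have hom: "\<exists>q. homeomorphism u T proj q" if u: "u \<in> v" for u
  proof -
    obtain U where U: "U \<in> sheets (Some x) e" "u = U \<inter> \<pi> -` (Some ` S)"
      using u unfolding v_def by blast
    obtain \<phi> where \<phi>: "disc_chart (Some x) e U \<phi>" using e(2)[OF U(1)] by blast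
    note dU = disc_chartD[OF \<phi>]
    obtain \<psi> where \<psi>: "\<psi> holomorphic_on ball 0 1" "\<And>z. z \<in> U \<Longrightarrow> \<psi> (\<phi> z) = z"
        "\<And>w. norm w < 1 \<Longrightarrow> \<psi> w \<in> U" "\<And>w. norm w < 1 \<Longrightarrow> \<phi> (\<psi> w) = w"
      by (rule disc_chart_inverse[OF \<phi>]) (rule that)
    have pU: "\<pi> z = Some (x + of_real e * \<phi> z)" if "z \<in> U" for z using dU(8)[OF that] order by simp
    have small: "norm ((x' - x) / of_real e) < 1" if "x' \<in> ball x e" for x'
      using that e(1) by (simp add: norm_divide dist_norm norm_minus_commute)
    define q where "q x' = \<psi> ((x' - x) / of_real e)" for x'
    have \<pi>q: "\<pi> (q x') = Some x'" "q x' \<in> U" if "x' \<in> ball x e" for x'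
      using \<psi>(3,4) small[OF that] pU[of "q x'"] e(1) by (auto simp: q_def)
    have "homeomorphism u T proj q"
    proof (rule homeomorphismI)
      show "continuous_on u proj"
        using op dU(2) U(2) by (intro holomorphic_on_imp_continuous_on proj_holomorphic) auto
      show "continuous_on T q" unfolding q_def
        using small e(1) by (intro continuous_on_compose2[OF holomorphic_on_imp_continuous_on[OF \<psi>(1)]] continuous_intros)
          (auto simp: T_def)
      show "proj ` u \<subseteq> T"
        using U(2) in_components_subset[OF U(1)] by (force simp: T_def proj_def)
      show "q ` T \<subseteq> u" using \<pi>q by (auto simp: T_def U(2))
      show "q (proj z) = z" if "z \<in> u" for z
        using that U(2) pU[of z] \<psi>(2)[of z] e(1) by (simp add: q_def proj_def)
      show "proj (q x') = x'" if "x' \<in> T" for x'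
        using that \<pi>q(1)[of x'] by (simp add: T_def proj_def)
    qed
    then show ?thesis by blast
  qed
  have xT: "x \<in> T" and oT: "openin (top_of_set S) T" using x e(1) assms(1) by (auto simp: T_def openin_open_eq)
  show "\<exists>T. x \<in> T \<and> openin (top_of_set S) T \<and>
      (\<exists>v. \<Union>v = \<pi> -` (Some ` S) \<inter> proj -` T \<and> (\<forall>u \<in> v. openin (top_of_set (\<pi> -` (Some ` S))) u) \<and>
        pairwise disjnt v \<and> (\<forall>u \<in> v. \<exists>q. homeomorphism u T proj q))"
    by (intro exI[of _ T] conjI exI[of _ v] ballI xT oT union opv disj hom)
qed

end

section \<open>Branches of the algebraic function on the covering line\<close>

text \<open>
  The finite point whose coordinate at \<open>a\<close> is \<open>w\<close>, for \<open>w \<noteq> 0\<close>; with it the small loops at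
  finite points and at infinity can be treated alike.
\<close>

definition pt_at :: "sphere \<Rightarrow> complex \<Rightarrow> complex" where
  "pt_at a w = (case a of None \<Rightarrow> inverse w | Some c \<Rightarrow> c + w)"

lemma sphere_pt_pt_at: "w \<noteq> 0 \<Longrightarrow> sphere_pt a w = Some (pt_at a w)"
  by (cases a) (auto simp: pt_at_def)

lemma continuous_on_pt_at:
  assumes "continuous_on S f" "\<And>t. t \<in> S \<Longrightarrow> f t \<noteq> 0"
  shows "continuous_on S (\<lambda>t. pt_at a (f t))"
  using assms by (cases a) (auto simp: pt_at_def intro!: continuous_intros)

lemma small_loop_eq: "small_loop a e t = pt_at a (of_real e * exp (2 * of_real pi * \<i> * of_real t))"
  by (cases a) (auto simp: pt_at_def circlepath)

lemma pathstart_small_loop: "pathstart (small_loop a e) = pt_at a (of_real e)"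
  by (simp add: pathstart_def small_loop_eq)

lemma pathfinish_small_loop: "pathfinish (small_loop a e) = pt_at a (of_real e)"
  by (simp add: pathfinish_def small_loop_eq)

lemma path_small_loop: "e \<noteq> 0 \<Longrightarrow> path (small_loop a e)"
  unfolding path_def small_loop_eq by (intro continuous_on_pt_at continuous_intros) auto

lemma punctured_disc_in_cofinite:
  assumes "finite (- S)"
  obtains \<rho> where "\<rho> > 0" "\<And>w. w \<noteq> 0 \<Longrightarrow> norm w < \<rho> \<Longrightarrow> pt_at a w \<in> S"
proof -
  have "inj_on (pt_at a) (- {0})" by (cases a) (auto simp: pt_at_def inj_on_def)
  then have "finite (pt_at a -` (- S) \<inter> - {0})" using assms by (intro finite_vimage_IntI)
  then obtain \<rho> where "\<rho> > 0" "\<forall>w\<in>pt_at a -` (- S) \<inter> - {0}. w \<noteq> 0 \<longrightarrow> \<rho> \<le> dist 0 w"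
    using finite_set_avoid by blast
  then show ?thesis using that by force
qed

lemma small_loop_in_loops_at:
  assumes "e > 0" "\<And>w. w \<noteq> 0 \<Longrightarrow> norm w \<le> e \<Longrightarrow> pt_at a w \<in> regular_points P"
  shows "small_loop a e \<in> loops_at P (pt_at a (of_real e))"
  using assms unfolding loops_at_def path_image_def
  by (auto simp: path_small_loop pathstart_small_loop pathfinish_small_loop)
    (auto simp: small_loop_eq norm_mult intro!: assms(2))

text \<open>
  A small circle around a regular point stays in a disc on which each root is a
  single-valued function.
\<close>

lemma regular_point_unramified:
  assumes "degree P > 0" "x \<in> regular_points P"
  shows "has_local_monodromy_order P (Some x) 1"
proof -
  obtain d where d: "d > 0" "ball x d \<subseteq> regular_points P"
    using open_regular_points[OF assms(1)] assms(2) open_contains_ball by blast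
  have "group.ord (monodromy_group P (pathstart (small_loop (Some x) e))) (monodromy P (small_loop (Some x) e)) = 1"
    if e: "e > 0" "e < d" for e
  proof -
    let ?\<gamma> = "small_loop (Some x) e"
    have loop: "?\<gamma> \<in> loops_at P (pt_at (Some x) (of_real e))"
      using e d(2) by (intro small_loop_in_loops_at) (auto simp: pt_at_def dist_norm subset_iff)
    then have base: "pathstart ?\<gamma> = x + of_real e" by (simp add: pathstart_small_loop pt_at_def)
    have im: "path_image ?\<gamma> \<subseteq> ball x d" using e by (auto simp: dist_norm)
    have "monodromy P ?\<gamma> y = y" if y: "y \<in> fiber P (x + of_real e)" for y
    proof -
      obtain s where s: "continuous_on (ball x d) s" "s (x + of_real e) = y"
          "\<And>t. t \<in> ball x d \<Longrightarrow> s t \<in> fiber P t"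
        by (rule section_lift[of P "ball x d" id "x + of_real e" y])
          (use d e y assms(1) in \<open>auto simp: dist_norm convex_imp_simply_connected convex_imp_locally_path_connected\<close>)
      have "path (s \<circ> ?\<gamma>)" using e s(1) im path_small_loop[of e "Some x"]
        by (intro path_continuous_image) (auto intro: continuous_on_subset)
      moreover have "(s \<circ> ?\<gamma>) t \<in> fiber P (?\<gamma> t)" if "t \<in> {0..1}" for t
        using s(3)[of "?\<gamma> t"] im that by (auto simp: path_image_def image_subset_iff)
      ultimately have "monodromy P ?\<gamma> (pathstart (s \<circ> ?\<gamma>)) = pathfinish (s \<circ> ?\<gamma>)"
        using loop assms(1) by (intro monodromy_eqI) (auto simp: loops_at_def)
      then show ?thesis using s(2) base loop by (auto simp: pathstart_compose pathfinish_compose loops_at_def)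
    qed
    then have "group.ord (monodromy_group P (x + of_real e)) (monodromy P ?\<gamma>) dvd 1"
      using monodromy_order[OF assms(1) loop, of 1] by (simp add: pt_at_def)
    then show ?thesis using base by simp
  qed
  then show ?thesis unfolding has_local_monodromy_order_def eventually_at_right_field
    using d(1) by blast
qed


text \<open>
  The substitution \<open>w = exp u\<close> turns the punctured disc into a half-plane, which is simply connected,
  so a root over \<open>w1 ^ k\<close> continues to a function \<open>Y\<close> there.  Adding \<open>2 \<pi> \<i> / k\<close> to \<open>u\<close> moves
  \<open>w ^ k\<close> once around \<open>0\<close> and thus applies the local monodromy to \<open>Y\<close>.  Its \<open>k\<close>-th power is
  the identity, so \<open>Y\<close> has period \<open>2 \<pi> \<i>\<close> and descends to the punctured disc.
\<close>

lemma local_branches: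
  assumes P: "degree P > 0" "finite (- regular_points P)"
    and k: "has_local_monodromy_order P a k" "k > 0"
  obtains \<rho> where "\<rho> > 0" "\<And>w. w \<noteq> 0 \<Longrightarrow> norm w < \<rho> \<Longrightarrow> pt_at a w \<in> regular_points P"
    "\<And>s. 0 < s \<Longrightarrow> s < \<rho> \<Longrightarrow> group.ord (monodromy_group P (pt_at a (of_real s))) (monodromy P (small_loop a s)) = k"
    "\<And>r w1 y1. 0 < r \<Longrightarrow> r ^ k \<le> \<rho> \<Longrightarrow> w1 \<in> ball 0 r - {0} \<Longrightarrow> y1 \<in> fiber P (pt_at a (w1 ^ k)) \<Longrightarrow>
      \<exists>g. continuous_on (ball 0 r - {0}) g \<and> g w1 = y1 \<and>
        (\<forall>w\<in>ball 0 r - {0}. g w \<in> fiber P (pt_at a (w ^ k)))"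
proof -
  obtain \<rho>0 where \<rho>0: "\<rho>0 > 0" "\<And>w. w \<noteq> 0 \<Longrightarrow> norm w < \<rho>0 \<Longrightarrow> pt_at a w \<in> regular_points P"
    by (rule punctured_disc_in_cofinite[OF P(2)]) (rule that)
  obtain \<rho>1 where \<rho>1: "\<rho>1 > 0" "\<And>s. 0 < s \<Longrightarrow> s < \<rho>1 \<Longrightarrow>
      group.ord (monodromy_group P (pt_at a (of_real s))) (monodromy P (small_loop a s)) = k"
    using k(1) unfolding has_local_monodromy_order_def eventually_at_right_field pathstart_small_loop
    by blast
  define \<rho> where "\<rho> = min \<rho>0 \<rho>1"
  have ext: "\<exists>g. continuous_on (ball 0 r - {0}) g \<and> g w1 = y1 \<and>
        (\<forall>w\<in>ball 0 r - {0}. g w \<in> fiber P (pt_at a (w ^ k)))"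
    if r: "0 < r" "r ^ k \<le> \<rho>" and w1: "w1 \<in> ball 0 r - {0}" "y1 \<in> fiber P (pt_at a (w1 ^ k))" for r w1 y1
  proof -
    define H where "H = {u. Re u < ln r}"
    define X where "X u = pt_at a (exp u ^ k)" for u
    have H: "convex H" "open H" unfolding H_def
      by (auto simp: convex_halfspace_Re_lt intro!: open_Collect_less continuous_intros)
    have expH: "norm (exp u) < r" if "u \<in> H" for u
      using that r(1) by (simp add: H_def) (metis exp_less_cancel_iff exp_ln)
    have powH: "norm (exp u ^ k) < \<rho>" if "u \<in> H" for u
      using power_strict_mono[OF expH[OF that] norm_ge_zero k(2)] r(2) by (simp add: norm_power)
    have LnH: "Ln w \<in> H" if "w \<in> ball 0 r - {0}" for w
      using that r(1) ln_less_cancel_iff[of "norm w" r] by (simp add: H_def)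
    have contX: "continuous_on H X"
      unfolding X_def by (intro continuous_on_pt_at continuous_intros) auto
    have XH: "X ` H \<subseteq> regular_points P"
      using powH \<rho>0(2) by (auto simp: X_def \<rho>_def)
    have "y1 \<in> fiber P (X (Ln w1))" using w1 by (simp add: X_def)
    then obtain Y where Y: "continuous_on H Y" "Y (Ln w1) = y1" "\<And>u. u \<in> H \<Longrightarrow> Y u \<in> fiber P (X u)"
      by (rule section_lift[OF P(1) convex_imp_simply_connected[OF H(1)]
            convex_imp_locally_path_connected[OF H(1)] contX XH LnH[OF w1(1)]]) (rule that)
    \<comment> \<open>At the real point \<open>u0\<close> the path starts where \<open>small_loop a s\<close> does.\<close>
    define u0 where "u0 = complex_of_real (ln r - 1)"
    define s where "s = exp (real k * (ln r - 1))"
    have H_add: "u + \<i> * of_real t \<in> H \<longleftrightarrow> u \<in> H" for u t by (simp add: H_def)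
    have u0: "u0 \<in> H" by (simp add: u0_def H_def)
    have s_eq: "exp u0 ^ k = of_real s"
      unfolding u0_def s_def exp_of_real exp_of_nat_mult of_real_power ..
    have s: "0 < s" "s < \<rho>"
    proof -
      show "0 < s" by (simp add: s_def)
      then show "s < \<rho>" using powH[OF u0] by (simp add: s_eq)
    qed
    define \<gamma> where "\<gamma> = small_loop a s"
    have loop: "\<gamma> \<in> loops_at P (pt_at a (of_real s))"
      unfolding \<gamma>_def using s \<rho>0(2) by (intro small_loop_in_loops_at) (auto simp: \<rho>_def)
    define c where "c t = Y (u0 + \<i> * of_real (2 * pi * t / real k))" for t
    have c_step: "monodromy P \<gamma> (c (real j)) = c (real (Suc j))" for j
    proof -
      have "path (\<lambda>t. c (real j + t))" unfolding path_def c_def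
        using u0 k(2) by (intro continuous_on_compose2[OF Y(1)] continuous_intros) (auto simp: H_add simp del: of_real_mult of_real_divide)
      moreover have "c (real j + t) \<in> fiber P (\<gamma> t)" for t
      proof -
        have "X (u0 + \<i> * of_real (2 * pi * (real j + t) / real k)) = \<gamma> t"
        proof -
          have "exp (u0 + \<i> * of_real (2 * pi * (real j + t) / real k)) ^ k =
              exp u0 ^ k * exp (\<i> * of_real (2 * pi * (real j + t) / real k)) ^ k"
            by (simp add: exp_add power_mult_distrib)
          also have "exp (\<i> * of_real (2 * pi * (real j + t) / real k)) ^ k = exp (\<i> * of_real (2 * pi * (real j + t)))"
            using k(2) by (simp add: exp_of_nat_mult[symmetric])
          also have "exp (\<i> * of_real (2 * pi * (real j + t))) = exp (2 * of_real pi * \<i> * of_real t)"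
            by (subst exp_eq, intro exI[of _ "int j"]) (simp add: algebra_simps)
          finally show ?thesis by (simp only: X_def \<gamma>_def small_loop_eq s_eq)
        qed
        then show ?thesis using Y(3)[of "u0 + \<i> * of_real (2 * pi * (real j + t) / real k)"] u0
          unfolding c_def H_add by simp
      qed
      ultimately have "monodromy P \<gamma> (pathstart (\<lambda>t. c (real j + t))) = pathfinish (\<lambda>t. c (real j + t))"
        using loop by (intro monodromy_eqI[OF P(1)]) (auto simp: loops_at_def)
      then show ?thesis by (simp add: pathstart_def pathfinish_def add.commute)
    qed
    have c_pow: "(monodromy P \<gamma> ^^ j) (c 0) = c (real j)" for j
      by (induct j) (simp_all add: c_step)
    have "c 0 \<in> fiber P (pt_at a (of_real s))"
      using Y(3)[OF u0] by (simp add: c_def X_def s_eq)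
    moreover have "group.ord (monodromy_group P (pt_at a (of_real s))) (monodromy P \<gamma>) dvd k"
      using \<rho>1(2)[of s] s by (simp add: \<gamma>_def \<rho>_def)
    ultimately have "c (real k) = c 0" using monodromy_order[OF P(1) loop, of k] c_pow[of k] by simp
    then have per0: "Y (u0 + \<i> * of_real (2 * pi)) = Y u0" using k(2) by (simp add: c_def)
    have period: "Y (u + \<i> * of_real (2 * pi)) = Y u" if "u \<in> H" for u
    proof (rule section_unique[where f = "\<lambda>u. Y (u + \<i> * of_real (2 * pi))" and g = Y,
          OF P(1) convex_connected[OF H(1)] contX XH _ _ Y(1,3) u0 per0 that])
      show "continuous_on H (\<lambda>u. Y (u + \<i> * of_real (2 * pi)))"
        by (intro continuous_on_compose2[OF Y(1)] continuous_intros) (auto simp: H_add simp del: of_real_mult)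
      have "exp (u + \<i> * of_real (2 * pi)) = exp u" for u :: complex
        by (simp add: exp_add mult.commute exp_two_pi_i)
      then have "X (u + \<i> * of_real (2 * pi)) = X u" for u by (simp only: X_def)
      then show "Y (u + \<i> * of_real (2 * pi)) \<in> fiber P (X u)" if "u \<in> H" for u
        using Y(3)[of "u + \<i> * of_real (2 * pi)"] that H_add by metis
    qed
    define g where "g w = Y (Ln w)" for w
    \<comment> \<open>The logarithm of \<open>- w\<close> is continuous where that of \<open>w\<close> jumps; by periodicity both
      define the same function.\<close>
    have g_alt: "g w = Y (Ln (- w) + \<i> * of_real pi)" if w: "w \<in> ball 0 r - {0}" for w
    proof (cases "Ln (- w) = Ln w + \<i> * of_real pi")
      case True
      then have "Ln (- w) + \<i> * of_real pi = Ln w + \<i> * of_real (2 * pi)" by (simp add: algebra_simps)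
      then have "Y (Ln (- w) + \<i> * of_real pi) = Y (Ln w + \<i> * of_real (2 * pi))" by (rule arg_cong)
      then show ?thesis using period[OF LnH[OF w]] by (simp only: g_def)
    next
      case False
      then have "Ln (- w) = Ln w - \<i> * of_real pi" using w Ln_minus[of w] by (auto split: if_splits)
      then show ?thesis by (simp add: g_def)
    qed
    have "continuous_on (ball 0 r - {0}) g"
    proof (intro continuous_at_imp_continuous_on ballI)
      fix w :: complex assume w: "w \<in> ball 0 r - {0}"
      have op: "open (ball 0 r - {0::complex})" by auto
      have YH: "isCont Y u" if "u \<in> H" for u using Y(1) H(2) that continuous_on_eq_continuous_at by blast
      show "isCont g w"
      proof (cases "w \<in> \<real>\<^sub>\<le>\<^sub>0")
        case False
        have "isCont (\<lambda>w. Y (Ln w)) w"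
          using False YH[OF LnH[OF w]] by (intro isCont_o2[of w Ln Y] continuous_intros)
        then show ?thesis by (simp add: g_def[abs_def])
      next
        case True
        then have nn: "- w \<notin> \<real>\<^sub>\<le>\<^sub>0" using w by (auto simp: complex_nonpos_Reals_iff complex_eq_iff)
        have "Ln (- w) + \<i> * of_real pi \<in> H" using LnH[of "- w"] w by (simp add: H_add)
        then have "isCont (\<lambda>w. Y (Ln (- w) + \<i> * of_real pi)) w"
          using YH nn by (intro isCont_o2[of w "\<lambda>w. Ln (- w) + \<i> * of_real pi" Y] continuous_intros) auto
        moreover have "\<forall>\<^sub>F v in nhds w. g v = Y (Ln (- v) + \<i> * of_real pi)"
          using eventually_nhds_in_open[OF op w] by eventually_elim (rule g_alt)
        ultimately show ?thesis using isCont_cong by fastforce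
      qed
    qed
    moreover have "g w1 = y1" using Y(2) by (simp add: g_def)
    moreover have "g w \<in> fiber P (pt_at a (w ^ k))" if w: "w \<in> ball 0 r - {0}" for w
      using Y(3)[OF LnH[OF w]] w by (simp add: g_def X_def)
    ultimately show ?thesis by blast
  qed
  show ?thesis using \<rho>0 \<rho>1 by (intro that[of \<rho>] ext) (auto simp: \<rho>_def)
qed

locale line_uniformized = line_covering A R \<pi> for A R \<pi> +
  fixes P :: "complex poly poly"
  assumes algebraic: "algebraic_function P" and signature: "has_signature P A R"
begin

lemmas degree_pos = algebraic_function_degree[OF algebraic]
lemmas finite_irregular = finite_irregular_points[OF algebraic]
lemmas open_regular = open_regular_points[OF degree_pos]

lemma local_order: "has_local_monodromy_order P a (branch_order a)"
  using signature unfolding has_signature_def branching_locus_def branch_order_def by auto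

lemma regular_not_branched: "x \<in> regular_points P \<Longrightarrow> Some x \<notin> A"
  using regular_point_unramified[OF degree_pos] signature
  unfolding has_signature_def branching_locus_def by blast

definition bad :: "complex set" where "bad = - (\<pi> -` (Some ` regular_points P))"

lemma not_bad: "z \<notin> bad \<longleftrightarrow> (\<exists>x\<in>regular_points P. \<pi> z = Some x)"
  by (auto simp: bad_def)

lemma proj_regular: "z \<notin> bad \<Longrightarrow> proj z \<in> regular_points P" "z \<notin> bad \<Longrightarrow> \<pi> z = Some (proj z)"
  by (auto simp: not_bad proj_def)

lemma covering_regular: "covering_space (- bad) proj (regular_points P)"
  using proj_covering_space[OF open_regular regular_not_branched] by (simp add: bad_def)

lemma open_good: "open (- bad)"
  using covering openin_continuous_map_preimage[of euclidean riemann_sphere \<pi> "Some ` regular_points P"] open_regular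
  unfolding universal_covering_by_line_def branched_covering_def bad_def by (fastforce simp: vimage_def)

lemma closed_bad: "closed bad"
  using open_good by (simp add: closed_def)

lemma proj_holomorphic_good: "proj holomorphic_on - bad"
  by (intro proj_holomorphic open_good) (auto simp: not_bad)

text \<open>
  Only finitely many points of the sphere are not regular, and in a chart each of them has finitely
  many preimages.  So the bad points are locally finite.
\<close>

lemma countable_bad: "countable bad"
proof -
  have "\<exists>U. open U \<and> p \<in> U \<and> finite (bad \<inter> U)" for p
  proof -
    obtain e U \<phi> where U: "disc_chart (\<pi> p) e U \<phi>" "p \<in> U" "\<phi> p = 0" by (rule chart_around) (rule that)
    note dU = disc_chartD[OF U(1)]
    let ?k = "branch_order (\<pi> p)"
    define C where "C = chart_at (\<pi> p) ` (insert None (Some ` (- regular_points P)))"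
    have "finite C" using finite_irregular by (simp add: C_def)
    have "bad \<inter> U \<subseteq> (\<Union>c\<in>C. {z \<in> U. \<phi> z ^ ?k = c / of_real e})"
    proof
      fix z assume z: "z \<in> bad \<inter> U"
      then have "chart_at (\<pi> p) (\<pi> z) \<in> C" unfolding C_def bad_def
        by (intro imageI) (cases "\<pi> z"; auto)
      moreover have "chart_at (\<pi> p) (\<pi> z) = of_real e * \<phi> z ^ ?k"
        using dU(8)[of z] z chart_at_sphere_pt by simp
      ultimately show "z \<in> (\<Union>c\<in>C. {z \<in> U. \<phi> z ^ ?k = c / of_real e})"
        using z dU(1) by (intro UN_I[of "chart_at (\<pi> p) (\<pi> z)"]) auto
    qed
    moreover have "finite {z \<in> U. \<phi> z ^ ?k = c}" for c
    proof -
      have "finite {w. w ^ ?k = c}" using branch_order_pos by (rule finite_nth_roots)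
      then have "finite (\<phi> -` {w. w ^ ?k = c} \<inter> U)" using dU(6) by (rule finite_vimage_IntI)
      moreover have "\<phi> -` {w. w ^ ?k = c} \<inter> U = {z \<in> U. \<phi> z ^ ?k = c}" by auto
      ultimately show ?thesis by simp
    qed
    ultimately have "finite (bad \<inter> U)" using \<open>finite C\<close> by (meson finite_UN_I finite_subset)
    then show ?thesis using dU(2) U(2) by blast
  qed
  then obtain U where U: "\<And>p. open (U p)" "\<And>p. p \<in> U p" "\<And>p. finite (bad \<inter> U p)" by metis
  obtain F where F: "F \<subseteq> range U" "countable F" "\<Union> F = \<Union> (range U)"
    by (rule Lindelof[of "range U"]) (use U(1) in auto)
  have "bad = (\<Union>S\<in>F. bad \<inter> S)" using F(3) U(2) by blast
  moreover have "countable (\<Union>S\<in>F. bad \<inter> S)" using F(1,2) U(3) by (intro countable_UN) (auto intro: countable_finite)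
  ultimately show ?thesis by simp
qed

lemma path_connected_good: "path_connected (- bad)"
  by (intro path_connected_complement_countable countable_bad) simp

lemma section_good_unique:
  assumes "continuous_on T f" "\<And>z. z \<in> T \<Longrightarrow> f z \<in> fiber P (proj z)"
    "continuous_on T g" "\<And>z. z \<in> T \<Longrightarrow> g z \<in> fiber P (proj z)"
    "connected T" "T \<subseteq> - bad" "z0 \<in> T" "f z0 = g z0" "z \<in> T"
  shows "f z = g z"
  by (rule section_unique[OF degree_pos assms(5), of proj f g z0])
    (use assms proj_regular in \<open>auto intro: continuous_on_subset
       holomorphic_on_imp_continuous_on[OF proj_holomorphic_good]\<close>)

lemma section_good_holomorphic:
  assumes "open T" "T \<subseteq> - bad" "continuous_on T f" "\<And>z. z \<in> T \<Longrightarrow> f z \<in> fiber P (proj z)"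
  shows "f holomorphic_on T"
  by (rule section_holomorphic[OF degree_pos assms(1) _ _ assms(3,4)])
    (use assms(2) proj_regular proj_holomorphic_good in \<open>auto intro: holomorphic_on_subset\<close>)

lemma section_on_good_ball:
  assumes "ball p r \<subseteq> - bad" "q \<in> ball p r" "y \<in> fiber P (proj q)"
  obtains f where "f holomorphic_on ball p r" "\<And>z. z \<in> ball p r \<Longrightarrow> f z \<in> fiber P (proj z)" "f q = y"
proof -
  have c: "continuous_on (ball p r) proj"
    using proj_holomorphic_good assms(1) holomorphic_on_imp_continuous_on holomorphic_on_subset by blast
  have im: "proj ` ball p r \<subseteq> regular_points P" using assms(1) proj_regular by blast
  obtain f where f: "continuous_on (ball p r) f" "f q = y" "\<And>z. z \<in> ball p r \<Longrightarrow> f z \<in> fiber P (proj z)"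
    by (rule section_lift[OF degree_pos convex_imp_simply_connected[OF convex_ball]
          convex_imp_locally_path_connected[OF convex_ball] c im assms(2,3)]) (rule that)
  then show ?thesis using that[of f] section_good_holomorphic[of "ball p r" f] assms(1) by auto
qed

text \<open>
  In the chart around \<open>p\<close>, rescaled by a root of the radius \<open>e\<close>, the covering is \<open>w \<mapsto> w ^ k\<close>, and \<open>k\<close>
  is the order of the local monodromy at \<open>\<pi> p\<close>.
\<close>

lemma section_near_bad:
  obtains r where "r > 0" "\<And>q y. q \<in> ball p r - {p} \<Longrightarrow> y \<in> fiber P (proj q) \<Longrightarrow>
     \<exists>f. f holomorphic_on (ball p r - {p}) \<and> (\<forall>z\<in>ball p r - {p}. f z \<in> fiber P (proj z)) \<and> f q = y"
    "ball p r - {p} \<subseteq> - bad"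
proof -
  obtain e U \<phi> where U: "disc_chart (\<pi> p) e U \<phi>" "p \<in> U" "\<phi> p = 0" by (rule chart_around) (rule that)
  note dU = disc_chartD[OF U(1)]
  let ?a = "\<pi> p" and ?k = "branch_order (\<pi> p)"
  obtain \<rho> where \<rho>: "\<rho> > 0" "\<And>w. w \<noteq> 0 \<Longrightarrow> norm w < \<rho> \<Longrightarrow> pt_at ?a w \<in> regular_points P"
    and ext: "\<And>r w1 y1. 0 < r \<Longrightarrow> r ^ ?k \<le> \<rho> \<Longrightarrow> w1 \<in> ball 0 r - {0} \<Longrightarrow> y1 \<in> fiber P (pt_at ?a (w1 ^ ?k)) \<Longrightarrow>
      \<exists>g. continuous_on (ball 0 r - {0}) g \<and> g w1 = y1 \<and>
        (\<forall>w\<in>ball 0 r - {0}. g w \<in> fiber P (pt_at ?a (w ^ ?k)))"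
    by (rule local_branches[OF degree_pos finite_irregular local_order branch_order_pos]) (rule that)
  define s where "s = root ?k \<rho>"
  define l where "l = root ?k e"
  have s: "s > 0" "s ^ ?k = \<rho>" and l: "l > 0" "l ^ ?k = e"
    using \<rho>(1) dU(1) branch_order_pos[of ?a] by (simp_all add: s_def l_def)
  define W where "W z = of_real l * \<phi> z" for z
  have "continuous_on U W" unfolding W_def
    by (intro continuous_intros holomorphic_on_imp_continuous_on dU)
  then have "open (U \<inter> W -` ball 0 s)" using dU(2) by (intro continuous_open_preimage) auto
  moreover have "p \<in> U \<inter> W -` ball 0 s" using U s(1) by (simp add: W_def)
  ultimately obtain r where r: "r > 0" "ball p r \<subseteq> U \<inter> W -` ball 0 s" using open_contains_ball by blast
  have W: "W z \<in> ball 0 s - {0}" if "z \<in> ball p r - {p}" for z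
  proof -
    have "z \<in> U" "z \<noteq> p" "W z \<in> ball 0 s" using that r(2) by auto
    moreover from this have "\<phi> z \<noteq> 0" using dU(6) U(2,3) by (metis inj_onD)
    ultimately show ?thesis using l(1) by (simp add: W_def)
  qed
  have pt: "\<pi> z = Some (pt_at ?a (W z ^ ?k))" if "z \<in> ball p r - {p}" for z
  proof -
    have "of_real e * \<phi> z ^ ?k = W z ^ ?k"
      by (simp add: W_def power_mult_distrib flip: l(2))
    then have "\<pi> z = sphere_pt ?a (W z ^ ?k)" using dU(8)[of z] that r(2) by auto
    then show ?thesis using W[OF that] by (simp add: sphere_pt_pt_at)
  qed
  have small: "norm (W z ^ ?k) < \<rho>" if "z \<in> ball p r - {p}" for z
    using W[OF that] power_strict_mono[of "norm (W z)" s ?k] s branch_order_pos[of ?a] by (simp add: norm_power)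
  have good: "ball p r - {p} \<subseteq> - bad"
  proof
    fix z assume z: "z \<in> ball p r - {p}"
    then have "pt_at ?a (W z ^ ?k) \<in> regular_points P" using \<rho>(2) small[OF z] W[OF z] by auto
    then show "z \<in> - bad" using pt[OF z] not_bad by auto
  qed
  have pr: "proj z = pt_at ?a (W z ^ ?k)" if "z \<in> ball p r - {p}" for z using pt[OF that] by (simp add: proj_def)
  show ?thesis
  proof (rule that[OF r(1) _ good])
    fix q y assume q: "q \<in> ball p r - {p}" and y: "y \<in> fiber P (proj q)"
    obtain g where g: "continuous_on (ball 0 s - {0}) g" "g (W q) = y"
        "\<And>w. w \<in> ball 0 s - {0} \<Longrightarrow> g w \<in> fiber P (pt_at ?a (w ^ ?k))"
      using ext[of s "W q" y] s W[OF q] y pr[OF q] by auto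
    have gW: "g (W z) \<in> fiber P (proj z)" if "z \<in> ball p r - {p}" for z using g(3)[OF W[OF that]] pr[OF that] by simp
    have "continuous_on (ball p r - {p}) (\<lambda>z. g (W z))"
      using \<open>continuous_on U W\<close> r(2) W
      by (intro continuous_on_compose2[OF g(1)]) (auto intro: continuous_on_subset)
    then have "(\<lambda>z. g (W z)) holomorphic_on (ball p r - {p})"
      using gW good by (intro section_good_holomorphic) auto
    then show "\<exists>f. f holomorphic_on (ball p r - {p}) \<and> (\<forall>z\<in>ball p r - {p}. f z \<in> fiber P (proj z)) \<and> f q = y"
      using gW g(2) by blast
  qed
qed

text \<open>
  The value \<open>0\<close> at the bad points makes these functions on the whole line, closed under composition with
  deck transformations.
\<close>

definition branches :: "(complex \<Rightarrow> complex) set" where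
  "branches = {Y. Y holomorphic_on - bad \<and> (\<forall>z\<in>- bad. Y z \<in> fiber P (proj z)) \<and> (\<forall>z\<in>bad. Y z = 0)}"

lemma branchesD:
  assumes "Y \<in> branches"
  shows "Y holomorphic_on - bad" "z \<notin> bad \<Longrightarrow> Y z \<in> fiber P (proj z)" "z \<in> bad \<Longrightarrow> Y z = 0"
  using assms by (auto simp: branches_def)

lemma branch_unique:
  assumes "Y \<in> branches" "Y' \<in> branches" "z \<notin> bad" "Y z = Y' z"
  shows "Y = Y'"
proof
  fix w show "Y w = Y' w"
  proof (cases "w \<in> bad")
    case False
    then show ?thesis
      using assms branchesD path_connected_imp_connected[OF path_connected_good]
      by (intro section_good_unique[of "- bad" Y Y' z w]) (auto intro: holomorphic_on_imp_continuous_on)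
  next
    case True
    then show ?thesis using branchesD(3)[OF assms(1)] branchesD(3)[OF assms(2)] by simp
  qed
qed

text \<open>
  Every root continues to the whole line: near a bad point by \<open>section_near_bad\<close>, near any other
  point because the root is unramified there.
\<close>

lemma branch_through:
  assumes "p \<notin> bad" "y \<in> fiber P (proj p)"
  obtains Y where "Y \<in> branches" "Y p = y"
proof -
  have loc: "\<exists>e>0. \<forall>V f. open V \<and> connected V \<and> V \<noteq> {} \<and> V \<subseteq> ball p e - bad \<and>
        f holomorphic_on V \<and> (\<forall>z\<in>V. f z \<in> fiber P (proj z)) \<longrightarrow>
        (\<exists>g. g holomorphic_on (ball p e - bad) \<and> (\<forall>z\<in>ball p e - bad. g z \<in> fiber P (proj z)) \<and> (\<forall>z\<in>V. g z = f z))"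
    for p
  proof -
    have "\<exists>e>0. \<forall>q\<in>ball p e - bad. \<forall>y\<in>fiber P (proj q). \<exists>g. g holomorphic_on (ball p e - bad) \<and>
        (\<forall>z\<in>ball p e - bad. g z \<in> fiber P (proj z)) \<and> g q = y"
    proof (cases "p \<in> bad")
      case True
      obtain r where r: "r > 0" "\<And>q y. q \<in> ball p r - {p} \<Longrightarrow> y \<in> fiber P (proj q) \<Longrightarrow>
          \<exists>f. f holomorphic_on (ball p r - {p}) \<and> (\<forall>z\<in>ball p r - {p}. f z \<in> fiber P (proj z)) \<and> f q = y"
          "ball p r - {p} \<subseteq> - bad"
        by (rule section_near_bad) (rule that)
      have "ball p r - bad = ball p r - {p}" using r(3) True by blast
      then show ?thesis using r by (intro exI[of _ r]) metis
    next
      case False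
      then obtain r where r: "r > 0" "ball p r \<subseteq> - bad" using open_good open_contains_ball by blast
      then have "ball p r - bad = ball p r" by blast
      moreover have "\<exists>g. g holomorphic_on ball p r \<and> (\<forall>z\<in>ball p r. g z \<in> fiber P (proj z)) \<and> g q = y"
        if "q \<in> ball p r" "y \<in> fiber P (proj q)" for q y
        by (rule section_on_good_ball[OF r(2) that]) blast
      ultimately show ?thesis using r(1) by (intro exI[of _ r]) simp
    qed
    then obtain e where e: "e > 0" "\<And>q y. q \<in> ball p e - bad \<Longrightarrow> y \<in> fiber P (proj q) \<Longrightarrow>
        \<exists>g. g holomorphic_on (ball p e - bad) \<and> (\<forall>z\<in>ball p e - bad. g z \<in> fiber P (proj z)) \<and> g q = y"
      by blast
    have "\<exists>g. g holomorphic_on (ball p e - bad) \<and> (\<forall>z\<in>ball p e - bad. g z \<in> fiber P (proj z)) \<and> (\<forall>z\<in>V. g z = f z)"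
      if V: "open V" "connected V" "V \<noteq> {}" "V \<subseteq> ball p e - bad"
        and f: "f holomorphic_on V" "\<forall>z\<in>V. f z \<in> fiber P (proj z)" for V f
    proof -
      obtain q where q: "q \<in> V" using V(3) by blast
      obtain g where g: "g holomorphic_on (ball p e - bad)" "\<forall>z\<in>ball p e - bad. g z \<in> fiber P (proj z)" "g q = f q"
        using e(2)[of q "f q"] q V(4) f(2) by blast
      have "g z = f z" if "z \<in> V" for z
        by (rule section_good_unique[of V g f q z])
          (use V f g q that in \<open>auto intro!: holomorphic_on_imp_continuous_on intro: holomorphic_on_subset\<close>)
      then show ?thesis using g by blast
    qed
    then show ?thesis using e(1) by (intro exI[of _ e]) blast
  qed
  obtain r where r: "r > 0" "ball p r \<subseteq> - bad" using assms(1) open_good open_contains_ball[of "- bad"] by blast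
  obtain f0 where f0: "f0 holomorphic_on ball p r" "\<And>z. z \<in> ball p r \<Longrightarrow> f0 z \<in> fiber P (proj z)" "f0 p = y"
    by (rule section_on_good_ball[OF r(2) _ assms(2)]) (use r(1) in \<open>auto intro: that\<close>)
  obtain g where g: "g holomorphic_on - bad" "\<And>z. z \<notin> bad \<Longrightarrow> g z \<in> fiber P (proj z)"
      "\<And>z. z \<in> ball p r \<Longrightarrow> g z = f0 z"
    by (rule global_section[OF closed_bad countable_bad loc open_ball convex_connected[OF convex_ball] _ r(2) f0(1,2)])
      (use r(1) in \<open>auto intro: that\<close>)
  define Y where "Y z = (if z \<in> bad then 0 else g z)" for z
  have "Y holomorphic_on - bad" using g(1) by (rule holomorphic_transform) (simp add: Y_def)
  then have "Y \<in> branches" using g(2) by (auto simp: branches_def Y_def)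
  moreover have "Y p = y" using g(3)[of p] r(1) f0(3) assms(1) by (simp add: Y_def)
  ultimately show ?thesis using that by blast
qed

lemma ex_good: obtains z where "z \<notin> bad"
  using countable_bad uncountable_UNIV_complex by (metis UNIV_eq_I)

lemma finite_branches: "finite branches"
proof -
  obtain z where z: "z \<notin> bad" by (rule ex_good)
  have "inj_on (\<lambda>Y. Y z) branches" using branch_unique z by (intro inj_onI) blast
  moreover have "(\<lambda>Y. Y z) ` branches \<subseteq> fiber P (proj z)" using branchesD z by blast
  ultimately show ?thesis
    using regular_pointD(2)[OF degree_pos proj_regular(1)[OF z]] finite_imageD finite_subset by blast
qed

lemma deck_bad: "g \<in> deck \<Longrightarrow> g z \<in> bad \<longleftrightarrow> z \<in> bad"
  by (auto simp: deck_def bad_def)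

lemma deck_proj: "g \<in> deck \<Longrightarrow> proj (g z) = proj z"
  by (auto simp: deck_def proj_def)

lemma branch_deck:
  assumes "g \<in> deck" "Y \<in> branches" shows "Y \<circ> g \<in> branches"
proof -
  have "g holomorphic_on - bad" using assms(1) by (auto simp: deck_def intro: holomorphic_on_subset)
  moreover have "g ` (- bad) \<subseteq> - bad" using deck_bad[OF assms(1)] by auto
  ultimately have "(Y \<circ> g) holomorphic_on - bad" using branchesD(1)[OF assms(2)] holomorphic_on_compose_gen by blast
  then show ?thesis using branchesD(2,3)[OF assms(2)] deck_bad[OF assms(1)] deck_proj[OF assms(1)]
    by (force simp: branches_def)
qed

text \<open>
  A branch along a path in the line is a lift to the curve of the projected path.
\<close>

lemma monodromy_along_projection:
  assumes "path \<delta>" "path_image \<delta> \<subseteq> - bad" "Y \<in> branches"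
  shows "monodromy P (proj \<circ> \<delta>) (Y (pathstart \<delta>)) = Y (pathfinish \<delta>)"
proof -
  have "continuous_on (- bad) Y" "continuous_on (- bad) proj"
    using branchesD(1)[OF assms(3)] proj_holomorphic_good holomorphic_on_imp_continuous_on by blast+
  then have "path (Y \<circ> \<delta>)" "path (proj \<circ> \<delta>)"
    using assms(1,2) by (auto intro!: path_continuous_image intro: continuous_on_subset)
  moreover have "path_image (proj \<circ> \<delta>) \<subseteq> regular_points P"
    using assms(2) proj_regular by (auto simp: path_image_compose)
  moreover have "(Y \<circ> \<delta>) t \<in> fiber P ((proj \<circ> \<delta>) t)" if "t \<in> {0..1}" for t
    using that assms(2) branchesD(2)[OF assms(3), of "\<delta> t"] by (auto simp: path_image_def image_subset_iff)
  ultimately have "monodromy P (proj \<circ> \<delta>) (pathstart (Y \<circ> \<delta>)) = pathfinish (Y \<circ> \<delta>)"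
    by (intro monodromy_eqI[OF degree_pos])
  then show ?thesis by (simp add: pathstart_compose pathfinish_compose)
qed

end

section \<open>The monodromy group as a quotient of the deck group\<close>

context line_uniformized
begin

text \<open>
  In the chart around its fixed point, such a \<open>g\<close> multiplies the coordinate by a root of unity
  \<open>exp (2 \<pi> \<i> j / k)\<close> with \<open>0 < j < k\<close>.  The points \<open>q t\<close> run through a small circle about the fixed
  point.  From \<open>q i\<close> to \<open>q (i + 1)\<close> the projection runs once around the small loop, so \<open>j\<close> local
  monodromies lead from the values of the branches at \<open>q 0\<close> to those at \<open>q j = g (q 0)\<close>, which are the same.
  So the order \<open>k\<close> of the local monodromy divides \<open>j\<close>.
\<close>

lemma fixing_branches_no_fixed_point:
  assumes g: "g \<in> deck" "\<And>z. g z = a * z + b" "a \<noteq> 1"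
    and inv: "\<And>Y z. Y \<in> branches \<Longrightarrow> Y (g z) = Y z"
  shows False
proof -
  define z0 where "z0 = b / (1 - a)"
  have fix0: "g z0 = z0" using g(2,3) by (simp add: z0_def field_simps)
  have fix_unique: "z = z0" if "g z = z" for z
    using that g(2,3) by (simp add: z0_def field_simps)
  obtain e U \<phi> where U: "disc_chart (\<pi> z0) e U \<phi>" "z0 \<in> U" "\<phi> z0 = 0" by (rule chart_around) (rule that)
  note dU = disc_chartD[OF U(1)]
  let ?a = "\<pi> z0" and ?k = "branch_order (\<pi> z0)"
  obtain \<psi> where \<psi>: "\<psi> holomorphic_on ball 0 1" "\<And>z. z \<in> U \<Longrightarrow> \<psi> (\<phi> z) = z"
      "\<And>w. norm w < 1 \<Longrightarrow> \<psi> w \<in> U" "\<And>w. norm w < 1 \<Longrightarrow> \<phi> (\<psi> w) = w"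
    by (rule disc_chart_inverse[OF U(1)]) (rule that)
  obtain \<rho> where \<rho>: "\<rho> > 0" "\<And>w. w \<noteq> 0 \<Longrightarrow> norm w < \<rho> \<Longrightarrow> pt_at ?a w \<in> regular_points P"
    "\<And>s. 0 < s \<Longrightarrow> s < \<rho> \<Longrightarrow> group.ord (monodromy_group P (pt_at ?a (of_real s))) (monodromy P (small_loop ?a s)) = ?k"
    by (rule local_branches[OF degree_pos finite_irregular local_order[of ?a] branch_order_pos]) (rule that)
  have cont\<psi>: "continuous_on (ball 0 1) \<psi>" by (rule holomorphic_on_imp_continuous_on[OF \<psi>(1)])
  have "continuous_on UNIV g" using g(1) by (auto simp: deck_def holomorphic_on_imp_continuous_on)
  then have "continuous_on (ball 0 1) (\<lambda>w. g (\<psi> w))"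
    by (rule continuous_on_compose2[OF _ cont\<psi> subset_UNIV])
  then have "open (ball 0 1 \<inter> (\<lambda>w. g (\<psi> w)) -` U)" using dU(2) by (intro continuous_open_preimage) auto
  moreover have "0 \<in> ball 0 1 \<inter> (\<lambda>w. g (\<psi> w)) -` U" using \<psi>(2)[OF U(2)] U fix0 by simp
  ultimately obtain r where r: "r > 0" "ball 0 r \<subseteq> ball 0 1 \<inter> (\<lambda>w. g (\<psi> w)) -` U"
    using open_contains_ball by blast
  \<comment> \<open>The radius \<open>\<tau>\<close> keeps \<open>g\<close> of the starting point inside the chart and makes the projected circle,
    of radius \<open>e * \<tau> ^ k\<close>, one of the small loops.\<close>
  define \<tau> where "\<tau> = min (r / 2) (min (1 / 2) (\<rho> / (2 * e)))"
  have \<tau>: "0 < \<tau>" "\<tau> < r" "\<tau> < 1" "e * \<tau> < \<rho>"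
  proof -
    have "\<tau> \<le> r / 2" "\<tau> \<le> 1 / 2" "\<tau> \<le> \<rho> / (2 * e)" by (simp_all add: \<tau>_def)
    then show "\<tau> < r" "\<tau> < 1" using r(1) by linarith+
    show "0 < \<tau>" using r(1) \<rho>(1) dU(1) by (simp add: \<tau>_def)
    have "e * \<tau> \<le> e * (\<rho> / (2 * e))" using \<open>\<tau> \<le> \<rho> / (2 * e)\<close> dU(1) by (intro mult_left_mono) auto
    also have "\<dots> = \<rho> / 2" using dU(1) by simp
    finally show "e * \<tau> < \<rho>" using \<rho>(1) by linarith
  qed
  define s where "s = e * \<tau> ^ ?k"
  have s: "0 < s" "s < \<rho>"
  proof -
    show "0 < s" using \<tau>(1) dU(1) by (simp add: s_def)
    have "\<tau> ^ ?k \<le> \<tau> ^ 1" using \<tau> branch_order_pos[of ?a] by (intro power_decreasing) auto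
    then have "s \<le> e * \<tau>" using dU(1) by (simp add: s_def)
    then show "s < \<rho>" using \<tau>(4) by simp
  qed
  define \<mu> where "\<mu> = monodromy P (small_loop ?a s)"
  have loop: "small_loop ?a s \<in> loops_at P (pt_at ?a (of_real s))"
    using s \<rho>(2) by (intro small_loop_in_loops_at) auto
  define q where "q t = \<psi> (of_real \<tau> * exp (2 * of_real pi * \<i> * of_real t / of_nat ?k))" for t :: real
  have q_norm: "norm (of_real \<tau> * exp (2 * of_real pi * \<i> * of_real t / of_nat ?k)) < 1" for t :: real
    using \<tau> by (simp add: norm_mult norm_exp_eq_Re)
  have q: "q t \<in> U" "\<phi> (q t) = of_real \<tau> * exp (2 * of_real pi * \<i> * of_real t / of_nat ?k)" for t
    unfolding q_def using \<psi>(3,4)[OF q_norm] by auto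
  have q_pt: "\<pi> (q t) = Some (pt_at ?a (of_real s * exp (2 * of_real pi * \<i> * of_real t)))" for t
  proof -
    have "of_real e * \<phi> (q t) ^ ?k = of_real s * exp (2 * of_real pi * \<i> * of_real t)"
      unfolding q s_def using branch_order_pos[of ?a]
      by (simp add: power_mult_distrib exp_of_nat_mult[symmetric])
    then show ?thesis using dU(8)[OF q(1)] s(1) by (simp add: sphere_pt_pt_at)
  qed
  have q_good: "q t \<notin> bad" for t
    using q_pt[of t] \<rho>(2)[of "of_real s * exp (2 * of_real pi * \<i> * of_real t)"] s
    unfolding not_bad by (auto simp: norm_mult norm_exp_eq_Re)
  have q_step: "\<mu> (Y (q (real j))) = Y (q (real (Suc j)))" if Y: "Y \<in> branches" for Y j
  proof -
    let ?\<delta> = "\<lambda>t. q (real j + t)"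
    have "path ?\<delta>" unfolding path_def q_def
      using q_norm branch_order_pos[of ?a]
      by (intro continuous_on_compose2[OF cont\<psi>] continuous_intros) (auto simp del: of_real_add)
    moreover have "path_image ?\<delta> \<subseteq> - bad" using q_good by (auto simp: path_image_def)
    moreover have "proj \<circ> ?\<delta> = small_loop ?a s"
    proof
      fix t
      have "exp (2 * of_real pi * \<i> * of_real (real j + t)) = exp (2 * of_real pi * \<i> * of_real t)"
        by (subst exp_eq, intro exI[of _ "int j"]) (simp add: algebra_simps)
      then show "(proj \<circ> ?\<delta>) t = small_loop ?a s t" by (simp only: o_apply proj_def q_pt small_loop_eq option.sel)
    qed
    ultimately have "\<mu> (Y (pathstart ?\<delta>)) = Y (pathfinish ?\<delta>)"
      using monodromy_along_projection[of ?\<delta> Y] Y by (simp add: \<mu>_def)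
    then show ?thesis by (simp add: pathstart_def pathfinish_def add.commute)
  qed
  have q_pow: "(\<mu> ^^ j) (Y (q 0)) = Y (q (real j))" if "Y \<in> branches" for Y j
    by (induct j) (simp_all add: q_step that)
  have "\<phi> (q 0) = of_real \<tau>" using q(2)[of 0] by simp
  have "q 0 = \<psi> (of_real \<tau>)" by (simp add: q_def)
  then have gU: "g (q 0) \<in> U" using r(2) \<tau> by (auto simp: subset_iff)
  have "sphere_pt ?a (of_real e * \<phi> (g (q 0)) ^ ?k) = sphere_pt ?a (of_real e * \<phi> (q 0) ^ ?k)"
    using dU(8)[OF gU] dU(8)[OF q(1)[of 0]] g(1) by (simp add: deck_def)
  then have "\<phi> (g (q 0)) ^ ?k = of_real \<tau> ^ ?k"
    using dU(1) \<open>\<phi> (q 0) = of_real \<tau>\<close> by (simp add: sphere_pt_inj)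
  then have "(\<phi> (g (q 0)) / of_real \<tau>) ^ ?k = 1" using \<tau>(1) by (simp add: power_divide)
  then have "\<phi> (g (q 0)) / of_real \<tau> \<in> {z. z ^ ?k = 1}" by simp
  then obtain j where j: "j < ?k" "\<phi> (g (q 0)) / of_real \<tau> = exp (2 * of_real pi * \<i> * of_nat j / of_nat ?k)"
    using complex_roots_unity[of ?k] branch_order_pos[of ?a] by (auto simp: Suc_leI)
  then have "\<phi> (g (q 0)) = \<phi> (q (real j))" using \<tau>(1) q(2)[of "real j"] by (simp add: field_simps)
  then have gj: "g (q 0) = q (real j)" using inj_onD[OF dU(6)] gU q(1) by blast
  have "j \<noteq> 0"
  proof
    assume "j = 0"
    then have "q 0 = z0" using gj fix_unique by simp
    then show False using \<open>\<phi> (q 0) = of_real \<tau>\<close> U(3) \<tau>(1) by simp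
  qed
  have "(\<mu> ^^ j) y = y" if y: "y \<in> fiber P (pt_at ?a (of_real s))" for y
  proof -
    have "proj (q 0) = pt_at ?a (of_real s)" using q_pt[of 0] by (simp add: proj_def)
    then obtain Y where Y: "Y \<in> branches" "Y (q 0) = y" using branch_through[OF q_good[of 0], of y] y by metis
    have "Y (q (real j)) = y" using inv[OF Y(1), of "q 0"] gj Y(2) by simp
    then show ?thesis using q_pow[OF Y(1), of j] Y(2) by simp
  qed
  then have "?k dvd j"
    using monodromy_order[OF degree_pos loop, of j] \<rho>(3)[OF s] by (simp add: \<mu>_def)
  then show False using j(1) \<open>j \<noteq> 0\<close> by (auto dest: dvd_imp_le)
qed

text \<open>
  A value \<open>y\<close> in the fibre over \<open>x0\<close> is identified with the branch that takes it at a fixed point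
  \<open>z0\<close> over \<open>x0\<close>.  Continuation along the projection of a path from \<open>z0\<close> to \<open>h z0\<close> replaces a branch \<open>Y\<close>
  by \<open>Y \<circ> h\<close>.  This is a right action, so \<open>\<Phi>\<close> uses the inverse of the deck transformation.
\<close>

lemma monodromy_group_quotient:
  assumes "x0 \<in> regular_points P"
  shows "\<exists>N. N \<lhd> deck_group \<and> comm_group (deck_group\<lparr>carrier := N\<rparr>) \<and> monodromy_group P x0 \<cong> deck_group Mod N"
proof -
  obtain z0 where z0: "\<pi> z0 = Some x0" using surj_projection by (metis surjD)
  then have good: "z0 \<notin> bad" and pz: "proj z0 = x0" using assms by (auto simp: not_bad proj_def)
  define br where "br y = (THE Y. Y \<in> branches \<and> Y z0 = y)" for y
  have br_eq: "br (Y z0) = Y" if "Y \<in> branches" for Y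
    unfolding br_def using that branch_unique[OF _ _ good] by (intro the_equality) auto
  have br: "br y \<in> branches" "br y z0 = y" if y: "y \<in> fiber P x0" for y
  proof -
    obtain Y where "Y \<in> branches" "Y z0 = y" using branch_through[OF good, of y] y pz by metis
    then show "br y \<in> branches" "br y z0 = y" using br_eq by auto
  qed
  define \<Phi> where "\<Phi> g = (\<lambda>y\<in>fiber P x0. br y (inv_into UNIV g z0))" for g
  have loop_eq: "monodromy P (proj \<circ> \<delta>) = (\<lambda>y\<in>fiber P x0. br y (pathfinish \<delta>))" "proj \<circ> \<delta> \<in> loops_at P x0"
    if \<delta>: "path \<delta>" "path_image \<delta> \<subseteq> - bad" "pathstart \<delta> = z0" "\<pi> (pathfinish \<delta>) = \<pi> z0" for \<delta>
  proof -
    have "continuous_on (- bad) proj" using proj_holomorphic_good holomorphic_on_imp_continuous_on by blast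
    then show l: "proj \<circ> \<delta> \<in> loops_at P x0"
      unfolding loops_at_def
    proof (intro CollectI conjI)
      show "path (proj \<circ> \<delta>)"
        using \<delta>(1,2) \<open>continuous_on (- bad) proj\<close> continuous_on_subset by (blast intro: path_continuous_image)
      show "path_image (proj \<circ> \<delta>) \<subseteq> regular_points P"
        using \<delta>(2) proj_regular(1) by (auto simp: path_image_compose)
      show "pathstart (proj \<circ> \<delta>) = x0" "pathfinish (proj \<circ> \<delta>) = x0"
        using \<delta>(3,4) pz by (simp_all add: pathstart_compose pathfinish_compose proj_def)
    qed
    show "monodromy P (proj \<circ> \<delta>) = (\<lambda>y\<in>fiber P x0. br y (pathfinish \<delta>))"
    proof (rule Bij_eqI[OF monodromy_Bij[OF degree_pos l]])
      fix y assume y: "y \<in> fiber P x0"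
      show "monodromy P (proj \<circ> \<delta>) y = (\<lambda>y\<in>fiber P x0. br y (pathfinish \<delta>)) y"
        using monodromy_along_projection[OF \<delta>(1,2) br(1)[OF y]] br(2)[OF y] \<delta>(3) y by simp
    qed simp
  qed
  have \<Phi>_loop: "\<Phi> g \<in> monodromy P ` loops_at P x0" if g: "g \<in> deck" for g
  proof -
    have gi: "inv_into UNIV g \<in> deck" by (rule deck_inv[OF g])
    then have "inv_into UNIV g z0 \<in> - bad" using good deck_bad by simp
    then obtain \<delta> where \<delta>: "path \<delta>" "path_image \<delta> \<subseteq> - bad" "pathstart \<delta> = z0" "pathfinish \<delta> = inv_into UNIV g z0"
      using path_connected_good good unfolding path_connected_def by blast
    have "\<pi> (pathfinish \<delta>) = \<pi> z0" using \<delta>(4) gi by (simp add: deck_def)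
    from loop_eq[OF \<delta>(1-3) this] show ?thesis unfolding \<Phi>_def \<delta>(4) by (metis imageI)
  qed
  have \<Phi>_Bij: "\<Phi> g \<in> Bij (fiber P x0)" if "g \<in> deck" for g
    using \<Phi>_loop[OF that] monodromy_Bij[OF degree_pos] by auto
  have onto: "\<Phi> ` deck = monodromy P ` loops_at P x0"
  proof
    show "\<Phi> ` deck \<subseteq> monodromy P ` loops_at P x0" using \<Phi>_loop by blast
    show "monodromy P ` loops_at P x0 \<subseteq> \<Phi> ` deck"
    proof
      fix m assume "m \<in> monodromy P ` loops_at P x0"
      then obtain \<gamma> where \<gamma>: "path \<gamma>" "path_image \<gamma> \<subseteq> regular_points P" "pathstart \<gamma> = x0" "pathfinish \<gamma> = x0"
        "m = monodromy P \<gamma>" by (auto simp: loops_at_def)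
      have "z0 \<in> - bad" "pathstart \<gamma> = proj z0" using good pz \<gamma>(3) by auto
      then obtain \<delta> where \<delta>: "path \<delta>" "path_image \<delta> \<subseteq> - bad" "pathstart \<delta> = z0" "\<And>t. t \<in> {0..1} \<Longrightarrow> proj (\<delta> t) = \<gamma> t"
        by (rule covering_space_lift_path_strong[OF covering_regular _ \<gamma>(1,2)]) (rule that)
      have "pathfinish \<delta> \<notin> bad" using \<delta>(2) pathfinish_in_path_image[of \<delta>] by blast
      moreover have "proj (pathfinish \<delta>) = x0" using \<delta>(4)[of 1] \<gamma>(4) by (simp add: pathfinish_def)
      ultimately have fin: "\<pi> (pathfinish \<delta>) = \<pi> z0" using proj_regular(2) z0 by metis
      obtain h where h: "h \<in> deck" "h z0 = pathfinish \<delta>" by (rule deck_transitive[OF fin[symmetric]]) (rule that)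
      have "bij h" using h(1) by (simp add: deck_def)
      have "m y = br y (pathfinish \<delta>)" if y: "y \<in> fiber P x0" for y
      proof -
        have cY: "continuous_on (- bad) (br y)"
          using branchesD(1)[OF br(1)[OF y]] by (rule holomorphic_on_imp_continuous_on)
        have "monodromy P \<gamma> (pathstart (br y \<circ> \<delta>)) = pathfinish (br y \<circ> \<delta>)"
        proof (rule monodromy_eqI[OF degree_pos \<gamma>(1,2)])
          show "path (br y \<circ> \<delta>)" using \<delta>(1,2) cY by (auto intro!: path_continuous_image intro: continuous_on_subset)
          show "(br y \<circ> \<delta>) t \<in> fiber P (\<gamma> t)" if "t \<in> {0..1}" for t
            using branchesD(2)[OF br(1)[OF y], of "\<delta> t"] \<delta>(2,4) that
            by (auto simp: path_image_def image_subset_iff)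
        qed
        then show ?thesis using \<delta>(3) br(2)[OF y] \<gamma>(5) by (simp add: pathstart_compose pathfinish_compose)
      qed
      then have "m = \<Phi> (inv_into UNIV h)"
        using monodromy_Bij[OF degree_pos, of \<gamma> x0] \<gamma> h \<open>bij h\<close>
        by (intro Bij_eqI[of _ "fiber P x0"]) (auto simp: loops_at_def \<Phi>_def inv_inv_eq)
      then show "m \<in> \<Phi> ` deck" using deck_inv[OF h(1)] by blast
    qed
  qed
  have hom: "\<Phi> (g \<circ> h) = \<Phi> g \<otimes>\<^bsub>monodromy_group P x0\<^esub> \<Phi> h" if g: "g \<in> deck" and h: "h \<in> deck" for g h
  proof -
    have bij: "bij g" "bij h" using g h by (auto simp: deck_def)
    have "\<Phi> (g \<circ> h) y = \<Phi> g (\<Phi> h y)" if y: "y \<in> fiber P x0" for y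
    proof -
      have "br y \<circ> inv_into UNIV h \<in> branches" by (rule branch_deck[OF deck_inv[OF h] br(1)[OF y]])
      from br_eq[OF this] have "br (\<Phi> h y) = br y \<circ> inv_into UNIV h" using y by (simp add: \<Phi>_def)
      moreover have "\<Phi> h y \<in> fiber P x0" using \<Phi>_Bij[OF h] y Bij_imp_funcset by blast
      ultimately show ?thesis using y bij by (simp add: \<Phi>_def o_inv_distrib)
    qed
    then have "\<Phi> (g \<circ> h) = compose (fiber P x0) (\<Phi> g) (\<Phi> h)"
      using \<Phi>_Bij[OF deck_comp[OF g h]] by (intro Bij_eqI) (auto simp: compose_def)
    then show ?thesis using mult_monodromy_group[OF \<Phi>_Bij[OF g] \<Phi>_Bij[OF h]] by simp
  qed
  have carr: "carrier (monodromy_group P x0) = monodromy P ` loops_at P x0" by (simp add: monodromy_group_loops)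
  interpret D: group deck_group by (rule group_deck)
  interpret h: group_hom deck_group "monodromy_group P x0" \<Phi>
    by (intro group_hom.intro group_deck group_monodromy_group[OF degree_pos assms] group_hom_axioms.intro homI)
      (use \<Phi>_loop hom carr in \<open>auto simp: deck_group_def\<close>)
  let ?N = "kernel deck_group (monodromy_group P x0) \<Phi>"
  have translation: "\<exists>b. \<forall>z. g z = z + b" if "g \<in> ?N" for g
  proof -
    have g: "g \<in> deck" and id: "\<Phi> g = (\<lambda>y\<in>fiber P x0. y)"
      using that by (auto simp: kernel_def deck_group_def one_monodromy_group)
    have "bij g" using g by (simp add: deck_def)
    have inv: "Y (g z) = Y z" if Y: "Y \<in> branches" for Y z
    proof -
      have "Y z0 \<in> fiber P x0" using branchesD(2)[OF Y good] pz by simp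
      then have "Y (inv_into UNIV g z0) = Y z0" using id br_eq[OF Y] by (simp add: \<Phi>_def fun_eq_iff) metis
      then have "Y \<circ> inv_into UNIV g = Y"
        using branch_unique[OF branch_deck[OF deck_inv[OF g] Y] Y good] by simp
      then have "Y (inv_into UNIV g (g z)) = Y (g z)" by (metis o_apply)
      then show ?thesis using \<open>bij g\<close> by (simp add: bij_is_inj)
    qed
    obtain a b where ab: "a \<noteq> 0" "\<And>z. g z = a * z + b" by (rule deck_affine[OF g]) (rule that)
    have "a = 1" using fixing_branches_no_fixed_point[OF g ab(2) _ inv] by blast
    then show ?thesis using ab(2) by auto
  qed
  have N: "?N \<lhd> deck_group" by (rule h.normal_kernel)
  have "group (deck_group\<lparr>carrier := ?N\<rparr>)"
    by (rule D.subgroup_imp_group[OF normal_imp_subgroup[OF N]])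
  moreover have "f \<circ> g = g \<circ> f" if "f \<in> ?N" "g \<in> ?N" for f g
    using translation[OF that(1)] translation[OF that(2)] by (auto simp: fun_eq_iff)
  ultimately have "comm_group (deck_group\<lparr>carrier := ?N\<rparr>)"
    by (intro group.group_comm_groupI) (auto simp: deck_group_def)
  moreover have "deck_group Mod ?N \<cong> monodromy_group P x0"
    using onto carr by (intro h.FactGroup_iso) (simp add: deck_group_def)
  then have "monodromy_group P x0 \<cong> deck_group Mod ?N"
    by (rule group.iso_sym[OF normal.factorgroup_is_group[OF N]])
  ultimately show ?thesis using N by blast
qed

end

section \<open>Polynomial growth and rational functions\<close>

lemma poly_growth:
  fixes p :: "complex poly"
  obtains C M where "C \<ge> 0" "\<And>x. norm (poly p x) \<le> C * (1 + norm x) ^ M"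
proof -
  have "\<exists>C M. C \<ge> 0 \<and> (\<forall>x. norm (poly p x) \<le> C * (1 + norm x) ^ M)"
  proof (induct p)
    case 0
    show ?case by (intro exI[of _ 0]) simp
  next
    case (pCons a p)
    then obtain C M where C: "C \<ge> 0" "\<And>x. norm (poly p x) \<le> C * (1 + norm x) ^ M" by blast
    have "norm (poly (pCons a p) x) \<le> (norm a + C) * (1 + norm x) ^ Suc M" for x
    proof -
      have "norm (poly (pCons a p) x) \<le> norm a + norm x * norm (poly p x)"
        using norm_triangle_ineq[of a "x * poly p x"] by (simp add: norm_mult)
      also have "\<dots> \<le> norm a * (1 + norm x) ^ Suc M + (1 + norm x) * (C * (1 + norm x) ^ M)"
      proof (intro add_mono mult_mono C(2))
        have "1 \<le> (1 + norm x) ^ Suc M" by (intro one_le_power) simp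
        then show "norm a \<le> norm a * (1 + norm x) ^ Suc M" using mult_left_mono[of 1 _ "norm a"] by simp
      qed (use C(1) in auto)
      also have "\<dots> = (norm a + C) * (1 + norm x) ^ Suc M" by (simp add: algebra_simps)
      finally show ?thesis .
    qed
    then show ?case using C(1) by (intro exI[of _ "norm a + C"] exI[of _ "Suc M"]) auto
  qed
  then show ?thesis using that by blast
qed

text \<open>
  The function is bounded near the finitely many missing points, so it extends to an entire function,
  and Liouville's theorem applies.
\<close>

lemma polynomial_of_growth:
  assumes "finite (- S)" "h holomorphic_on S" "C \<ge> 0" "\<And>x. x \<in> S \<Longrightarrow> norm (h x) \<le> C * (1 + norm x) ^ M"
  obtains p where "\<And>x. x \<in> S \<Longrightarrow> h x = poly p x"
proof -
  have "h \<in> O[at z](\<lambda>_. 1)" if "z \<in> - S" for z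
  proof (rule bigoI)
    have "\<forall>\<^sub>F x in at z. x \<in> S"
    proof -
      have "open (- (- S - {z}))" using assms(1) by (intro open_Compl finite_imp_closed) auto
      then have "\<forall>\<^sub>F x in at z. x \<in> - (- S - {z}) - {z}" by (intro eventually_at_in_open) auto
      then show ?thesis by eventually_elim auto
    qed
    moreover have "\<forall>\<^sub>F x in at z. x \<in> ball z 1" by (intro eventually_at_in_open') auto
    ultimately show "\<forall>\<^sub>F x in at z. norm (h x) \<le> (C * (2 + norm z) ^ M) * norm (1 :: complex)"
    proof eventually_elim
      case (elim x)
      have "norm x \<le> norm z + 1" using elim(2) norm_triangle_sub[of x z] by (simp add: dist_norm norm_minus_commute)
      then have "C * (1 + norm x) ^ M \<le> C * (2 + norm z) ^ M"
        using assms(3) by (intro mult_left_mono power_mono) auto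
      then show ?case using assms(4)[OF elim(1)] by simp
    qed
  qed
  then obtain g where g: "g holomorphic_on UNIV" "\<And>z. z \<in> S \<Longrightarrow> g z = h z"
    using removable_singularities[of "- S" UNIV h] assms(1,2) by (auto simp: Compl_eq_Diff_UNIV[symmetric])
  obtain B where B: "\<And>z. z \<in> - S \<Longrightarrow> norm z \<le> B"
    using finite_imp_bounded[OF assms(1)] unfolding bounded_iff by blast
  have "norm (g z) \<le> (C * 2 ^ M) * norm z ^ M" if z: "max 1 (B + 1) \<le> norm z" for z
  proof -
    have S: "z \<in> S" using B[of z] z by force
    have "C * (1 + norm z) ^ M \<le> C * (2 * norm z) ^ M"
      using assms(3) z by (intro mult_left_mono power_mono) auto
    then show ?thesis using g(2)[OF S] assms(4)[OF S] by (simp add: power_mult_distrib algebra_simps)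
  qed
  then have lp: "g z = (\<Sum>k\<le>M. (deriv ^^ k) g 0 / fact k * z ^ k)" for z
    by (rule Liouville_polynomial[OF g(1)])
  define p where "p = (\<Sum>k\<le>M. Polynomial.monom ((deriv ^^ k) g 0 / fact k) k)"
  have "(\<Sum>k\<le>M. (deriv ^^ k) g 0 / fact k * z ^ k) = poly p z" for z
    by (simp add: p_def poly_sum poly_monom)
  then have "g z = poly p z" for z by (rule trans[OF lp])
  then show ?thesis using that g(2) by metis
qed

lemma root_bound:
  assumes "y \<in> fiber P x" "degree P > 0"
  shows "norm y * norm (poly (lead_coeff P) x) \<le> (\<Sum>i\<le>degree P. norm (poly (poly.coeff P i) x))"
proof (cases "norm y \<le> 1")
  case True
  have "norm y * norm (poly (lead_coeff P) x) \<le> norm (poly (poly.coeff P (degree P)) x)"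
    using True by (intro mult_left_le_one_le) auto
  also have "\<dots> \<le> (\<Sum>i\<le>degree P. norm (poly (poly.coeff P i) x))"
    by (rule member_le_sum) auto
  finally show ?thesis .
next
  case False
  obtain d where d: "degree P = Suc d" using assms(2) gr0_implies_Suc by blast
  let ?a = "\<lambda>i. poly (poly.coeff P i) x"
  have "poly (poly P [:y:]) x = (\<Sum>i\<le>Suc d. ?a i * y ^ i)"
    unfolding poly_altdef[of P] d by (simp add: poly_sum poly_power)
  then have "?a (Suc d) * y ^ Suc d = - (\<Sum>i\<le>d. ?a i * y ^ i)"
    using assms(1) by (simp add: fiber_def add_eq_0_iff)
  then have "norm (?a (Suc d)) * norm y ^ Suc d = norm (\<Sum>i\<le>d. ?a i * y ^ i)"
    by (metis norm_minus_cancel norm_mult norm_power)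
  also have "\<dots> \<le> (\<Sum>i\<le>d. norm (?a i) * norm y ^ d)"
  proof (rule sum_norm_le)
    fix i assume "i \<in> {..d}"
    then have "norm y ^ i \<le> norm y ^ d" using False by (intro power_increasing) auto
    then show "norm (?a i * y ^ i) \<le> norm (?a i) * norm y ^ d"
      by (simp add: norm_mult norm_power mult_left_mono)
  qed
  also have "\<dots> = (\<Sum>i\<le>d. norm (?a i)) * norm y ^ d" by (simp add: sum_distrib_right)
  finally have "(norm y * norm (?a (Suc d))) * norm y ^ d \<le> (\<Sum>i\<le>d. norm (?a i)) * norm y ^ d"
    by (simp add: algebra_simps)
  moreover have "norm y ^ d > 0" using False by (intro zero_less_power) auto
  ultimately have "norm y * norm (?a (Suc d)) \<le> (\<Sum>i\<le>d. norm (?a i))" by simp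
  then show ?thesis by (simp add: d add_increasing2)
qed

section \<open>Closure properties of functions given by radicals\<close>

text \<open>
  The first root of a function is the function itself; this replaces a formula by any holomorphic
  function that agrees with it on the domain.
\<close>

lemma radical_on_cong:
  assumes "radical_on U g" "f holomorphic_on U" "\<And>x. x \<in> U \<Longrightarrow> f x = g x"
  shows "radical_on U f"
  by (rule radical_on.root[OF assms(1,2), of 1]) (use assms(3) in auto)

lemma radical_on_const: "radical_on U (\<lambda>x. c)"
  using radical_on.rational[of U 1 "[:c:]"] by simp

lemma radical_on_sum:
  assumes "\<And>i. i \<in> I \<Longrightarrow> radical_on U (f i)"
  shows "radical_on U (\<lambda>x. \<Sum>i\<in>I. f i x)"
  using assms
proof (induct I rule: infinite_finite_induct)
  case (insert i I)
  then show ?case using radical_on.add[of U "f i" "\<lambda>x. \<Sum>i\<in>I. f i x"] by simp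
qed (simp_all add: radical_on_const)

section \<open>Lagrange resolvents\<close>

lemma resolvent_shift:
  fixes a :: "'a::comm_ring_1" and f :: "nat \<Rightarrow> 'a"
  assumes "a ^ m = 1" "f m = f 0"
  shows "a * (\<Sum>j<m. a ^ j * f (Suc j)) = (\<Sum>j<m. a ^ j * f j)"
proof -
  have "a * (\<Sum>j<m. a ^ j * f (Suc j)) = (\<Sum>j<m. a ^ Suc j * f (Suc j))"
    by (simp add: sum_distrib_left algebra_simps)
  also have "\<dots> = (\<Sum>j<Suc m. a ^ j * f j) - a ^ 0 * f 0" by (simp only: sum.lessThan_Suc_shift) simp
  also have "\<dots> = (\<Sum>j<m. a ^ j * f j)" using assms by simp
  finally show ?thesis .
qed

text \<open>
  The orthogonality relations for the powers of a primitive root of unity: the resolvents sum up to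
  a multiple of the original function.
\<close>

lemma resolvent_inversion:
  fixes f :: "nat \<Rightarrow> complex"
  assumes "m > 0"
  defines "\<zeta> \<equiv> exp (2 * of_real pi * \<i> / of_nat m)"
  shows "\<zeta> ^ m = 1" "(\<Sum>k<m. \<Sum>j<m. (\<zeta> ^ k) ^ j * f j) = of_nat m * f 0"
proof -
  have pow: "\<zeta> ^ j = exp (2 * of_real pi * \<i> * of_nat j / of_nat m)" for j
    unfolding \<zeta>_def exp_of_nat_mult[symmetric] by (simp add: algebra_simps)
  show z1: "\<zeta> ^ m = 1" unfolding pow using assms(1) by simp
  have orth: "(\<Sum>k<m. (\<zeta> ^ j) ^ k) = (if j = 0 then of_nat m else 0)" if "j < m" for j
  proof (cases "j = 0")
    case False
    then have "\<zeta> ^ j \<noteq> 1" unfolding pow using complex_root_unity_eq_1[of m j] assms(1) that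
      by (auto dest: dvd_imp_le)
    moreover have "(\<zeta> ^ j) ^ m = 1" using z1 by (metis power_mult mult.commute power_one)
    ultimately show ?thesis using False by (simp add: geometric_sum)
  qed simp
  have "(\<Sum>k<m. \<Sum>j<m. (\<zeta> ^ k) ^ j * f j) = (\<Sum>j<m. (\<Sum>k<m. (\<zeta> ^ j) ^ k) * f j)"
    by (subst sum.swap) (simp add: sum_distrib_left sum_distrib_right power_mult[symmetric] mult.commute)
  also have "\<dots> = (\<Sum>j<m. if j = 0 then of_nat m * f 0 else 0)"
    by (intro sum.cong) (auto simp: orth)
  also have "\<dots> = of_nat m * f 0" using assms(1) by simp
  finally show "(\<Sum>k<m. \<Sum>j<m. (\<zeta> ^ k) ^ j * f j) = of_nat m * f 0" .
qed

section \<open>Expressibility in radicals\<close>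

context line_uniformized
begin

inductive_set branch_ring :: "(complex \<Rightarrow> complex) set" where
  branch: "Y \<in> branches \<Longrightarrow> Y \<in> branch_ring"
| const: "(\<lambda>z. c) \<in> branch_ring"
| add: "F \<in> branch_ring \<Longrightarrow> H \<in> branch_ring \<Longrightarrow> (\<lambda>z. F z + H z) \<in> branch_ring"
| mult: "F \<in> branch_ring \<Longrightarrow> H \<in> branch_ring \<Longrightarrow> (\<lambda>z. F z * H z) \<in> branch_ring"

lemma branch_ring_sum:
  "(\<And>i. i \<in> I \<Longrightarrow> F i \<in> branch_ring) \<Longrightarrow> (\<lambda>z. \<Sum>i\<in>I. F i z) \<in> branch_ring"
  by (induct I rule: infinite_finite_induct) (auto intro: branch_ring.intros)

lemma branch_ring_power: "F \<in> branch_ring \<Longrightarrow> (\<lambda>z. F z ^ n) \<in> branch_ring"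
  by (induct n) (auto intro: branch_ring.intros)

lemma branch_ring_holomorphic: "F \<in> branch_ring \<Longrightarrow> F holomorphic_on - bad"
  by (induct rule: branch_ring.induct) (auto intro: holomorphic_on_add holomorphic_on_mult branchesD(1))

lemma branch_ring_deck: "F \<in> branch_ring \<Longrightarrow> g \<in> deck \<Longrightarrow> F \<circ> g \<in> branch_ring"
proof (induct rule: branch_ring.induct)
  case (branch Y)
  then show ?case by (intro branch_ring.branch branch_deck)
qed (auto simp: o_def intro: branch_ring.intros)

lemma deck_power: "g \<in> deck \<Longrightarrow> g ^^ n \<in> deck"
  by (induct n) (simp_all add: deck_id deck_comp del: id_apply)

lemma branch_ring_deck_cong:
  assumes "F \<in> branch_ring" "\<And>Y. Y \<in> branches \<Longrightarrow> Y \<circ> g = Y \<circ> h"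
  shows "F \<circ> g = F \<circ> h"
  using assms(1)
proof (induct rule: branch_ring.induct)
  case (branch Y)
  then show ?case by (rule assms(2))
qed (auto simp: fun_eq_iff)

text \<open>
  The action on the finite set of branches takes the same value at two powers of \<open>g\<close>.
\<close>

lemma deck_finite_order:
  assumes "g \<in> deck"
  obtains m where "m > 0" "\<And>F. F \<in> branch_ring \<Longrightarrow> F \<circ> (g ^^ m) = F"
proof -
  define c where "c n = (\<lambda>Y\<in>branches. Y \<circ> (g ^^ n))" for n
  have "range c \<subseteq> branches \<rightarrow>\<^sub>E branches"
    using branch_deck[OF deck_power[OF assms]] by (auto simp: c_def)
  then have "finite (range c)" by (rule finite_subset) (intro finite_PiE finite_branches)
  then have "\<not> inj c" using finite_imageD infinite_UNIV_nat by blast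
  then obtain i j where ij: "c i = c j" "i < j" unfolding inj_def by (metis nat_neq_iff)
  have "Y \<circ> (g ^^ (j - i)) = Y \<circ> id" if "Y \<in> branches" for Y
  proof -
    have "Y \<circ> (g ^^ i) = Y \<circ> (g ^^ j)" using fun_cong[OF ij(1), of Y] that by (simp add: c_def)
    also have "g ^^ j = (g ^^ (j - i)) \<circ> (g ^^ i)" using ij(2) by (simp flip: funpow_add)
    finally have eq: "(Y \<circ> (g ^^ (j - i))) \<circ> (g ^^ i) = Y \<circ> (g ^^ i)" by (metis o_assoc)
    have "surj (g ^^ i)" using deck_power[OF assms] by (simp add: deck_def bij_is_surj)
    then have "(Y \<circ> (g ^^ (j - i))) z = Y z" for z using eq by (metis o_apply surjD)
    then show ?thesis by (simp add: fun_eq_iff)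
  qed
  then have "F \<circ> (g ^^ (j - i)) = F" if "F \<in> branch_ring" for F
    using branch_ring_deck_cong[OF that, of "g ^^ (j - i)" id] by simp
  then show ?thesis using that[of "j - i"] ij(2) by simp
qed

lemma finite_representatives:
  assumes "D \<subseteq> deck"
  obtains S where "finite S" "S \<subseteq> D" "\<And>g F. g \<in> D \<Longrightarrow> F \<in> branch_ring \<Longrightarrow> \<exists>h\<in>S. F \<circ> g = F \<circ> h"
proof -
  define c where "c g = (\<lambda>Y\<in>branches. Y \<circ> g)" for g :: "complex \<Rightarrow> complex"
  have "c ` D \<subseteq> branches \<rightarrow>\<^sub>E branches" using branch_deck assms by (auto simp: c_def)
  then have "finite (c ` D)" by (rule finite_subset) (intro finite_PiE finite_branches)
  then obtain S where S: "S \<subseteq> D" "finite S" "c ` D = c ` S"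
    using finite_subset_image[of "c ` D" c D] by blast
  have "\<exists>h\<in>S. F \<circ> g = F \<circ> h" if "g \<in> D" "F \<in> branch_ring" for g F
  proof -
    have "c g \<in> c ` S" using S(3) that(1) by (metis imageI)
    then obtain h where h: "h \<in> S" "c g = c h" by (metis imageE)
    have "F \<circ> g = F \<circ> h"
    proof (rule branch_ring_deck_cong[OF that(2)])
      fix Y assume "Y \<in> branches"
      then show "Y \<circ> g = Y \<circ> h" using fun_cong[OF h(2), of Y] by (simp add: c_def)
    qed
    then show ?thesis using h(1) by blast
  qed
  then show ?thesis using that S by blast
qed

subsection \<open>Invariants of the deck group are rational\<close>

text \<open>
  Bounds by powers of this weight are stable under sums and products.  They express polynomial growth at
  infinity and at the zeros of the leading coefficient.
\<close>

definition weight :: "complex \<Rightarrow> real" where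
  "weight z = (1 + norm (proj z)) * (1 + 1 / norm (poly (lead_coeff P) (proj z)))"

lemma weight_ge_1: "weight z \<ge> 1"
proof -
  have "1 * 1 \<le> weight z" unfolding weight_def by (intro mult_mono) auto
  then show ?thesis by simp
qed

lemma branch_ring_growth:
  assumes "F \<in> branch_ring"
  shows "\<exists>C M. C \<ge> 0 \<and> (\<forall>z. z \<notin> bad \<longrightarrow> norm (F z) \<le> C * weight z ^ M)"
  using assms
proof (induct rule: branch_ring.induct)
  case (branch Y)
  have "\<exists>C M. C \<ge> 0 \<and> (\<forall>x. norm (poly (poly.coeff P i) x) \<le> C * (1 + norm x) ^ M)" for i
    by (rule poly_growth[of "poly.coeff P i"]) blast
  then obtain C M where C: "\<And>i. C i \<ge> 0" "\<And>i x. norm (poly (poly.coeff P i) x) \<le> C i * (1 + norm x) ^ M i"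
    by metis
  define K where "K = (\<Sum>i\<le>degree P. M i)"
  have "norm (Y z) \<le> (\<Sum>i\<le>degree P. C i) * weight z ^ Suc K" if z: "z \<notin> bad" for z
  proof -
    let ?x = "proj z" and ?l = "norm (poly (lead_coeff P) (proj z))"
    have l: "?l > 0" using regular_pointD(1)[OF degree_pos proj_regular(1)[OF z]] by simp
    have "norm (Y z) * ?l \<le> (\<Sum>i\<le>degree P. norm (poly (poly.coeff P i) ?x))"
      using root_bound[OF branchesD(2)[OF branch z] degree_pos] .
    also have "\<dots> \<le> (\<Sum>i\<le>degree P. C i * (1 + norm ?x) ^ K)"
    proof (rule sum_mono)
      fix i assume "i \<in> {..degree P}"
      then have "M i \<le> K" unfolding K_def by (intro member_le_sum) auto
      then have "(1 + norm ?x) ^ M i \<le> (1 + norm ?x) ^ K" by (intro power_increasing) auto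
      then have "C i * (1 + norm ?x) ^ M i \<le> C i * (1 + norm ?x) ^ K" using C(1) by (intro mult_left_mono)
      then show "norm (poly (poly.coeff P i) ?x) \<le> C i * (1 + norm ?x) ^ K" using C(2) order_trans by blast
    qed
    also have "\<dots> = (\<Sum>i\<le>degree P. C i) * (1 + norm ?x) ^ K" by (simp add: sum_distrib_right)
    finally have "norm (Y z) \<le> (\<Sum>i\<le>degree P. C i) * ((1 + norm ?x) ^ K * (1 / ?l))"
      using l by (simp add: field_simps)
    also have "\<dots> \<le> (\<Sum>i\<le>degree P. C i) * (weight z ^ K * weight z)"
    proof (intro mult_left_mono mult_mono)
      have "(1 + norm ?x) * 1 \<le> weight z" "1 * (1 / ?l) \<le> weight z"
        unfolding weight_def by (intro mult_mono; simp)+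
      then show "(1 + norm ?x) ^ K \<le> weight z ^ K" "1 / ?l \<le> weight z" by (auto intro: power_mono)
    qed (use C(1) weight_ge_1[of z] in \<open>auto intro: sum_nonneg\<close>)
    finally show ?thesis by (simp add: mult.commute)
  qed
  then show ?case using C(1) by (intro exI[of _ "\<Sum>i\<le>degree P. C i"] exI[of _ "Suc K"]) (auto intro: sum_nonneg)
next
  case (const c)
  show ?case by (intro exI[of _ "norm c"] exI[of _ 0]) auto
next
  case (add F H)
  then obtain C M C' M' where C: "C \<ge> 0" "\<And>z. z \<notin> bad \<Longrightarrow> norm (F z) \<le> C * weight z ^ M"
      "C' \<ge> 0" "\<And>z. z \<notin> bad \<Longrightarrow> norm (H z) \<le> C' * weight z ^ M'" by blast
  have "norm (F z + H z) \<le> (C + C') * weight z ^ (M + M')" if z: "z \<notin> bad" for z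
  proof -
    have "C * weight z ^ M \<le> C * weight z ^ (M + M')" "C' * weight z ^ M' \<le> C' * weight z ^ (M + M')"
      using C(1,3) weight_ge_1[of z] by (intro mult_left_mono power_increasing; simp)+
    then show ?thesis using norm_triangle_ineq[of "F z" "H z"] C(2,4)[OF z] by (simp add: algebra_simps)
  qed
  then show ?case using C(1,3) by (intro exI[of _ "C + C'"] exI[of _ "M + M'"]) auto
next
  case (mult F H)
  then obtain C M C' M' where C: "C \<ge> 0" "\<And>z. z \<notin> bad \<Longrightarrow> norm (F z) \<le> C * weight z ^ M"
      "C' \<ge> 0" "\<And>z. z \<notin> bad \<Longrightarrow> norm (H z) \<le> C' * weight z ^ M'" by blast
  have "norm (F z * H z) \<le> (C * C') * weight z ^ (M + M')" if z: "z \<notin> bad" for z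
  proof -
    have "norm (F z) * norm (H z) \<le> (C * weight z ^ M) * (C' * weight z ^ M')"
      using C z weight_ge_1[of z] by (intro mult_mono) auto
    then show ?thesis by (simp add: norm_mult power_add algebra_simps)
  qed
  then show ?case using C(1,3) by (intro exI[of _ "C * C'"] exI[of _ "M + M'"]) auto
qed

lemma local_section:
  assumes "x \<in> regular_points P"
  obtains d \<sigma> where "d > 0" "ball x d \<subseteq> regular_points P" "\<sigma> holomorphic_on ball x d"
    "\<And>x'. x' \<in> ball x d \<Longrightarrow> \<sigma> x' \<notin> bad" "\<And>x'. x' \<in> ball x d \<Longrightarrow> proj (\<sigma> x') = x'"
proof -
  obtain z where z: "\<pi> z = Some x" using surj_projection by (metis surjD)
  obtain e U \<phi> where U: "disc_chart (\<pi> z) e U \<phi>" by (rule chart_around) (rule that)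
  note dU = disc_chartD[OF U]
  have order: "branch_order (Some x) = 1"
    using regular_not_branched[OF assms] by (simp add: branch_order_def)
  obtain \<psi> where \<psi>: "\<psi> holomorphic_on ball 0 1" "\<And>w. norm w < 1 \<Longrightarrow> \<psi> w \<in> U" "\<And>w. norm w < 1 \<Longrightarrow> \<phi> (\<psi> w) = w"
    by (rule disc_chart_inverse[OF U]) (rule that)
  obtain d0 where d0: "d0 > 0" "ball x d0 \<subseteq> regular_points P" using open_regular assms open_contains_ball by blast
  define \<sigma> where "\<sigma> x' = \<psi> ((x' - x) / of_real e)" for x'
  have small: "norm ((x' - x) / of_real e) < 1" if "x' \<in> ball x e" for x'
    using that dU(1) by (simp add: norm_divide dist_norm norm_minus_commute)
  have \<pi>\<sigma>: "\<pi> (\<sigma> x') = Some x'" if "x' \<in> ball x e" for x'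
    using dU(8)[OF \<psi>(2)[OF small[OF that]]] \<psi>(3)[OF small[OF that]] order dU(1)
    by (simp add: \<sigma>_def z)
  show ?thesis
  proof (rule that[of "min d0 e" \<sigma>])
    have "\<sigma> holomorphic_on ball x e" unfolding \<sigma>_def
      using small dU(1) by (intro holomorphic_on_compose_gen[of "\<lambda>x'. (x' - x) / of_real e" _ \<psi> "ball 0 1", unfolded o_def]
          holomorphic_intros \<psi>(1)) auto
    then show "\<sigma> holomorphic_on ball x (min d0 e)" by (rule holomorphic_on_subset) auto
    show "\<sigma> x' \<notin> bad" "proj (\<sigma> x') = x'" if "x' \<in> ball x (min d0 e)" for x'
      using \<pi>\<sigma>[of x'] d0(2) that by (auto simp: not_bad proj_def)
  qed (use d0 dU(1) in auto)
qed

text \<open>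
  An invariant function is constant on the fibres of the projection, so it is a function of \<open>x\<close>.
  Multiplication by a power of the leading coefficient bounds it by a polynomial.
\<close>

lemma deck_invariant_rational:
  assumes "F \<in> branch_ring" "\<And>g. g \<in> deck \<Longrightarrow> F \<circ> g = F"
  obtains p n where "\<And>z. z \<notin> bad \<Longrightarrow> F z = poly p (proj z) / poly (lead_coeff P ^ n) (proj z)"
proof -
  define f where "f x = F (SOME z. \<pi> z = Some x)" for x
  have Ff: "F z = f (proj z)" if "z \<notin> bad" for z
  proof -
    have "\<pi> (SOME w. \<pi> w = Some (proj z)) = Some (proj z)"
      using proj_regular(2)[OF that] by (rule someI)
    then have "\<pi> z = \<pi> (SOME w. \<pi> w = Some (proj z))" using proj_regular(2)[OF that] by simp
    then obtain g where "g \<in> deck" "g z = (SOME w. \<pi> w = Some (proj z))" by (rule deck_transitive)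
    then show ?thesis using assms(2)[of g] unfolding f_def by (metis o_apply)
  qed
  obtain C M where C: "C \<ge> 0" "\<And>z. z \<notin> bad \<Longrightarrow> norm (F z) \<le> C * weight z ^ M"
    using branch_ring_growth[OF assms(1)] by blast
  define h where "h x = f x * poly (lead_coeff P ^ M) x" for x
  have "f field_differentiable at x" if "x \<in> regular_points P" for x
  proof -
    obtain d \<sigma> where \<sigma>: "d > 0" "ball x d \<subseteq> regular_points P" "\<sigma> holomorphic_on ball x d"
        "\<And>x'. x' \<in> ball x d \<Longrightarrow> \<sigma> x' \<notin> bad" "\<And>x'. x' \<in> ball x d \<Longrightarrow> proj (\<sigma> x') = x'"
      by (rule local_section[OF \<open>x \<in> regular_points P\<close>]) (rule that)
    have "(F \<circ> \<sigma>) holomorphic_on ball x d"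
      using \<sigma>(3,4) branch_ring_holomorphic[OF assms(1)] by (intro holomorphic_on_compose_gen) auto
    then have "f holomorphic_on ball x d"
      by (rule holomorphic_transform) (use Ff \<sigma>(4,5) in auto)
    then show ?thesis using \<sigma>(1) by (simp add: holomorphic_on_imp_differentiable_at)
  qed
  then have "f holomorphic_on regular_points P"
    by (simp add: holomorphic_on_def field_differentiable_at_within)
  moreover have "poly q holomorphic_on S" for q :: "complex poly" and S
    unfolding poly_altdef by (intro holomorphic_intros)
  ultimately have hol: "h holomorphic_on regular_points P"
    unfolding h_def by (intro holomorphic_intros) auto
  obtain D N where D: "D \<ge> 0" "\<And>x. norm (poly (lead_coeff P) x) \<le> D * (1 + norm x) ^ N"
    by (rule poly_growth[of "lead_coeff P"]) (rule that)
  have growth: "norm (h x) \<le> (C * (D + 1) ^ M) * (1 + norm x) ^ (M + N * M)" if x: "x \<in> regular_points P" for x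
  proof -
    let ?l = "norm (poly (lead_coeff P) x)"
    have l: "?l > 0" using regular_pointD(1)[OF degree_pos x] by simp
    obtain z where z: "\<pi> z = Some x" using surj_projection by (metis surjD)
    then have zx: "z \<notin> bad" "proj z = x" using x by (auto simp: not_bad proj_def)
    have one: "(1 + norm x) ^ N \<ge> 1" by (intro one_le_power) simp
    have "norm (h x) \<le> (C * weight z ^ M) * ?l ^ M"
      using C(2)[OF zx(1)] Ff[OF zx(1)] zx(2)
      by (simp add: h_def norm_mult norm_power poly_power mult_right_mono)
    also have "\<dots> = C * ((1 + norm x) * (?l + 1)) ^ M"
      using l by (simp add: weight_def zx(2) power_mult_distrib[symmetric] field_simps)
    also have "\<dots> \<le> C * ((1 + norm x) * ((D + 1) * (1 + norm x) ^ N)) ^ M"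
    proof -
      have "?l + 1 \<le> (D + 1) * (1 + norm x) ^ N" using add_mono[OF D(2)[of x] one] by (simp add: distrib_right)
      then show ?thesis using C(1) l by (intro mult_left_mono power_mono) auto
    qed
    also have "\<dots> = (C * (D + 1) ^ M) * (1 + norm x) ^ (M + N * M)"
    proof -
      have "(w * ((D + 1) * w ^ N)) ^ M = (D + 1) ^ M * w ^ (M + N * M)" for w :: real
        by (simp add: power_mult_distrib power_add power_mult)
      then show ?thesis by (simp only: mult.assoc)
    qed
    finally show ?thesis .
  qed
  obtain p where p: "\<And>x. x \<in> regular_points P \<Longrightarrow> h x = poly p x"
    by (rule polynomial_of_growth[OF finite_irregular hol _ growth]) (use C(1) D(1) in \<open>auto intro: that\<close>)
  have "F z = poly p (proj z) / poly (lead_coeff P ^ M) (proj z)" if z: "z \<notin> bad" for z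
    using p[OF proj_regular(1)[OF z]] regular_pointD(1)[OF degree_pos proj_regular(1)[OF z]] Ff[OF z]
    by (simp add: h_def poly_power field_simps)
  then show ?thesis by (rule that)
qed

subsection \<open>Descending from the deck group to the trivial group\<close>

text \<open>
  All invariants of \<open>S\<close> in the ring generated by the branches become radical expressions on \<open>U\<close> after
  composition with the local section \<open>\<sigma>\<close> of the covering.  A larger \<open>S\<close> makes this weaker.
\<close>

definition radical_invariants :: "complex set \<Rightarrow> (complex \<Rightarrow> complex) \<Rightarrow> (complex \<Rightarrow> complex) set \<Rightarrow> bool" where
  "radical_invariants U \<sigma> S \<longleftrightarrow>
     (\<forall>F\<in>branch_ring. (\<forall>g\<in>S. F \<circ> g = F) \<longrightarrow> radical_on U (F \<circ> \<sigma>))"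

text \<open>
  The resolvents of \<open>F\<close> with respect to \<open>t\<close> are again invariant under \<open>S\<close> by the assumption on \<open>t\<close>.
  Composition with \<open>t\<close> multiplies them by an \<open>m\<close>-th root of unity, so their \<open>m\<close>-th powers are also
  invariant under \<open>t\<close>.
\<close>

lemma radical_invariants_remove:
  assumes \<sigma>: "\<sigma> holomorphic_on U" "\<sigma> ` U \<subseteq> - bad" and t: "t \<in> deck"
    and normal: "\<And>F. F \<in> branch_ring \<Longrightarrow> (\<forall>g\<in>S. F \<circ> g = F) \<Longrightarrow> (\<forall>g\<in>S. F \<circ> t \<circ> g = F \<circ> t)"
    and rad: "radical_invariants U \<sigma> (insert t S)"
  shows "radical_invariants U \<sigma> S"
  unfolding radical_invariants_def
proof (intro ballI impI)
  fix F assume F: "F \<in> branch_ring" "\<forall>g\<in>S. F \<circ> g = F"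
  obtain m where m: "m > 0" "\<And>F. F \<in> branch_ring \<Longrightarrow> F \<circ> (t ^^ m) = F" by (rule deck_finite_order[OF t]) (rule that)
  define \<zeta> where "\<zeta> = exp (2 * of_real pi * \<i> / of_nat m)"
  note \<zeta> = resolvent_inversion[OF m(1), folded \<zeta>_def]
  define L where "L k = (\<lambda>z. \<Sum>j<m. (\<zeta> ^ k) ^ j * (F \<circ> (t ^^ j)) z)" for k
  have Ft: "F \<circ> (t ^^ j) \<in> branch_ring" for j by (rule branch_ring_deck[OF F(1) deck_power[OF t]])
  have Ft_inv: "\<forall>g\<in>S. F \<circ> (t ^^ j) \<circ> g = F \<circ> (t ^^ j)" for j
  proof (induct j)
    case (Suc j)
    have "F \<circ> (t ^^ Suc j) = F \<circ> (t ^^ j) \<circ> t" by (simp add: funpow_Suc_right o_assoc del: funpow.simps)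
    then show ?case using normal[OF Ft Suc] by (simp only:)
  qed (use F(2) in auto)
  have L_ring: "L k \<in> branch_ring" for k
    unfolding L_def by (intro branch_ring_sum branch_ring.mult branch_ring.const Ft)
  have L_inv: "L k \<circ> g = L k" if "g \<in> S" for k g
    using Ft_inv that by (auto simp: L_def fun_eq_iff)
  have L_t: "\<zeta> ^ k * L k (t z) = L k z" for k z
  proof -
    have "(\<zeta> ^ k) ^ m = 1" using \<zeta>(1) by (metis power_mult mult.commute power_one)
    moreover have "(F \<circ> (t ^^ m)) z = (F \<circ> (t ^^ 0)) z" using m(2)[OF F(1)] by simp
    ultimately have "\<zeta> ^ k * (\<Sum>j<m. (\<zeta> ^ k) ^ j * (F \<circ> (t ^^ Suc j)) z) = (\<Sum>j<m. (\<zeta> ^ k) ^ j * (F \<circ> (t ^^ j)) z)"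
      by (rule resolvent_shift[where f = "\<lambda>j. (F \<circ> (t ^^ j)) z"])
    moreover have "(F \<circ> (t ^^ j)) (t z) = (F \<circ> (t ^^ Suc j)) z" for j
      by (simp add: funpow_swap1)
    ultimately show ?thesis by (simp only: L_def)
  qed
  have "radical_on U (L k \<circ> \<sigma>)" for k
  proof -
    have "(\<lambda>z. L k z ^ m) \<circ> g = (\<lambda>z. L k z ^ m)" if "g \<in> insert t S" for g
    proof (cases "g = t")
      case True
      have "L k (t z) ^ m = L k z ^ m" for z
      proof -
        have "L k z ^ m = (\<zeta> ^ k) ^ m * L k (t z) ^ m" by (simp add: L_t[symmetric, of k z] power_mult_distrib)
        also have "(\<zeta> ^ k) ^ m = 1" using \<zeta>(1) by (metis power_mult mult.commute power_one)
        finally show ?thesis by simp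
      qed
      then show ?thesis using True by auto
    next
      case False
      then have "g \<in> S" using that by simp
      from L_inv[OF this, of k] have "L k (g z) = L k z" for z by (metis o_apply)
      then show ?thesis by auto
    qed
    then have "radical_on U ((\<lambda>z. L k z ^ m) \<circ> \<sigma>)"
      using rad branch_ring_power[OF L_ring] unfolding radical_invariants_def by blast
    moreover have "(L k \<circ> \<sigma>) holomorphic_on U"
      using branch_ring_holomorphic[OF L_ring] \<sigma> by (intro holomorphic_on_compose_gen)
    ultimately show ?thesis using m(1) by (rule radical_on.root) simp
  qed
  then have "radical_on U (\<lambda>x. (1 / of_nat m) * (\<Sum>k<m. (L k \<circ> \<sigma>) x))"
    by (intro radical_on.mult radical_on_const radical_on_sum)
  moreover have "(\<Sum>k<m. (L k \<circ> \<sigma>) x) = of_nat m * (F \<circ> \<sigma>) x" for x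
    using \<zeta>(2)[of "\<lambda>j. (F \<circ> (t ^^ j)) (\<sigma> x)"] by (simp add: L_def)
  moreover have "(F \<circ> \<sigma>) holomorphic_on U"
    using branch_ring_holomorphic[OF F(1)] \<sigma> by (intro holomorphic_on_compose_gen)
  ultimately show "radical_on U (F \<circ> \<sigma>)"
    using m(1) by (elim radical_on_cong) auto
qed

definition deck_translations :: "(complex \<Rightarrow> complex) set" where
  "deck_translations = {g \<in> deck. \<exists>b. \<forall>z. g z = z + b}"

text \<open>
  The linear parts of affine maps commute.
\<close>

lemma deck_commute_up_to_translation:
  assumes "g \<in> deck" "s \<in> deck"
  obtains \<tau> where "\<tau> \<in> deck_translations" "g \<circ> s = \<tau> \<circ> (s \<circ> g)"
proof -
  obtain a b where g: "\<And>z. g z = a * z + b" by (rule deck_affine[OF assms(1)]) (rule that)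
  obtain c d where s: "\<And>z. s z = c * z + d" by (rule deck_affine[OF assms(2)]) (rule that)
  define \<tau> where "\<tau> = (g \<circ> s) \<circ> inv_into UNIV (s \<circ> g)"
  have sg: "s \<circ> g \<in> deck" by (rule deck_comp[OF assms(2,1)])
  then have bij: "bij (s \<circ> g)" by (simp add: deck_def)
  have \<tau>: "\<tau> (s (g z)) = g (s z)" for z
    using inv_f_f[OF bij_is_inj[OF bij], of z] by (simp add: \<tau>_def)
  have "\<tau> w = w + (a * d + b - c * b - d)" for w
  proof -
    obtain z where "w = s (g z)" using bij_is_surj[OF bij] by (metis o_apply surjD)
    then show ?thesis using \<tau>[of z] by (simp add: g s algebra_simps)
  qed
  moreover have "\<tau> \<in> deck" unfolding \<tau>_def by (intro deck_comp[OF deck_comp[OF assms] deck_inv[OF sg]])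
  ultimately have "\<tau> \<in> deck_translations" by (auto simp: deck_translations_def)
  moreover have "g \<circ> s = \<tau> \<circ> (s \<circ> g)" using \<tau> by (simp add: fun_eq_iff)
  ultimately show ?thesis by (rule that)
qed

text \<open>
  The action of \<open>D\<close> on the branches is that of finitely many of its elements, which are removed one by one.
  The commutation relation says that composition with \<open>t\<close> preserves the invariants of \<open>T\<close> and of
  the elements that are left.
\<close>

lemma radical_invariants_descend:
  assumes \<sigma>: "\<sigma> holomorphic_on U" "\<sigma> ` U \<subseteq> - bad" and D: "D \<subseteq> deck"
    and comm: "\<And>t g. t \<in> D \<Longrightarrow> g \<in> D \<union> T \<Longrightarrow> \<exists>\<tau>\<in>insert id T. t \<circ> g = \<tau> \<circ> (g \<circ> t)"
    and rad: "radical_invariants U \<sigma> (D \<union> T)"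
  shows "radical_invariants U \<sigma> T"
proof -
  obtain S where S: "finite S" "S \<subseteq> D" "\<And>g F. g \<in> D \<Longrightarrow> F \<in> branch_ring \<Longrightarrow> \<exists>h\<in>S. F \<circ> g = F \<circ> h"
    by (rule finite_representatives[OF D]) (rule that)
  have "radical_invariants U \<sigma> (S \<union> T)"
    unfolding radical_invariants_def
  proof (intro ballI impI)
    fix F assume F: "F \<in> branch_ring" "\<forall>g\<in>S \<union> T. F \<circ> g = F"
    then have "F \<circ> g = F" if "g \<in> D \<union> T" for g using S(3)[OF _ F(1), of g] that by auto
    then show "radical_on U (F \<circ> \<sigma>)" using rad F(1) unfolding radical_invariants_def by blast
  qed
  with S(1,2) show ?thesis
  proof (induct S rule: finite_induct)
    case (insert t S)
    have "radical_invariants U \<sigma> (S \<union> T)"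
    proof (rule radical_invariants_remove[OF \<sigma>, of t])
      show "t \<in> deck" using insert D by auto
      show "radical_invariants U \<sigma> (insert t (S \<union> T))" using insert by simp
      fix F assume F: "F \<in> branch_ring" "\<forall>g\<in>S \<union> T. F \<circ> g = F"
      show "\<forall>g\<in>S \<union> T. F \<circ> t \<circ> g = F \<circ> t"
      proof
        fix g assume g: "g \<in> S \<union> T"
        then have "t \<in> D" "g \<in> D \<union> T" using insert by auto
        from comm[OF this] obtain \<tau> where \<tau>: "\<tau> \<in> insert id T" "t \<circ> g = \<tau> \<circ> (g \<circ> t)" by blast
        have "F \<circ> t \<circ> g = F \<circ> \<tau> \<circ> g \<circ> t" using \<tau>(2) by (simp add: o_assoc[symmetric])
        also have "F \<circ> \<tau> = F" using F(2) \<tau>(1) by auto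
        also have "F \<circ> g = F" using F(2) g by blast
        finally show "F \<circ> t \<circ> g = F \<circ> t" .
      qed
    qed
    then show ?case using insert by simp
  qed simp
qed

text \<open>
  The group descends in two commutative steps: from all deck transformations to the translations,
  and from the translations to the trivial group.
\<close>

lemma radical_invariants_trivial:
  assumes \<sigma>: "\<sigma> holomorphic_on U" "\<sigma> ` U \<subseteq> - bad" "\<And>x. x \<in> U \<Longrightarrow> proj (\<sigma> x) = x"
  shows "radical_invariants U \<sigma> {}"
proof -
  have deck: "radical_invariants U \<sigma> deck"
    unfolding radical_invariants_def
  proof (intro ballI impI)
    fix F assume F: "F \<in> branch_ring" "\<forall>g\<in>deck. F \<circ> g = F"
    obtain p n where pn: "\<And>z. z \<notin> bad \<Longrightarrow> F z = poly p (proj z) / poly (lead_coeff P ^ n) (proj z)"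
      using deck_invariant_rational[OF F(1)] F(2) by metis
    have reg: "x \<in> regular_points P" if "x \<in> U" for x
      using proj_regular(1)[of "\<sigma> x"] \<sigma>(2,3) that by auto
    have "radical_on U (\<lambda>x. poly p x / poly (lead_coeff P ^ n) x)"
      using regular_pointD(1)[OF degree_pos reg] by (intro radical_on.rational) (simp add: poly_power)
    moreover have "(F \<circ> \<sigma>) holomorphic_on U"
      using branch_ring_holomorphic[OF F(1)] \<sigma>(1,2) by (intro holomorphic_on_compose_gen)
    ultimately show "radical_on U (F \<circ> \<sigma>)"
      by (rule radical_on_cong) (use pn \<sigma>(2,3) in auto)
  qed
  have sub: "deck_translations \<subseteq> deck" by (auto simp: deck_translations_def)
  then have "radical_invariants U \<sigma> (deck \<union> deck_translations)" using deck by (simp add: Un_absorb2)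
  then have "radical_invariants U \<sigma> deck_translations"
    using deck_commute_up_to_translation sub by (elim radical_invariants_descend[OF \<sigma>(1,2), rotated 2]) blast+
  then show ?thesis
    by (intro radical_invariants_descend[OF \<sigma>(1,2) sub, of "{}"]) (auto simp: deck_translations_def fun_eq_iff)
qed

theorem expressible: "expressible_in_radicals P"
  unfolding expressible_in_radicals_def
proof (intro allI impI, elim conjE)
  fix V y assume V: "open V" "V \<noteq> {}" "y holomorphic_on V" "\<forall>x\<in>V. y x \<in> fiber P x"
  have "V - (- regular_points P) \<noteq> {}"
    using V(1,2) finite_irregular by (intro open_minus_countable_nonempty countable_finite)
  then obtain x where x: "x \<in> V" "x \<in> regular_points P" by blast
  obtain d \<sigma> where \<sigma>: "d > 0" "ball x d \<subseteq> regular_points P" "\<sigma> holomorphic_on ball x d"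
    "\<And>x'. x' \<in> ball x d \<Longrightarrow> \<sigma> x' \<notin> bad" "\<And>x'. x' \<in> ball x d \<Longrightarrow> proj (\<sigma> x') = x'"
    by (rule local_section[OF x(2)]) (rule that)
  have "open (V \<inter> ball x d)" "x \<in> V \<inter> ball x d" using V(1) x(1) \<sigma>(1) by auto
  then obtain r where r: "r > 0" "ball x r \<subseteq> V \<inter> ball x d" using open_contains_ball by blast
  define U where "U = ball x r"
  have U: "open U" "connected U" "U \<noteq> {}" "U \<subseteq> V" "U \<subseteq> ball x d" "x \<in> U" using r by (auto simp: U_def)
  have hol: "\<sigma> holomorphic_on U" using \<sigma>(3) U(5) holomorphic_on_subset by blast
  have im: "\<sigma> ` U \<subseteq> - bad" using \<sigma>(4) U(5) by auto
  have sec: "proj (\<sigma> x') = x'" if "x' \<in> U" for x' using \<sigma>(5) U(5) that by blast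
  obtain Y where Y: "Y \<in> branches" "Y (\<sigma> x) = y x"
  proof (rule branch_through[of "\<sigma> x" "y x"])
    show "\<sigma> x \<notin> bad" using im U(6) by blast
    show "y x \<in> fiber P (proj (\<sigma> x))" using sec[OF U(6)] V(4) x(1) by simp
  qed (rule that)
  have Y\<sigma>: "(Y \<circ> \<sigma>) holomorphic_on U"
    using branchesD(1)[OF Y(1)] hol im by (intro holomorphic_on_compose_gen)
  have yU: "y holomorphic_on U" using V(3) U(4) holomorphic_on_subset by blast
  have eq: "y x' = (Y \<circ> \<sigma>) x'" if x': "x' \<in> U" for x'
  proof (rule section_unique[OF degree_pos U(2) continuous_on_id _ _ _ _ _ U(6) _ x'])
    show "(\<lambda>x. x) ` U \<subseteq> regular_points P" using U(5) \<sigma>(2) by auto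
    show "continuous_on U y" "continuous_on U (Y \<circ> \<sigma>)"
      using yU Y\<sigma> holomorphic_on_imp_continuous_on by blast+
    show "y t \<in> fiber P t" if "t \<in> U" for t using V(4) U(4) that by blast
    show "(Y \<circ> \<sigma>) t \<in> fiber P t" if "t \<in> U" for t
      using branchesD(2)[OF Y(1), of "\<sigma> t"] im sec[OF that] that by auto
    show "y x = (Y \<circ> \<sigma>) x" using Y(2) by simp
  qed
  have "radical_on U (Y \<circ> \<sigma>)"
    using radical_invariants_trivial[OF hol im sec] branch_ring.branch[OF Y(1)]
    unfolding radical_invariants_def by simp
  then have "radical_on U y" using yU eq by (rule radical_on_cong)
  then show "\<exists>U\<subseteq>V. open U \<and> connected U \<and> U \<noteq> {} \<and> radical_on U y"
    using U(1-4) by (intro exI[of _ U] conjI)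
qed

end

theorem theorem10:
  fixes A :: "sphere set" and R :: "sphere \<Rightarrow> nat"
  assumes "is_signature A R" and "parabolic A R"
  shows "(\<forall>P. algebraic_function P \<and> has_signature P A R \<longrightarrow> expressible_in_radicals P) \<and>
    (\<exists>G :: (complex \<Rightarrow> complex) monoid. group G \<and>
      (\<forall>P x0. algebraic_function P \<and> has_signature P A R \<and> x0 \<in> regular_points P \<longrightarrow>
        (\<exists>N. N \<lhd> G \<and> comm_group (G\<lparr>carrier := N\<rparr>) \<and> monodromy_group P x0 \<cong> G Mod N)))"
proof -
  obtain \<pi> where "universal_covering_by_line A R \<pi>" using assms(2) unfolding parabolic_def by blast
  then interpret line_covering A R \<pi> by unfold_locales
  have uniformized: "line_uniformized A R \<pi> P" if "algebraic_function P" "has_signature P A R" for P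
    using that by unfold_locales
  show ?thesis
  proof (intro conjI exI[of _ deck_group] allI impI group_deck)
    show "expressible_in_radicals P" if "algebraic_function P \<and> has_signature P A R" for P
      using that line_uniformized.expressible[OF uniformized] by blast
    show "\<exists>N. N \<lhd> deck_group \<and> comm_group (deck_group\<lparr>carrier := N\<rparr>) \<and> monodromy_group P x0 \<cong> deck_group Mod N"
      if "algebraic_function P \<and> has_signature P A R \<and> x0 \<in> regular_points P" for P x0
      using that line_uniformized.monodromy_group_quotient[OF uniformized] by blast
  qed
qed

end
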